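(* Let $M$ be a totally real surface of the nearly Kähler $\mathbb{C}P^3$ that is also totally geodesic for Kähler $\mathbb{C}P^3$, i.e. totally geodesic in $(\mathbb{C}P^3,g_\circ)$. (i) If $M$ is not minimal in nearly Kähler $\mathbb{C}P^3$, then $M$ is congruent to (an open part of) the $\mathbb{C}P^1$ given by the immersion $$(u,v)\in[0,\pi]\times[0,2\pi]\ \mapsto\ \pi\left(\cos u,\ \tfrac{\sqrt2}{\sqrt3}\, i e^{iv}\sin u,\ 0,\ \tfrac{1}{\sqrt3}e^{iv}\sin u\right).$$ (ii) If $M$ is minimal in nearly Kähler $\mathbb{C}P^3$, then $M$ is congruent to (an open part of) the $\mathbb{R}P^2$ given, for some fixed $c\in\mathbb{R}$, by $$\mathbb{R}P^2\to\mathbb{R}P^3\subset\mathbb{C}P^3:\ [(y_1,y_2,y_3)]\mapsto\pi\left(y_1,\ y_2,\ \cos c\; y_3,\ \sin c\; y_3\right),\qquad (y_1,y_2,y_3)\in\mathbb{S}^2\subset\mathbb{R}^3 .$$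
   Context: Identify $\mathbb{C}^4\cong\mathbb{H}^2$ by $(z_1,z_2,z_3,z_4)\leftrightarrow(z_1+z_2j,\ z_3+z_4j)$, with unit quaternions acting by left multiplication: left multiplication by $i$ is multiplication by the complex scalar $i$, left multiplication by $j$ is $(z_1,z_2,z_3,z_4)\mapsto(-\bar z_2,\bar z_1,-\bar z_4,\bar z_3)$, and $k=ij$. Let $\pi:\mathbb{S}^7\to\mathbb{C}P^3$ be the Hopf fibration ($p\sim e^{i\theta}p$), $g_\circ$ the Fubini–Study metric making $\pi$ a Riemannian submersion from the unit round sphere, and $J_\circ$ the standard complex structure of $\mathbb{C}P^3$. "Kähler $\mathbb{C}P^3$" means $(\mathbb{C}P^3,g_\circ,J_\circ)$. Let $\mathcal{D}_1^2$ be the rank-2 distribution $d\pi(\mathrm{Span}\{jp,kp\})$ at $\pi(p)$ (well defined) and $\mathcal{D}_2^4$ its $g_\circ$-orthogonal complement. Let $P$ be $-1$ on $\mathcal{D}_1^2$ and $+1$ on $\mathcal{D}_2^4$; put $J=PJ_\circ=J_\circ P$ and $g(X,Y)=\tfrac32 g_\circ(X,Y)+\tfrac12 g_\circ(X,PY)$. Then $(\mathbb{C}P^3,g,J)$ is the nearly Kähler $\mathbb{C}P^3$. A surface $M$ (connected immersed 2-dimensional submanifold) is totally real in nearly Kähler $\mathbb{C}P^3$ if $J(TM)$ is $g$-orthogonal to $TM$. Minimal in nearly Kähler $\mathbb{C}P^3$ means zero mean curvature vector in $(\mathbb{C}P^3,g)$. Two submanifolds are congruent if some isometry of $(\mathbb{C}P^3,g)$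 maps one to the other. *)

theory Defs
  imports "HOL-Analysis.Analysis"
begin

section \<open>Smooth manifolds and smooth maps\<close>

text \<open>\<open>Ck_on k S f\<close> is only meant for open \<open>S\<close>: the derivatives are taken in the full space.\<close>

primrec Ck_on :: "nat \<Rightarrow> 'a set \<Rightarrow> ('a::euclidean_space \<Rightarrow> 'b::euclidean_space) \<Rightarrow> bool" where
  "Ck_on 0 S f \<longleftrightarrow> continuous_on S f"
| "Ck_on (Suc k) S f \<longleftrightarrow> (\<forall>x\<in>S. f differentiable (at x)) \<and>
     (\<forall>v. Ck_on k S (\<lambda>x. frechet_derivative f (at x) v))"

definition smooth_on :: "'a set \<Rightarrow> ('a::euclidean_space \<Rightarrow> 'b::euclidean_space) \<Rightarrow> bool" where
  "smooth_on S f \<longleftrightarrow> (\<forall>k. Ck_on k S f)"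

type_synonym ('m, 'e) chart = "'m set \<times> ('m \<Rightarrow> 'e)"

definition chart_inv :: "('m, 'e) chart \<Rightarrow> 'e \<Rightarrow> 'm" where
  "chart_inv c = inv_into (fst c) (snd c)"

text \<open>Coordinate expression of a map \<open>f\<close> with respect to a chart \<open>c\<close> of its source and a chart
  \<open>d\<close> of its target, and the set of coordinates on which it is defined.\<close>

definition rep_dom :: "('m, 'e) chart \<Rightarrow> ('n, 'k) chart \<Rightarrow> ('m \<Rightarrow> 'n) \<Rightarrow> 'e set" where
  "rep_dom c d f = snd c ` (fst c \<inter> f -` fst d)"

definition rep :: "('m, 'e) chart \<Rightarrow> ('n, 'k) chart \<Rightarrow> ('m \<Rightarrow> 'n) \<Rightarrow> 'e \<Rightarrow> 'k" where
  "rep c d f = snd d \<circ> f \<circ> chart_inv c"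

definition smooth_atlas :: "'m topology \<Rightarrow> ('m, 'e::euclidean_space) chart set \<Rightarrow> bool" where
  "smooth_atlas X A \<longleftrightarrow>
     (\<forall>c\<in>A. openin X (fst c) \<and> open (snd c ` fst c) \<and>
        homeomorphic_map (subtopology X (fst c)) (top_of_set (snd c ` fst c)) (snd c)) \<and>
     (\<Union>c\<in>A. fst c) = topspace X \<and>
     (\<forall>c\<in>A. \<forall>d\<in>A. smooth_on (rep_dom c d id) (rep c d id))"

definition second_countable_space :: "'m topology \<Rightarrow> bool" where
  "second_countable_space X \<longleftrightarrow>
     (\<exists>\<B>. countable \<B> \<and> (\<forall>B\<in>\<B>. openin X B) \<and>
        (\<forall>U x. openin X U \<and> x \<in> U \<longrightarrow> (\<exists>B\<in>\<B>. x \<in> B \<and> B \<subseteq> U)))"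

definition smooth_manifold :: "'m topology \<Rightarrow> ('m, 'e::euclidean_space) chart set \<Rightarrow> bool" where
  "smooth_manifold X A \<longleftrightarrow>
     Hausdorff_space X \<and> second_countable_space X \<and> smooth_atlas X A"

definition smooth_map ::
    "'m topology \<Rightarrow> ('m, 'e::euclidean_space) chart set \<Rightarrow>
     'n topology \<Rightarrow> ('n, 'k::euclidean_space) chart set \<Rightarrow> ('m \<Rightarrow> 'n) \<Rightarrow> bool" where
  "smooth_map X A Y B f \<longleftrightarrow>
     continuous_map X Y f \<and> (\<forall>c\<in>A. \<forall>d\<in>B. smooth_on (rep_dom c d f) (rep c d f))"

definition immersion ::
    "'m topology \<Rightarrow> ('m, 'e::euclidean_space) chart set \<Rightarrow>
     'n topology \<Rightarrow> ('n, 'k::euclidean_space) chart set \<Rightarrow> ('m \<Rightarrow> 'n) \<Rightarrow> bool" where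
  "immersion X A Y B f \<longleftrightarrow>
     smooth_map X A Y B f \<and>
     (\<forall>c\<in>A. \<forall>d\<in>B. \<forall>q\<in>rep_dom c d f. inj (frechet_derivative (rep c d f) (at q)))"

definition diffeomorphism ::
    "'m topology \<Rightarrow> ('m, 'e::euclidean_space) chart set \<Rightarrow>
     'n topology \<Rightarrow> ('n, 'k::euclidean_space) chart set \<Rightarrow> ('m \<Rightarrow> 'n) \<Rightarrow> bool" where
  "diffeomorphism X A Y B f \<longleftrightarrow>
     bij_betw f (topspace X) (topspace Y) \<and>
     smooth_map X A Y B f \<and> smooth_map Y B X A (inv_into (topspace X) f)"


section \<open>Riemannian geometry in charts\<close>

text \<open>A metric in coordinates, \<open>G x u v\<close>, is a family of inner products indexed by the points \<open>x\<close>
  of the coordinate domain; a metric on a manifold assigns such a family to every chart.\<close>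

type_synonym 'e coord_metric = "'e \<Rightarrow> 'e \<Rightarrow> 'e \<Rightarrow> real"

text \<open>\<open>christoffel G x u v\<close> is \<open>\<nabla>\<^sub>u v\<close> at \<open>x\<close> for the Levi-Civita connection of \<open>G\<close> and
  constant coordinate fields \<open>u\<close>, \<open>v\<close>, as given by the Koszul formula.\<close>

definition christoffel :: "'e::euclidean_space coord_metric \<Rightarrow> 'e \<Rightarrow> 'e \<Rightarrow> 'e \<Rightarrow> 'e" where
  "christoffel G x u v =
     (let dG = (\<lambda>a b c. frechet_derivative (\<lambda>y. G y b c) (at x) a)
      in THE w. \<forall>z. G x w z = (dG u v z + dG v u z - dG z u v) / 2)"

text \<open>\<open>\<nabla>\<^sub>u (dF v)\<close> along the map \<open>F\<close>, for constant coordinate fields \<open>u\<close>, \<open>v\<close> of the source.\<close>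

definition cov_deriv_along ::
    "'e::euclidean_space coord_metric \<Rightarrow> ('a::euclidean_space \<Rightarrow> 'e) \<Rightarrow> 'a \<Rightarrow> 'a \<Rightarrow> 'a \<Rightarrow> 'e" where
  "cov_deriv_along G F q u v =
     frechet_derivative (\<lambda>t. frechet_derivative F (at t) v) (at q) u +
     christoffel G (F q) (frechet_derivative F (at q) u) (frechet_derivative F (at q) v)"

definition normal_part :: "('e::euclidean_space \<Rightarrow> 'e \<Rightarrow> real) \<Rightarrow> 'e set \<Rightarrow> 'e \<Rightarrow> 'e" where
  "normal_part h T w = (THE n. (\<forall>t\<in>T. h n t = 0) \<and> w - n \<in> T)"

definition second_ff ::
    "'e::euclidean_space coord_metric \<Rightarrow> ('a::euclidean_space \<Rightarrow> 'e) \<Rightarrow> 'a \<Rightarrow> 'a \<Rightarrow> 'a \<Rightarrow> 'e" where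
  "second_ff G F q u v =
     normal_part (G (F q)) (range (frechet_derivative F (at q))) (cov_deriv_along G F q u v)"

text \<open>Mean curvature vector of a surface: half the trace of the second fundamental form over any
  basis that is orthonormal for the induced metric.\<close>

definition mean_curvature ::
    "'e::euclidean_space coord_metric \<Rightarrow> (real^2 \<Rightarrow> 'e) \<Rightarrow> real^2 \<Rightarrow> 'e" where
  "mean_curvature G F q =
     (let I = (\<lambda>u v. G (F q) (frechet_derivative F (at q) u) (frechet_derivative F (at q) v))
      in THE H. \<forall>e1 e2. I e1 e1 = 1 \<and> I e2 e2 = 1 \<and> I e1 e2 = 0 \<longrightarrow>
           H = (1/2) *\<^sub>R (second_ff G F q e1 e1 + second_ff G F q e2 e2))"

definition totally_geodesic ::
    "('m, 'a::euclidean_space) chart set \<Rightarrow> ('n, 'e::euclidean_space) chart set \<Rightarrow>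
     (('n, 'e) chart \<Rightarrow> 'e coord_metric) \<Rightarrow> ('m \<Rightarrow> 'n) \<Rightarrow> bool" where
  "totally_geodesic A B G f \<longleftrightarrow>
     (\<forall>c\<in>A. \<forall>d\<in>B. \<forall>q\<in>rep_dom c d f. \<forall>u v. second_ff (G d) (rep c d f) q u v = 0)"

definition minimal_surface ::
    "('m, real^2) chart set \<Rightarrow> ('n, 'e::euclidean_space) chart set \<Rightarrow>
     (('n, 'e) chart \<Rightarrow> 'e coord_metric) \<Rightarrow> ('m \<Rightarrow> 'n) \<Rightarrow> bool" where
  "minimal_surface A B G f \<longleftrightarrow>
     (\<forall>c\<in>A. \<forall>d\<in>B. \<forall>q\<in>rep_dom c d f. mean_curvature (G d) (rep c d f) q = 0)"

text \<open>Likewise, \<open>J d x\<close> is the coordinate expression in the chart \<open>d\<close> of an endomorphism field.\<close>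

definition totally_real ::
    "('m, 'a::euclidean_space) chart set \<Rightarrow> ('n, 'e::euclidean_space) chart set \<Rightarrow>
     (('n, 'e) chart \<Rightarrow> 'e coord_metric) \<Rightarrow> (('n, 'e) chart \<Rightarrow> 'e \<Rightarrow> 'e \<Rightarrow> 'e) \<Rightarrow>
     ('m \<Rightarrow> 'n) \<Rightarrow> bool" where
  "totally_real A B G J f \<longleftrightarrow>
     (\<forall>c\<in>A. \<forall>d\<in>B. \<forall>q\<in>rep_dom c d f. \<forall>u v.
        let x = rep c d f q; df = frechet_derivative (rep c d f) (at q)
        in G d x (J d x (df u)) (df v) = 0)"

definition isometry ::
    "'n topology \<Rightarrow> ('n, 'e::euclidean_space) chart set \<Rightarrow>
     (('n, 'e) chart \<Rightarrow> 'e coord_metric) \<Rightarrow> ('n \<Rightarrow> 'n) \<Rightarrow> bool" where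
  "isometry Y B G \<phi> \<longleftrightarrow>
     diffeomorphism Y B Y B \<phi> \<and>
     (\<forall>c\<in>B. \<forall>d\<in>B. \<forall>x\<in>rep_dom c d \<phi>. \<forall>u v.
        let d\<phi> = frechet_derivative (rep c d \<phi>) (at x)
        in G d (rep c d \<phi> x) (d\<phi> u) (d\<phi> v) = G c x u v)"

definition congruent_to_open_part ::
    "'n topology \<Rightarrow> ('n, 'e::euclidean_space) chart set \<Rightarrow>
     (('n, 'e) chart \<Rightarrow> 'e coord_metric) \<Rightarrow> 'n set \<Rightarrow> 'n set \<Rightarrow> bool" where
  "congruent_to_open_part Y B G S T \<longleftrightarrow>
     (\<exists>\<phi>. isometry Y B G \<phi> \<and> \<phi> ` S \<subseteq> T \<and> openin (subtopology Y T) (\<phi> ` S))"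


section \<open>The complex projective space\<close>

text \<open>Points of the projective space are the fibres of the Hopf fibration.\<close>

definition hopf :: "complex^4 \<Rightarrow> (complex^4) set" where
  "hopf p = {cis \<theta> *s p | \<theta>. True}"

definition CP3 :: "(complex^4) set topology" where
  "CP3 = topology (\<lambda>U. U \<subseteq> hopf ` sphere 0 1 \<and>
           openin (top_of_set (sphere 0 1)) {p \<in> sphere 0 1. hopf p \<in> U})"

lemma openin_CP3:
  "openin CP3 U \<longleftrightarrow> U \<subseteq> hopf ` sphere 0 1 \<and>
     openin (top_of_set (sphere 0 1)) {p \<in> sphere 0 1. hopf p \<in> U}"
proof -
  let ?P = "\<lambda>U. {p \<in> sphere 0 1. hopf p \<in> U}"
  let ?S = "top_of_set (sphere (0::complex^4) 1)"
  have "istopology (\<lambda>U. U \<subseteq> hopf ` sphere 0 1 \<and> openin ?S (?P U))"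
    unfolding istopology_def
  proof (intro conjI allI impI)
    fix U V assume U: "U \<subseteq> hopf ` sphere 0 1 \<and> openin ?S (?P U)"
      and V: "V \<subseteq> hopf ` sphere 0 1 \<and> openin ?S (?P V)"
    show "U \<inter> V \<subseteq> hopf ` sphere 0 1"
      using U by (meson le_infI1)
    have "?P (U \<inter> V) = ?P U \<inter> ?P V" by (rule set_eqI) (simp, argo)
    then show "openin ?S (?P (U \<inter> V))"
      using openin_Int[OF conjunct2[OF U] conjunct2[OF V]] by (simp only:)
  next
    fix K assume K: "\<forall>U\<in>K. U \<subseteq> hopf ` sphere 0 1 \<and> openin ?S (?P U)"
    show "\<Union>K \<subseteq> hopf ` sphere 0 1"
      using K by (meson Sup_least)
    have "?P (\<Union>K) = \<Union>(?P ` K)" by (rule set_eqI) simp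
    moreover have "openin ?S (\<Union>(?P ` K))"
    proof (rule openin_Union)
      fix T assume "T \<in> ?P ` K"
      then obtain U where "T = ?P U" and U: "U \<in> K" by (rule imageE)
      then show "openin ?S T" using conjunct2[OF bspec[OF K U]] by (simp only:)
    qed
    ultimately show "openin ?S (?P (\<Union>K))" by (simp only:)
  qed
  then show ?thesis by (simp only: CP3_def topology_inverse')
qed

lemma topspace_CP3: "topspace CP3 = hopf ` sphere 0 1"
proof (rule subset_antisym)
  show "topspace CP3 \<subseteq> hopf ` sphere 0 1"
    using openin_CP3[of "topspace CP3"] openin_topspace[of CP3] by argo
  have "{p \<in> sphere 0 1. hopf p \<in> hopf ` sphere 0 1} = sphere 0 1"
    by (rule set_eqI) (simp only: mem_Collect_eq image_eqI[OF refl] simp_thms cong: conj_cong)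
  then have "openin CP3 (hopf ` sphere 0 1)"
    unfolding openin_CP3 by (simp only: openin_subtopology_self subset_refl simp_thms)
  then show "hopf ` sphere 0 1 \<subseteq> topspace CP3"
    by (rule openin_subset)
qed

type_synonym CP3_chart = "((complex^4) set, complex^3) chart"

text \<open>The ratios of coordinates do not depend on the point chosen on the fibre.\<close>

definition affine_chart :: "4 \<Rightarrow> 4 \<Rightarrow> 4 \<Rightarrow> 4 \<Rightarrow> CP3_chart" where
  "affine_chart i j k l =
     (hopf ` {p \<in> sphere 0 1. p $ i \<noteq> 0},
      \<lambda>x. let p = (SOME p. p \<in> x) in vector [p $ j / p $ i, p $ k / p $ i, p $ l / p $ i])"

definition CP3_atlas :: "CP3_chart set" where
  "CP3_atlas = {affine_chart 1 2 3 4, affine_chart 2 1 3 4, affine_chart 3 1 2 4, affine_chart 4 1 2 3}"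

definition jmul :: "complex^4 \<Rightarrow> complex^4" where
  "jmul p = vector [- cnj (p $ 2), cnj (p $ 1), - cnj (p $ 4), cnj (p $ 3)]"

definition kmul :: "complex^4 \<Rightarrow> complex^4" where
  "kmul p = \<i> *s jmul p"

text \<open>The differential of the Hopf fibration at a point \<open>p\<close> of the unit sphere, in the chart \<open>d\<close>.
  The fibration is extended radially to non-zero vectors, so that the derivative may be taken in
  the ambient space; only its values on vectors tangent to the sphere are used.\<close>

definition dhopf :: "CP3_chart \<Rightarrow> complex^4 \<Rightarrow> complex^4 \<Rightarrow> complex^3" where
  "dhopf d p = frechet_derivative (\<lambda>z. snd d (hopf (sgn z))) (at p)"

definition horizontal :: "complex^4 \<Rightarrow> (complex^4) set" where
  "horizontal p = {X. X \<bullet> p = 0 \<and> X \<bullet> (\<i> *s p) = 0}"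

definition hlift :: "CP3_chart \<Rightarrow> complex^4 \<Rightarrow> complex^3 \<Rightarrow> complex^4" where
  "hlift d p v = (THE X. X \<in> horizontal p \<and> dhopf d p X = v)"

text \<open>A point of the unit sphere over the point with coordinates \<open>x\<close>. The definitions below do not
  depend on which point of the fibre is chosen.\<close>

definition pt_over :: "CP3_chart \<Rightarrow> complex^3 \<Rightarrow> complex^4" where
  "pt_over d x = (SOME p. p \<in> chart_inv d x)"


section \<open>The Kaehler and the nearly Kaehler structure\<close>

definition g_FS :: "CP3_chart \<Rightarrow> (complex^3) coord_metric" where
  "g_FS d x v w = hlift d (pt_over d x) v \<bullet> hlift d (pt_over d x) w"

definition J_FS :: "CP3_chart \<Rightarrow> complex^3 \<Rightarrow> complex^3 \<Rightarrow> complex^3" where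
  "J_FS d x v = dhopf d (pt_over d x) (\<i> *s hlift d (pt_over d x) v)"

definition D1 :: "CP3_chart \<Rightarrow> complex^3 \<Rightarrow> (complex^3) set" where
  "D1 d x = dhopf d (pt_over d x) ` span {jmul (pt_over d x), kmul (pt_over d x)}"

definition D2 :: "CP3_chart \<Rightarrow> complex^3 \<Rightarrow> (complex^3) set" where
  "D2 d x = {w. \<forall>v\<in>D1 d x. g_FS d x w v = 0}"

definition P_NK :: "CP3_chart \<Rightarrow> complex^3 \<Rightarrow> complex^3 \<Rightarrow> complex^3" where
  "P_NK d x v = (THE w. \<exists>v1\<in>D1 d x. \<exists>v2\<in>D2 d x. v = v1 + v2 \<and> w = - v1 + v2)"

definition J_NK :: "CP3_chart \<Rightarrow> complex^3 \<Rightarrow> complex^3 \<Rightarrow> complex^3" where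
  "J_NK d x v = P_NK d x (J_FS d x v)"

definition g_NK :: "CP3_chart \<Rightarrow> (complex^3) coord_metric" where
  "g_NK d x v w = 3/2 * g_FS d x v w + 1/2 * g_FS d x v (P_NK d x w)"


section \<open>The model surfaces\<close>

definition model_CP1 :: "(complex^4) set set" where
  "model_CP1 =
     {hopf (vector [of_real (cos u),
                    of_real (sqrt 2 / sqrt 3) * \<i> * exp (\<i> * of_real v) * of_real (sin u),
                    0,
                    of_real (1 / sqrt 3) * exp (\<i> * of_real v) * of_real (sin u)]) | u v.
        u \<in> {0..pi} \<and> v \<in> {0..2 * pi}}"

definition model_RP2 :: "real \<Rightarrow> (complex^4) set set" where
  "model_RP2 c =
     {hopf (vector [of_real (y $ 1), of_real (y $ 2),
                    of_real (cos c * y $ 3), of_real (sin c * y $ 3)]) | y.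
        y \<in> sphere (0 :: real^3) 1}"

end

theory Submission
  imports Defs
begin

text \<open>Write points of the projective space as lines through \<open>p\<close> and tangent vectors as horizontal lifts.
  With the complex symplectic form \<open>\<omega>\<close> (\<open>om\<close> below) of \<open>\<complex>\<^sup>4\<close>, the nearly Kaehler metric is
  \<open>2 \<langle>X, Y\<rangle> - Re (\<omega>(p, X) cnj \<omega>(p, Y))\<close>, so the quaternionic unitary maps are isometries.
  If \<open>M\<close> is totally geodesic for the Fubini-Study metric, the curvature tensor of that metric forces each tangent plane to be complex
  or totally real, and by connectedness one of the two cases holds everywhere. The frame formed by the point and its tangent
  plane then satisfies a linear differential equation with complex, respectively real, coefficients,
  so its span \<open>W\<close> is constant up to phase, and \<open>M\<close> is an open part of the projectivization of \<open>W\<close>.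
  Being totally real for the nearly Kaehler structure means \<open>\<bar>\<omega>\<bar>\<^sup>2 = 2/3\<close> on a complex \<open>W\<close>, and that \<open>\<omega>\<close> is real
  up to phase on a real \<open>W\<close>; either condition determines \<open>W\<close> up to a quaternionic unitary map and a phase.
  The second fundamental form for the nearly Kaehler metric is
  \<open>-2 Re (cnj \<omega>(p, X) \<omega>(X, N))\<close> on \<open>(X, X)\<close> in a normal direction \<open>N\<close>: its trace vanishes in the real case
  and does not in the complex case.\<close>

section \<open>Hermitian and symplectic algebra\<close>

text \<open>Four points shape the argument. (a) The frame equation is never solved: a linear
  functional killing the initial frame is followed along a segment; its values satisfy a homogeneous
  linear system and stay 0 by a Gronwall estimate. Real-linear functionals serve the real case,
  complex-linear ones the complex case. (b) The phase by which a lift of the surface differs from a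
  vector of \<open>W\<close> is uncontrolled, so it is replaced by the smooth normalisation
  \<open>herm z p = 1\<close> against a fixed \<open>p\<close>. (c) In the real case the totally
  real condition at one point \<open>p\<close> involves only the values \<open>om p X\<close>. Since
  the image is open in the projectivization of \<open>W\<close>, points \<open>p + s X\<close> near
  \<open>p\<close> supply the value of \<open>om\<close> on the remaining pair. Up to phase
  \<open>om\<close> is then a real skew form on a space of dimension 3, so it has a kernel. A unit
  kernel vector determines the normal form, and it brings every real \<open>W\<close> to the
  parameter \<open>c = 0\<close> of the model family. (d) The number 2/3 is forced by the tangent
  pair \<open>X\<close>, \<open>iX\<close>, for which being totally real reads 2 - 3 |om p X|^2 =
  0.\<close>

definition herm :: "complex^4 \<Rightarrow> complex^4 \<Rightarrow> complex" where
  "herm a b = (\<Sum>m\<in>UNIV. a $ m * cnj (b $ m))"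

text \<open>At a unit vector \<open>p\<close> one has \<open>om p X = herm X (jmul p)\<close>: the
  form reads off the component of \<open>X\<close> along \<open>jmul p\<close>, that is, its part in
  the distribution \<open>D1\<close>.\<close>

definition om :: "complex^4 \<Rightarrow> complex^4 \<Rightarrow> complex" where
  "om a b = a $ 1 * b $ 2 - a $ 2 * b $ 1 + a $ 3 * b $ 4 - a $ 4 * b $ 3"

lemma vector_4 [simp]:
  "(vector [a, b, c, d] :: 'a::zero^4) $ 1 = a"
  "(vector [a, b, c, d] :: 'a::zero^4) $ 2 = b"
  "(vector [a, b, c, d] :: 'a::zero^4) $ 3 = c"
  "(vector [a, b, c, d] :: 'a::zero^4) $ 4 = d"
  unfolding vector_def by simp_all

lemma herm_add: "herm (a + a') b = herm a b + herm a' b" "herm a (b + b') = herm a b + herm a b'"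
  by (simp_all add: herm_def algebra_simps sum.distrib)

lemma herm_scale: "herm (c *s a) b = c * herm a b" "herm a (c *s b) = cnj c * herm a b"
  by (simp_all add: herm_def sum_distrib_left mult_ac)

lemma herm_scaleR: "herm (r *\<^sub>R a) b = r * herm a b" "herm a (r *\<^sub>R b) = r * herm a b"
  by (simp_all add: herm_def sum_distrib_left scaleR_conv_of_real[where 'a=complex] mult_ac)

lemma herm_minus: "herm (- a) b = - herm a b" "herm a (- b) = - herm a b"
  by (simp_all add: herm_def sum_negf)

lemma herm_diff: "herm (a - a') b = herm a b - herm a' b" "herm a (b - b') = herm a b - herm a b'"
  by (simp_all add: herm_def algebra_simps sum_subtractf)

lemma herm_zero [simp]: "herm 0 b = 0" "herm a 0 = 0"
  by (simp_all add: herm_def)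

lemma cnj_herm: "cnj (herm a b) = herm b a"
  by (simp add: herm_def mult_ac)

lemma Re_herm: "Re (herm a b) = a \<bullet> b"
  by (simp add: herm_def inner_vec_def inner_complex_def)

lemma Im_herm: "Im (herm a b) = a \<bullet> (\<i> *s b)"
  by (simp add: Re_herm[symmetric] herm_scale)

lemma herm_self: "herm a a = of_real ((norm a)\<^sup>2)"
proof -
  have "Im (herm a a) = 0" using cnj_herm[of a a] by (simp add: complex_eq_iff)
  then show ?thesis by (simp add: complex_eq_iff Re_herm power2_norm_eq_inner)
qed

lemma scaleR_smult: "r *\<^sub>R (a::complex^4) = of_real r *s a"
  by (simp add: vec_eq_iff scaleR_conv_of_real[where 'a=complex])

lemma norm_smult: "norm (c *s (a::complex^4)) = cmod c * norm a"
proof -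
  have c: "c * cnj c = of_real ((cmod c)\<^sup>2)" by (rule complex_norm_square[symmetric])
  have "of_real ((norm (c *s a))\<^sup>2) = (c * cnj c) * herm a a"
    by (simp only: herm_self[symmetric] herm_scale mult_ac)
  also have "\<dots> = (of_real ((cmod c * norm a)\<^sup>2) :: complex)"
    unfolding c herm_self by (simp add: power_mult_distrib)
  finally have "(norm (c *s a))\<^sup>2 = (cmod c * norm a)\<^sup>2" using of_real_eq_iff by blast
  then show ?thesis by simp
qed

lemma herm_bound: "cmod (herm a b) \<le> norm a * norm b"
proof (cases "herm a b = 0")
  case False
  \<comment> \<open>The phase that makes \<open>herm (e *s a) b\<close> real and nonnegative, so
    that the real Cauchy-Schwarz inequality applies.\<close>
  define e where "e = cnj (herm a b) / of_real (cmod (herm a b))"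
  have "e * herm a b = of_real (cmod (herm a b))"
    using False by (simp add: e_def mult.commute[of "cnj _"] complex_norm_square[symmetric] power2_eq_square)
  then have "cmod (herm a b) = (e *s a) \<bullet> b" by (simp add: Re_herm[symmetric] herm_scale)
  also have "\<dots> \<le> norm (e *s a) * norm b" by (rule norm_cauchy_schwarz)
  also have "norm (e *s a) = norm a" using False by (simp add: norm_smult e_def norm_divide)
  finally show ?thesis .
qed simp

lemma bounded_bilinear_herm: "bounded_bilinear herm"
proof
  show "\<exists>K. \<forall>a b. norm (herm a b) \<le> norm a * norm b * K"
    by (rule exI[of _ 1]) (use herm_bound in \<open>simp add: mult.commute\<close>)
qed (simp_all add: herm_add herm_scaleR scaleR_conv_of_real[where 'a=complex])

lemma jmul_simps [simp]:
  "jmul p $ 1 = - cnj (p $ 2)" "jmul p $ 2 = cnj (p $ 1)"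
  "jmul p $ 3 = - cnj (p $ 4)" "jmul p $ 4 = cnj (p $ 3)"
  by (simp_all add: jmul_def)

lemma jmul_jmul [simp]: "jmul (jmul p) = - p"
  by (simp add: vec_eq_iff forall_4)

lemma jmul_smult: "jmul (c *s p) = cnj c *s jmul p"
  by (simp add: vec_eq_iff forall_4)

lemma jmul_minus: "jmul (- q) = - jmul q"
  by (simp add: vec_eq_iff forall_4)

lemma herm_jmul: "herm (jmul a) (jmul b) = herm b a"
  by (simp add: herm_def sum_4 mult_ac)

lemma om_herm: "om a b = - herm a (jmul b)"
  by (simp add: herm_def sum_4 om_def)

lemma herm_jmul_right: "herm a (jmul b) = - om a b"
  by (simp add: om_herm)

lemma herm_jmul_left: "herm (jmul a) b = - cnj (om b a)"
  by (simp add: om_herm cnj_herm)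

lemma om_jmul: "om (jmul a) b = - herm b a" "om b (jmul a) = herm b a"
  by (simp_all add: om_herm herm_jmul herm_minus)

lemma norm_jmul [simp]: "norm (jmul a) = norm a"
proof -
  have "of_real ((norm (jmul a))\<^sup>2) = (of_real ((norm a)\<^sup>2) :: complex)"
    by (simp only: herm_self[symmetric] herm_jmul)
  then have "(norm (jmul a))\<^sup>2 = (norm a)\<^sup>2" using of_real_eq_iff by blast
  then show ?thesis by simp
qed

lemma om_add: "om (a + a') b = om a b + om a' b" "om a (b + b') = om a b + om a b'"
  by (simp_all add: om_def algebra_simps)

lemma om_diff: "om (a - a') b = om a b - om a' b" "om a (b - b') = om a b - om a b'"
  by (simp_all add: om_def algebra_simps)

lemma om_minus: "om (- a) b = - om a b" "om a (- b) = - om a b"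
  by (simp_all add: om_def algebra_simps)

lemma om_scale: "om (c *s a) b = c * om a b" "om a (c *s b) = c * om a b"
  by (simp_all add: om_def algebra_simps)

lemma om_scaleR: "om (r *\<^sub>R a) b = r * om a b" "om a (r *\<^sub>R b) = r * om a b"
  by (simp_all add: scaleR_smult om_scale)

lemma om_zero [simp]: "om 0 b = 0" "om a 0 = 0"
  by (simp_all add: om_def)

lemma om_self [simp]: "om a a = 0"
  by (simp add: om_def)

lemma om_swap: "om a b = - om b a"
  by (simp add: om_def)

lemma bounded_bilinear_om: "bounded_bilinear om"
proof
  show "\<exists>K. \<forall>a b. norm (om a b) \<le> norm a * norm b * K"
    by (rule exI[of _ 1]) (use herm_bound[of _ "jmul _"] in \<open>simp add: mult.commute om_herm\<close>)
qed (simp_all add: om_add om_scaleR scaleR_conv_of_real[where 'a=complex])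

lemma smult_assoc: "a *s (b *s (v::complex^4)) = (a * b) *s v"
  by (simp add: vec_eq_iff)

text \<open>Orthonormality says that the matrix with rows \<open>u m\<close> has its conjugate
  transpose as right inverse. For a square matrix it is then also a left inverse, which is
  completeness.\<close>

lemma herm_orthonormal_expansion:
  fixes u :: "4 \<Rightarrow> complex^4"
  assumes "\<And>m n. herm (u m) (u n) = (if m = n then 1 else 0)"
  shows "v = (\<Sum>m\<in>UNIV. herm v (u m) *s u m)"
proof -
  define U where "U = (\<chi> m n. u m $ n)"
  define V where "V = (\<chi> n m. cnj (u m $ n))"
  have "U ** V = mat 1"
    using assms by (simp add: U_def V_def matrix_matrix_mult_def mat_def vec_eq_iff herm_def)
  then have VU: "V ** U = mat 1" using matrix_left_right_inverse by blast
  have "v $ n = (\<Sum>m\<in>UNIV. herm v (u m) *s u m) $ n" for n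
  proof -
    have "v $ n = (\<Sum>k\<in>UNIV. v $ k * (V ** U) $ k $ n)"
      unfolding VU by (simp add: mat_def if_distrib cong: if_cong)
    also have "\<dots> = (\<Sum>k\<in>UNIV. \<Sum>m\<in>UNIV. v $ k * cnj (u m $ k) * u m $ n)"
      by (simp add: matrix_matrix_mult_def U_def V_def sum_distrib_left mult_ac)
    also have "\<dots> = (\<Sum>m\<in>UNIV. \<Sum>k\<in>UNIV. v $ k * cnj (u m $ k) * u m $ n)"
      by (rule sum.swap)
    also have "\<dots> = (\<Sum>m\<in>UNIV. herm v (u m) *s u m) $ n"
      by (simp add: herm_def sum_distrib_right)
    finally show ?thesis .
  qed
  then show ?thesis by (simp add: vec_eq_iff)
qed

lemma herm_orthonormal_expansion4:
  assumes "norm a = 1" "norm b = 1" "norm c = 1" "norm d = 1"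
    and "herm a b = 0" "herm a c = 0" "herm a d = 0" "herm b c = 0" "herm b d = 0" "herm c d = 0"
  shows "v = herm v a *s a + herm v b *s b + herm v c *s c + herm v d *s d"
proof -
  define u :: "4 \<Rightarrow> complex^4" where
    "u = (\<lambda>m. if m = 1 then a else if m = 2 then b else if m = 3 then c else d)"
  have sw: "herm b a = 0" "herm c a = 0" "herm d a = 0" "herm c b = 0" "herm d b = 0" "herm d c = 0"
    using assms(5-10) cnj_herm by (metis complex_cnj_zero)+
  have "\<forall>(m::4) (n::4). herm (u m) (u n) = (if m = n then 1 else 0)"
    unfolding forall_4 by (simp add: u_def herm_self assms sw)
  then have "v = (\<Sum>m\<in>UNIV. herm v (u m) *s u m)" by (intro herm_orthonormal_expansion) simp
  then show ?thesis by (simp add: sum_4 u_def)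
qed

subsection \<open>Quaternionic unitary maps\<close>

text \<open>The elements of Sp(2). Commuting with \<open>jmul\<close> is what makes a Hermitian
  isometry preserve \<open>om\<close>.\<close>

definition qunitary :: "(complex^4 \<Rightarrow> complex^4) \<Rightarrow> bool" where
  "qunitary A \<longleftrightarrow> (\<forall>u v. A (u + v) = A u + A v) \<and> (\<forall>c v. A (c *s v) = c *s A v) \<and>
     (\<forall>u v. herm (A u) (A v) = herm u v) \<and> (\<forall>v. A (jmul v) = jmul (A v))"

context
  fixes A assumes A: "qunitary A"
begin

lemma qunitary_add: "A (u + v) = A u + A v" and qunitary_smult: "A (c *s v) = c *s A v"
  and qunitary_herm: "herm (A u) (A v) = herm u v" and qunitary_jmul: "A (jmul v) = jmul (A v)"
  using A by (auto simp: qunitary_def)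

lemma qunitary_scaleR: "A (r *\<^sub>R v) = r *\<^sub>R A v"
  by (simp add: scaleR_smult qunitary_smult)

lemma qunitary_linear: "linear A"
  by (rule linearI) (simp_all add: qunitary_add qunitary_scaleR)

lemma qunitary_bounded_linear: "bounded_linear A"
  by (simp add: linear_linear qunitary_linear)

lemma qunitary_om: "om (A u) (A v) = om u v"
  by (simp add: om_herm qunitary_jmul[symmetric] qunitary_herm)

lemma qunitary_norm: "norm (A u) = norm u"
proof -
  have "of_real ((norm (A u))\<^sup>2) = (of_real ((norm u)\<^sup>2) :: complex)"
    by (simp only: herm_self[symmetric] qunitary_herm)
  then have "(norm (A u))\<^sup>2 = (norm u)\<^sup>2" using of_real_eq_iff by blast
  then show ?thesis by simp
qed

lemma qunitary_diff: "A (u - v) = A u - A v"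
  by (rule linear_diff[OF qunitary_linear])

lemma qunitary_inverse: obtains B where "qunitary B" "\<And>v. A (B v) = v" "\<And>v. B (A v) = v"
proof -
  have inj: "inj A"
  proof (rule injI)
    fix u v assume "A u = A v"
    then have "A (u - v) = 0" by (simp add: qunitary_diff)
    then show "u = v" using qunitary_norm[of "u - v"] by simp
  qed
  then have surj: "surj A" using linear_injective_imp_surjective[OF qunitary_linear] by simp
  define B where "B = inv A"
  have AB: "A (B v) = v" for v by (simp add: B_def surj_f_inv_f surj)
  have BA: "B (A v) = v" for v by (simp add: B_def inj)
  have AI: "u = v" if "A u = A v" for u v using that inj by (simp add: inj_eq)
  have "qunitary B" unfolding qunitary_def
  proof (intro conjI allI)
    show "B (u + v) = B u + B v" for u v by (rule AI) (simp add: qunitary_add AB)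
    show "B (c *s v) = c *s B v" for c v by (rule AI) (simp add: qunitary_smult AB)
    show "B (jmul v) = jmul (B v)" for v by (rule AI) (simp add: qunitary_jmul AB)
    show "herm (B u) (B v) = herm u v" for u v using qunitary_herm[of "B u" "B v"] by (simp add: AB)
  qed
  then show ?thesis using that AB BA by blast
qed

end

text \<open>The condition \<open>om p r = 0\<close> is orthogonality of \<open>r\<close> to
  \<open>jmul p\<close>, so \<open>p\<close>, \<open>jmul p\<close>, \<open>r\<close>,
  \<open>jmul r\<close> form an orthonormal basis adapted to \<open>jmul\<close>. The normal forms
  of planes are obtained by exhibiting such a frame.\<close>

lemma qunitary_exists:
  assumes "norm p = 1" "norm r = 1" "herm p r = 0" "om p r = 0"
  obtains A where "qunitary A"
    "\<And>v. A v = v $ 1 *s p + v $ 2 *s jmul p + v $ 3 *s r + v $ 4 *s jmul r"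
proof -
  define A :: "complex^4 \<Rightarrow> complex^4" where "A v = v $ 1 *s p + v $ 2 *s jmul p + v $ 3 *s r + v $ 4 *s jmul r" for v
  have h: "herm p p = 1" "herm r r = 1" "herm r p = 0" "om r p = 0"
    using cnj_herm[of p r] om_swap[of r p] by (simp_all add: herm_self assms)
  have 1: "herm (A u) (A v) = herm u v" for u v :: "complex^4"
  proof -
    have "herm (A u) (A v) = u $ 1 * cnj (v $ 1) + u $ 2 * cnj (v $ 2) + u $ 3 * cnj (v $ 3) + u $ 4 * cnj (v $ 4)"
      unfolding A_def
      by (simp add: herm_add herm_scale herm_jmul herm_jmul_left herm_jmul_right h assms(3,4)
        om_add om_scale om_jmul)
    then show ?thesis by (simp add: herm_def sum_4)
  qed
  have 2: "A (jmul v) = jmul (A v)" for v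
    by (simp add: A_def vec_eq_iff forall_4 algebra_simps)
  have 3: "A (u + v) = A u + A v" for u v
    by (simp add: A_def vec_eq_iff algebra_simps)
  have 4: "A (c *s v) = c *s A v" for c v
    by (simp add: A_def vec_eq_iff algebra_simps)
  have "qunitary A" unfolding qunitary_def by (intro conjI allI 1 2 3 4)
  then show ?thesis using that A_def by blast
qed

section \<open>Smooth functions on open sets\<close>

lemma frechet_derivativeI: "(f has_derivative D) (at x) \<Longrightarrow> frechet_derivative f (at x) = D"
  by (metis frechet_derivative_at)

lemma Ck_on_cong:
  assumes "open S" "\<And>x. x \<in> S \<Longrightarrow> f x = g x" "Ck_on k S f"
  shows "Ck_on k S g"
  using assms(2,3)
proof (induction k arbitrary: f g)
  case 0
  then show ?case by (simp cong: continuous_on_cong_simp)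
next
  case (Suc k)
  have eq: "frechet_derivative g (at x) = frechet_derivative f (at x)" "g differentiable (at x)"
    if x: "x \<in> S" for x
  proof -
    have "(f has_derivative frechet_derivative f (at x)) (at x)"
      using Suc.prems x frechet_derivative_works by auto
    then have "(g has_derivative frechet_derivative f (at x)) (at x)"
      by (rule has_derivative_transform_within_open[OF _ \<open>open S\<close> x]) (use Suc.prems in auto)
    then show "frechet_derivative g (at x) = frechet_derivative f (at x)" "g differentiable (at x)"
      by (auto simp: frechet_derivativeI differentiable_def)
  qed
  have "Ck_on k S (\<lambda>x. frechet_derivative g (at x) v)" for v
    by (rule Suc.IH[of "\<lambda>x. frechet_derivative f (at x) v"]) (use Suc.prems eq in auto)
  then show ?case using eq by simp
qed

lemma Ck_on_Suc_imp: "Ck_on (Suc k) S f \<Longrightarrow> Ck_on k S f"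
proof (induction k arbitrary: f)
  case 0
  then show ?case
    by (auto intro!: continuous_at_imp_continuous_on differentiable_imp_continuous_within)
next
  case (Suc k)
  then show ?case by (metis Ck_on.simps(2))
qed

lemma Ck_on_SucI:
  assumes "open S" "\<And>x. x \<in> S \<Longrightarrow> (f has_derivative D x) (at x)" "\<And>v. Ck_on k S (\<lambda>x. D x v)"
  shows "Ck_on (Suc k) S f"
proof -
  have "Ck_on k S (\<lambda>x. frechet_derivative f (at x) v)" for v
    by (rule Ck_on_cong[OF assms(1) _ assms(3)[of v]]) (simp add: frechet_derivativeI[OF assms(2)])
  then show ?thesis using assms(2) by (auto simp: differentiable_def)
qed

lemma Ck_on_SucD:
  assumes "Ck_on (Suc k) S f" "x \<in> S"
  shows "(f has_derivative frechet_derivative f (at x)) (at x)"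
  using assms frechet_derivative_works by auto

lemma Ck_on_const: "Ck_on k S (\<lambda>x. c)"
  by (induction k arbitrary: c) auto

lemma Ck_on_bounded_linear:
  assumes "bounded_linear L" shows "Ck_on k S L"
proof (cases k)
  case 0
  then show ?thesis using assms by (simp add: linear_continuous_on)
next
  case (Suc k')
  have "(L has_derivative L) (at x)" for x
    using bounded_linear_imp_has_derivative[OF assms] .
  then have "frechet_derivative L (at x) = L" "L differentiable (at x)" for x
    by (auto simp: frechet_derivativeI differentiable_def)
  then show ?thesis using Suc by (simp add: Ck_on_const)
qed

lemma Ck_on_add:
  assumes "open S" shows "Ck_on k S f \<Longrightarrow> Ck_on k S g \<Longrightarrow> Ck_on k S (\<lambda>x. f x + g x)"
proof (induction k arbitrary: f g)
  case 0
  then show ?case by (auto intro: continuous_on_add)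
next
  case (Suc k)
  show ?case
  proof (rule Ck_on_SucI[OF assms])
    fix x assume "x \<in> S"
    then show "((\<lambda>x. f x + g x) has_derivative
        (\<lambda>v. frechet_derivative f (at x) v + frechet_derivative g (at x) v)) (at x)"
      using Suc.prems by (intro has_derivative_add Ck_on_SucD)
  next
    show "Ck_on k S (\<lambda>x. frechet_derivative f (at x) v + frechet_derivative g (at x) v)" for v
      using Suc by auto
  qed
qed

lemma Ck_on_bilinear:
  assumes "open S" and b: "bounded_bilinear b"
  shows "Ck_on k S f \<Longrightarrow> Ck_on k S g \<Longrightarrow> Ck_on k S (\<lambda>x. b (f x) (g x))"
proof (induction k arbitrary: f g)
  case 0
  then show ?case using bounded_bilinear.continuous_on[OF b] by auto
next
  case (Suc k)
  show ?case
  proof (rule Ck_on_SucI[OF assms(1)])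
    fix x assume "x \<in> S"
    then show "((\<lambda>x. b (f x) (g x)) has_derivative
        (\<lambda>v. b (f x) (frechet_derivative g (at x) v) + b (frechet_derivative f (at x) v) (g x))) (at x)"
      using Suc.prems by (intro bounded_bilinear.FDERIV[OF b] Ck_on_SucD)
  next
    show "Ck_on k S (\<lambda>x. b (f x) (frechet_derivative g (at x) v) + b (frechet_derivative f (at x) v) (g x))" for v
      using Suc.prems Ck_on_Suc_imp[of k S f] Ck_on_Suc_imp[of k S g]
      by (intro Ck_on_add[OF assms(1)] Suc.IH) auto
  qed
qed

lemma Ck_on_inverse:
  fixes f :: "'a::euclidean_space \<Rightarrow> complex"
  assumes "open S" and nz: "\<And>x. x \<in> S \<Longrightarrow> f x \<noteq> 0"
  shows "Ck_on k S f \<Longrightarrow> Ck_on k S (\<lambda>x. inverse (f x))"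
proof (induction k)
  case 0
  then show ?case using nz by (auto intro: continuous_on_inverse)
next
  case (Suc k)
  have bm: "bounded_bilinear ((*) :: complex \<Rightarrow> _)" by (rule bounded_bilinear_mult)
  show ?case
  proof (rule Ck_on_SucI[OF assms(1)])
    fix x assume x: "x \<in> S"
    show "((\<lambda>x. inverse (f x)) has_derivative
        (\<lambda>v. (- 1) * (inverse (f x) * frechet_derivative f (at x) v * inverse (f x)))) (at x)"
      using Deriv.has_derivative_inverse[OF nz[OF x] Ck_on_SucD[OF Suc.prems x]] by simp
  next
    have k: "Ck_on k S (\<lambda>x. inverse (f x))" using Suc Ck_on_Suc_imp by blast
    show "Ck_on k S (\<lambda>x. (- 1) * (inverse (f x) * frechet_derivative f (at x) v * inverse (f x)))" for v
      using Suc.prems k by (intro Ck_on_bilinear[OF assms(1) bm] Ck_on_const) auto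
  qed
qed

lemma smooth_onD:
  assumes "smooth_on S f"
  shows "x \<in> S \<Longrightarrow> (f has_derivative frechet_derivative f (at x)) (at x)"
    and "smooth_on S (\<lambda>x. frechet_derivative f (at x) v)"
    and "continuous_on S f"
proof -
  have k: "Ck_on k S f" for k using assms by (simp add: smooth_on_def)
  show "x \<in> S \<Longrightarrow> (f has_derivative frechet_derivative f (at x)) (at x)"
    using Ck_on_SucD[OF k[of "Suc 0"]] by blast
  show "smooth_on S (\<lambda>x. frechet_derivative f (at x) v)"
    using k[of "Suc _"] by (auto simp: smooth_on_def)
  show "continuous_on S f" using k[of 0] by simp
qed

lemma smooth_on_subset: 
  assumes "smooth_on S f" "T \<subseteq> S" shows "smooth_on T f"
proof -
  have "Ck_on k T f" if "Ck_on k S f" for k and f :: "'a \<Rightarrow> 'b"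
    using that
  proof (induction k arbitrary: f)
    case 0
    then show ?case using assms(2) continuous_on_subset by auto
  next
    case (Suc k)
    then show ?case using assms(2) by auto
  qed
  then show ?thesis using assms by (simp add: smooth_on_def)
qed

subsection \<open>Symmetry of second derivatives\<close>

text \<open>The mean value theorem is applied to the second difference over a square of side
  \<open>h\<close>, once in the direction \<open>v\<close> and once in the direction
  \<open>w\<close>. The difference is symmetric in \<open>v\<close> and \<open>w\<close>, hence its
  use for the symmetry of second derivatives.\<close>

lemma mixed_difference_mean_value:
  fixes f :: "'a::euclidean_space \<Rightarrow> real"
  assumes h: "h > 0"
    and S: "\<And>s t. \<lbrakk>0 \<le> s; s \<le> h; 0 \<le> t; t \<le> h\<rbrakk> \<Longrightarrow> x + s *\<^sub>R v + t *\<^sub>R w \<in> S"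
    and f: "\<And>y. y \<in> S \<Longrightarrow> (f has_derivative f' y) (at y)"
    and fv: "\<And>y. y \<in> S \<Longrightarrow> ((\<lambda>y. f' y v) has_derivative f'' y) (at y)"
  obtains s t where "0 \<le> s" "s \<le> h" "0 \<le> t" "t \<le> h"
    "f (x + h *\<^sub>R v + h *\<^sub>R w) - f (x + h *\<^sub>R v) - f (x + h *\<^sub>R w) + f x
      = h * (h * f'' (x + s *\<^sub>R v + t *\<^sub>R w) w)"
proof -
  have d1: "((\<lambda>s. f (x + s *\<^sub>R v + t *\<^sub>R w)) has_real_derivative f' (x + s *\<^sub>R v + t *\<^sub>R w) v) (at s)"
    if "0 \<le> s" "s \<le> h" "0 \<le> t" "t \<le> h" for s t
  proof -
    have "((\<lambda>s. x + s *\<^sub>R v + t *\<^sub>R w) has_derivative (\<lambda>r. r *\<^sub>R v)) (at s)"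
      by (auto intro!: derivative_eq_intros)
    from has_derivative_compose[OF this, of f "f' (x + s *\<^sub>R v + t *\<^sub>R w)"]
    have "((\<lambda>s. f (x + s *\<^sub>R v + t *\<^sub>R w)) has_derivative (\<lambda>r. f' (x + s *\<^sub>R v + t *\<^sub>R w) (r *\<^sub>R v))) (at s)"
      using f[OF S[OF that]] by simp
    moreover have "linear (f' (x + s *\<^sub>R v + t *\<^sub>R w))"
      using f[OF S[OF that]] has_derivative_linear by blast
    ultimately show ?thesis
      by (simp add: has_field_derivative_def linear_scale mult.commute[of _ "f' _ v"])
  qed
  have d2: "((\<lambda>t. f' (x + s *\<^sub>R v + t *\<^sub>R w) v) has_real_derivative f'' (x + s *\<^sub>R v + t *\<^sub>R w) w) (at t)"
    if "0 \<le> s" "s \<le> h" "0 \<le> t" "t \<le> h" for s t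
  proof -
    have "((\<lambda>t. x + s *\<^sub>R v + t *\<^sub>R w) has_derivative (\<lambda>r. r *\<^sub>R w)) (at t)"
      by (auto intro!: derivative_eq_intros)
    from has_derivative_compose[OF this, of "\<lambda>y. f' y v" "f'' (x + s *\<^sub>R v + t *\<^sub>R w)"]
    have "((\<lambda>t. f' (x + s *\<^sub>R v + t *\<^sub>R w) v) has_derivative (\<lambda>r. f'' (x + s *\<^sub>R v + t *\<^sub>R w) (r *\<^sub>R w))) (at t)"
      using fv[OF S[OF that]] by simp
    moreover have "linear (f'' (x + s *\<^sub>R v + t *\<^sub>R w))"
      using fv[OF S[OF that]] has_derivative_linear by blast
    ultimately show ?thesis
      by (simp add: has_field_derivative_def linear_scale mult.commute[of _ "f'' _ w"])
  qed
  have "\<exists>s>0. s < h \<and> (f (x + h *\<^sub>R v + h *\<^sub>R w) - f (x + h *\<^sub>R v + 0 *\<^sub>R w)) - (f (x + 0 *\<^sub>R v + h *\<^sub>R w) - f (x + 0 *\<^sub>R v + 0 *\<^sub>R w))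
      = (h - 0) * (f' (x + s *\<^sub>R v + h *\<^sub>R w) v - f' (x + s *\<^sub>R v + 0 *\<^sub>R w) v)"
    by (rule MVT2[OF h, where f = "\<lambda>s. f (x + s *\<^sub>R v + h *\<^sub>R w) - f (x + s *\<^sub>R v + 0 *\<^sub>R w)"])
       (use h in \<open>intro DERIV_diff d1; simp\<close>)
  then obtain s where s: "0 < s" "s < h"
    and e1: "f (x + h *\<^sub>R v + h *\<^sub>R w) - f (x + h *\<^sub>R v) - f (x + h *\<^sub>R w) + f x
      = h * (f' (x + s *\<^sub>R v + h *\<^sub>R w) v - f' (x + s *\<^sub>R v + 0 *\<^sub>R w) v)"
    by (auto simp: algebra_simps)
  have "\<exists>t>0. t < h \<and> f' (x + s *\<^sub>R v + h *\<^sub>R w) v - f' (x + s *\<^sub>R v + 0 *\<^sub>R w) v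
      = (h - 0) * f'' (x + s *\<^sub>R v + t *\<^sub>R w) w"
    by (rule MVT2[OF h]) (use s d2 in auto)
  then obtain t where "0 < t" "t < h" "f' (x + s *\<^sub>R v + h *\<^sub>R w) v - f' (x + s *\<^sub>R v + 0 *\<^sub>R w) v
      = h * f'' (x + s *\<^sub>R v + t *\<^sub>R w) w" by auto
  with e1 s show ?thesis by (intro that[of s t]) auto
qed

lemma second_derivative_symmetric_real:
  fixes f :: "'a::euclidean_space \<Rightarrow> real"
  assumes "open S" "x \<in> S"
    and f: "\<And>y. y \<in> S \<Longrightarrow> (f has_derivative f' y) (at y)"
    and fv: "\<And>y. y \<in> S \<Longrightarrow> ((\<lambda>y. f' y v) has_derivative fv y) (at y)"
    and fw: "\<And>y. y \<in> S \<Longrightarrow> ((\<lambda>y. f' y w) has_derivative fw y) (at y)"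
    and cv: "continuous_on S (\<lambda>y. fv y w)" and cw: "continuous_on S (\<lambda>y. fw y v)"
  shows "fv x w = fw x v"
proof (rule ccontr)
  define e where "e = \<bar>fv x w - fw x v\<bar>"
  assume "fv x w \<noteq> fw x v"
  then have e: "e / 2 > 0" by (simp add: e_def)
  have "isCont (\<lambda>y. fv y w) x" "isCont (\<lambda>y. fw y v) x"
    using cv cw assms(1,2) by (auto simp: continuous_on_eq_continuous_at)
  then obtain d1 d2 where d: "d1 > 0" "d2 > 0"
    and dv: "\<And>y. dist y x < d1 \<Longrightarrow> dist (fv y w) (fv x w) < e / 2"
    and dw: "\<And>y. dist y x < d2 \<Longrightarrow> dist (fw y v) (fw x v) < e / 2"
    using e unfolding continuous_at_eps_delta by metis
  obtain d3 where d3: "d3 > 0" "ball x d3 \<subseteq> S" using assms(1,2) openE by blast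
  define d where "d = min d1 (min d2 d3)"
  have dp: "d > 0" using d d3 by (simp add: d_def)
  \<comment> \<open>With this \<open>h\<close> the whole square lies within \<open>d / 2\<close> of
    \<open>x\<close>; the summand 1 keeps \<open>n\<close> positive even for
    \<open>v = w = 0\<close>.\<close>
  define n where "n = norm v + norm w + 1"
  define h where "h = d / (2 * n)"
  have nn: "n > 0" unfolding n_def by (meson add_nonneg_pos add_nonneg_nonneg norm_ge_zero zero_less_one)
  then have h: "h > 0" using dp by (simp add: h_def)
  have near: "dist (x + s *\<^sub>R v + t *\<^sub>R w) x < d" if "0 \<le> s" "s \<le> h" "0 \<le> t" "t \<le> h" for s t
  proof -
    have "dist (x + s *\<^sub>R v + t *\<^sub>R w) x = norm (s *\<^sub>R v + t *\<^sub>R w)" by (simp add: dist_norm add.assoc)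
    also have "\<dots> \<le> s * norm v + t * norm w"
      using norm_triangle_ineq[of "s *\<^sub>R v" "t *\<^sub>R w"] that by simp
    also have "\<dots> \<le> h * norm v + h * norm w"
      using that by (intro add_mono mult_right_mono) auto
    also have "\<dots> \<le> h * n" using h by (simp add: n_def algebra_simps)
    also have "\<dots> = d / 2" using nn by (simp add: h_def)
    finally show ?thesis using dp by simp
  qed
  have near': "dist (x + s *\<^sub>R w + t *\<^sub>R v) x < d" if "0 \<le> s" "s \<le> h" "0 \<le> t" "t \<le> h" for s t
    using near[OF that(3,4,1,2)] by (simp add: add.assoc add.commute[of "s *\<^sub>R w"])
  have inS: "y \<in> S" if "dist y x < d" for y
    using that d3 by (auto simp: d_def dist_commute subset_iff)
  obtain s t where st: "0 \<le> s" "s \<le> h" "0 \<le> t" "t \<le> h"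
    "f (x + h *\<^sub>R v + h *\<^sub>R w) - f (x + h *\<^sub>R v) - f (x + h *\<^sub>R w) + f x
      = h * (h * fv (x + s *\<^sub>R v + t *\<^sub>R w) w)"
    using mixed_difference_mean_value[OF h inS[OF near] f fv] by blast
  obtain s' t' where st': "0 \<le> s'" "s' \<le> h" "0 \<le> t'" "t' \<le> h"
    "f (x + h *\<^sub>R w + h *\<^sub>R v) - f (x + h *\<^sub>R w) - f (x + h *\<^sub>R v) + f x
      = h * (h * fw (x + s' *\<^sub>R w + t' *\<^sub>R v) v)"
    using mixed_difference_mean_value[OF h inS[OF near'] f fw] by blast
  \<comment> \<open>Both mean value formulas describe the same mixed difference, so the two mixed
    derivatives agree at two points close to \<open>x\<close>, which contradicts the gap
    \<open>e\<close>.\<close>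
  have "f (x + h *\<^sub>R w + h *\<^sub>R v) = f (x + h *\<^sub>R v + h *\<^sub>R w)"
    by (simp add: add.assoc add.commute[of "h *\<^sub>R v"])
  with st(5) st'(5) have "h * (h * fv (x + s *\<^sub>R v + t *\<^sub>R w) w) = h * (h * fw (x + s' *\<^sub>R w + t' *\<^sub>R v) v)"
    by linarith
  then have "fv (x + s *\<^sub>R v + t *\<^sub>R w) w = fw (x + s' *\<^sub>R w + t' *\<^sub>R v) v" using h by simp
  moreover have "dist (fv (x + s *\<^sub>R v + t *\<^sub>R w) w) (fv x w) < e / 2"
    using near[OF st(1-4)] by (intro dv) (simp add: d_def)
  moreover have "dist (fw (x + s' *\<^sub>R w + t' *\<^sub>R v) v) (fw x v) < e / 2"
    using near'[OF st'(1-4)] by (intro dw) (simp add: d_def)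
  ultimately show False unfolding dist_real_def e_def by (smt (verit) field_sum_of_halves)
qed

lemma second_derivative_symmetric:
  fixes f :: "'a::euclidean_space \<Rightarrow> 'b::euclidean_space"
  assumes "open S" "x \<in> S" "smooth_on S f"
  shows "frechet_derivative (\<lambda>y. frechet_derivative f (at y) v) (at x) w
       = frechet_derivative (\<lambda>y. frechet_derivative f (at y) w) (at x) v"
proof (rule euclidean_eqI)
  fix b :: 'b assume "b \<in> Basis"
  let ?D = "\<lambda>v y. frechet_derivative (\<lambda>y. frechet_derivative f (at y) v) (at y)"
  have D: "((\<lambda>y. frechet_derivative f (at y) v) has_derivative ?D v y) (at y)" if "y \<in> S" for v y
    using smooth_onD(1)[OF smooth_onD(2)[OF assms(3)] that] .
  have c: "continuous_on S (\<lambda>y. ?D v y w)" for v w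
    using smooth_onD(3)[OF smooth_onD(2)[OF smooth_onD(2)[OF assms(3)]]] .
  show "?D v x w \<bullet> b = ?D w x v \<bullet> b"
  proof (rule second_derivative_symmetric_real[OF assms(1,2), of "\<lambda>y. f y \<bullet> b" "\<lambda>y v. frechet_derivative f (at y) v \<bullet> b"])
    show "((\<lambda>y. f y \<bullet> b) has_derivative (\<lambda>v. frechet_derivative f (at y) v \<bullet> b)) (at y)" if "y \<in> S" for y
      using smooth_onD(1)[OF assms(3) that] by (rule has_derivative_inner_left)
    show "((\<lambda>y. frechet_derivative f (at y) v \<bullet> b) has_derivative (\<lambda>w. ?D v y w \<bullet> b)) (at y)" if "y \<in> S" for y v
      using D[OF that] by (rule has_derivative_inner_left)
    show "((\<lambda>y. frechet_derivative f (at y) w \<bullet> b) has_derivative (\<lambda>v. ?D w y v \<bullet> b)) (at y)" if "y \<in> S" for y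
      using D[OF that] by (rule has_derivative_inner_left)
    show "continuous_on S (\<lambda>y. ?D v y w \<bullet> b)" "continuous_on S (\<lambda>y. ?D w y v \<bullet> b)"
      by (intro continuous_on_inner continuous_on_const c)+
  qed
qed

subsection \<open>A linear differential inequality\<close>

text \<open>Gronwall: the weight \<open>exp (- 2 * C * t)\<close> gives the squared norm of
  \<open>y\<close> a nonpositive derivative, so a zero initial value persists.\<close>

lemma linear_ode_zero:
  fixes y :: "real \<Rightarrow> 'a::real_inner"
  assumes d: "\<And>t. t \<in> {0..1} \<Longrightarrow> (y has_vector_derivative y' t) (at t within {0..1})"
    and b: "\<And>t. t \<in> {0..1} \<Longrightarrow> norm (y' t) \<le> C * norm (y t)"
    and "y 0 = 0" "t \<in> {0..1}"
  shows "y t = 0"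
proof -
  define \<phi> where "\<phi> t = (y t \<bullet> y t) * exp (- 2 * C * t)" for t
  define \<psi> where "\<psi> t = (2 * (y t \<bullet> y' t) - 2 * C * (y t \<bullet> y t)) * exp (- 2 * C * t)" for t
  have "(\<phi> has_derivative (\<lambda>h. \<psi> s * h)) (at s within {0..t})" if "s \<in> {0..t}" for s
  proof -
    have "(y has_derivative (\<lambda>h. h *\<^sub>R y' s)) (at s within {0..t})"
      using has_vector_derivative_within_subset[OF d[of s], of "{0..t}"] that \<open>t \<in> {0..1}\<close>
      by (auto simp: has_vector_derivative_def)
    then show ?thesis unfolding \<phi>_def \<psi>_def
      by (auto intro!: derivative_eq_intros simp: algebra_simps inner_commute)
  qed
  then obtain s where s: "s \<in> {0..t}" "\<phi> t - \<phi> 0 = \<psi> s * (t - 0)"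
    using mvt_very_simple[of 0 t \<phi> "\<lambda>s h. \<psi> s * h"] \<open>t \<in> {0..1}\<close> by auto
  have "y s \<bullet> y' s \<le> norm (y s) * norm (y' s)" by (rule norm_cauchy_schwarz)
  also have "\<dots> \<le> norm (y s) * (C * norm (y s))"
    using b[of s] s \<open>t \<in> {0..1}\<close> by (intro mult_left_mono) auto
  also have "\<dots> = C * (y s \<bullet> y s)" by (simp add: dot_square_norm power2_eq_square)
  finally have "\<psi> s \<le> 0" unfolding \<psi>_def by (simp add: mult_nonpos_nonneg)
  then have "\<psi> s * t \<le> 0" using \<open>t \<in> {0..1}\<close> by (simp add: mult_nonpos_nonneg)
  then have "\<phi> t \<le> \<phi> 0" using s by simp
  then have "(y t \<bullet> y t) * exp (- 2 * C * t) \<le> 0" by (simp add: \<phi>_def assms(3))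
  then have "y t \<bullet> y t \<le> 0" by (simp add: mult_le_0_iff)
  then show ?thesis by (metis inner_ge_zero inner_eq_zero_iff order_antisym)
qed

section \<open>Inner products depending on a point\<close>

text \<open>The Fubini-Study and nearly Kaehler metrics and the induced metrics depend on the point,
  so positive definite forms are treated as data rather than through the inner product of the
  type.\<close>

locale inner_form =
  fixes G :: "'e::euclidean_space \<Rightarrow> 'e \<Rightarrow> real"
  assumes lin1: "linear (\<lambda>u. G u v)" and sym: "G u v = G v u" and pos: "u \<noteq> 0 \<Longrightarrow> G u u > 0"
begin

lemma lin2: "linear (\<lambda>v. G u v)"
  using lin1[of u] by (simp add: sym[of u])

lemma add: "G (u + u') v = G u v + G u' v" "G v (u + u') = G v u + G v u'"
  using linear_add[OF lin1] linear_add[OF lin2] by auto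

lemma diff: "G (u - u') v = G u v - G u' v" "G v (u - u') = G v u - G v u'"
  using linear_diff[OF lin1] linear_diff[OF lin2] by auto

lemma scale: "G (r *\<^sub>R u) v = r * G u v" "G v (r *\<^sub>R u) = r * G v u"
  using linear_scale[OF lin1] linear_scale[OF lin2] by auto

lemma zero [simp]: "G 0 v = 0" "G v 0 = 0"
  using scale(1)[of 0] scale(2)[of _ 0] by auto

lemma eq_zero: "G u u = 0 \<longleftrightarrow> u = 0"
  using pos[of u] by (cases "u = 0") auto

text \<open>\<open>K\<close> is the Gram map on the standard basis; positivity makes it injective,
  hence surjective. Unique existence is what the definite description in \<open>christoffel\<close>
  asks for.\<close>

lemma riesz:
  assumes "linear l"
  shows "\<exists>!w. \<forall>z. G w z = l z"
proof -
  define K where "K w = (\<Sum>b\<in>Basis. G w b *\<^sub>R b)" for w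
  have K: "linear K"
    by (rule linearI) (simp_all add: K_def add scale scaleR_left_distrib sum.distrib scaleR_sum_right)
  have Kb: "K w \<bullet> b = G w b" if "b \<in> Basis" for w b
    using that by (simp add: K_def inner_sum_left inner_Basis if_distrib cong: if_cong)
  have ext: "m z = l z" if "linear m" "linear l" "\<And>b. b \<in> Basis \<Longrightarrow> m b = l b" for m l :: "'e \<Rightarrow> real" and z
    using that linear_eq_stdbasis by metis
  have "inj K"
  proof (subst linear_injective_0[OF K], intro allI impI)
    fix w assume "K w = 0"
    then have "G w b = 0" if "b \<in> Basis" for b using Kb[OF that, of w] by simp
    then have "G w w = 0" using ext[OF lin2, of "\<lambda>_. 0" w w] by (simp add: linear_zero)
    then show "w = 0" by (simp add: eq_zero)
  qed
  then have "surj K" using linear_injective_imp_surjective[OF K] by simp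
  then obtain w where w: "K w = (\<Sum>b\<in>Basis. l b *\<^sub>R b)" by (metis surjD)
  have "G w b = l b" if "b \<in> Basis" for b
    using Kb[OF that, of w] that unfolding w
    by (simp add: inner_sum_left inner_Basis if_distrib cong: if_cong)
  then have "\<forall>z. G w z = l z" using ext[OF lin2 assms] by blast
  moreover have "w' = w''" if "\<forall>z. G w' z = l z" "\<forall>z. G w'' z = l z" for w' w''
    using that eq_zero[of "w' - w''"] by (simp add: diff)
  ultimately show ?thesis by blast
qed

text \<open>The tangential part of \<open>w\<close> is found by Riesz representation for the form
  pulled back along \<open>D\<close>; injectivity of \<open>D\<close> makes the pull-back
  positive.\<close>

lemma normal_part:
  fixes D :: "'a::euclidean_space \<Rightarrow> 'e"
  assumes "linear D" "inj D"
  shows "\<forall>t\<in>range D. G (normal_part G (range D) w) t = 0" "w - normal_part G (range D) w \<in> range D"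
    and "\<lbrakk>\<forall>t\<in>range D. G n t = 0; w - n \<in> range D\<rbrakk> \<Longrightarrow> normal_part G (range D) w = n"
proof -
  interpret I: inner_form "\<lambda>u v. G (D u) (D v)"
  proof (rule inner_form.intro)
    show "linear (\<lambda>u. G (D u) (D v))" for v :: 'a
      using linear_compose[OF assms(1) lin1] by (simp add: o_def)
    show "G (D u) (D v) = G (D v) (D u)" for u v :: 'a by (rule sym)
    show "G (D u) (D u) > 0" if "u \<noteq> 0" for u :: 'a
      using pos[of "D u"] that assms linear_injective_0 by blast
  qed
  have "linear (\<lambda>v. G w (D v))" using linear_compose[OF assms(1) lin2] by (simp add: o_def)
  then obtain u where u: "\<And>v. G (D u) (D v) = G w (D v)" using I.riesz by blast
  have ex: "(\<forall>t\<in>range D. G (w - D u) t = 0) \<and> w - (w - D u) \<in> range D"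
    using u by (auto simp: diff)
  have un: "n = n'" if "(\<forall>t\<in>range D. G n t = 0) \<and> w - n \<in> range D"
    "(\<forall>t\<in>range D. G n' t = 0) \<and> w - n' \<in> range D" for n n'
  proof -
    have "(w - n') - (w - n) \<in> range D"
      using that linear_subspace_image[OF assms(1) subspace_UNIV] by (meson subspace_diff)
    then have "n - n' \<in> range D" by simp
    then have "G n (n - n') = 0" "G n' (n - n') = 0" using that by auto
    then have "G (n - n') (n - n') = 0" by (simp add: diff(1)[of n n' "n - n'"])
    then show ?thesis by (simp add: eq_zero)
  qed
  have *: "(\<forall>t\<in>range D. G (normal_part G (range D) w) t = 0) \<and> w - normal_part G (range D) w \<in> range D"
    unfolding normal_part_def by (rule theI') (use un ex in blast)
  then show "\<forall>t\<in>range D. G (normal_part G (range D) w) t = 0" "w - normal_part G (range D) w \<in> range D"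
    by auto
  show "\<lbrakk>\<forall>t\<in>range D. G n t = 0; w - n \<in> range D\<rbrakk> \<Longrightarrow> normal_part G (range D) w = n"
    using un * by blast
qed

end

section \<open>Affine charts of the projective space\<close>

lemma hopf_self [simp]: "p \<in> hopf p"
  unfolding hopf_def by (rule CollectI, rule exI[of _ 0]) simp

lemma hopf_phase: "cmod c = 1 \<Longrightarrow> hopf (c *s p) = hopf p"
proof -
  have sub: "hopf (c *s p) \<subseteq> hopf p" if "cmod c = 1" for c p
  proof -
    have "c = cis (Arg c)" using rcis_cmod_Arg[of c] that by (simp add: rcis_def)
    then obtain t where t: "c = cis t" ..
    show ?thesis unfolding hopf_def
      by (auto simp: t vec_eq_iff mult.assoc[symmetric] cis_mult)
  qed
  assume c: "cmod c = 1"
  have "hopf (inverse c *s (c *s p)) \<subseteq> hopf (c *s p)"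
    by (rule sub) (simp add: c norm_inverse)
  moreover have "c \<noteq> 0" using c by auto
  then have "inverse c *s (c *s p) = p" by (simp add: smult_assoc)
  ultimately show ?thesis using sub[OF c] by auto
qed

lemma hopf_memD:
  assumes "q \<in> hopf p" obtains c where "cmod c = 1" "q = c *s p"
proof -
  obtain t where "q = cis t *s p" using assms by (auto simp: hopf_def)
  then show ?thesis using that[of "cis t"] by (simp only: norm_cis)
qed

lemma hopf_eqD:
  assumes "hopf q = hopf p" obtains c where "cmod c = 1" "q = c *s p"
  using assms hopf_memD hopf_self by metis

lemma vec_sgn_smult: "sgn (z::complex^4) = of_real (1 / norm z) *s z"
  by (simp add: sgn_div_norm scaleR_smult divide_inverse)

lemma smult_Re_Im: "a *s (u::complex^4) = Re a *\<^sub>R u + Im a *\<^sub>R (\<i> *s u)"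
  by (simp add: vec_eq_iff complex_eq_iff)

lemma hopf_sgn_smult:
  assumes "c \<noteq> 0" shows "hopf (sgn (c *s z)) = hopf (sgn z)"
proof -
  have "sgn (c *s z) = (c / of_real (cmod c)) *s sgn z"
    by (simp add: vec_sgn_smult norm_smult smult_assoc)
  then show ?thesis using hopf_phase[of "c / of_real (cmod c)"] assms by (simp add: norm_divide)
qed

text \<open>The chart \<open>d\<close> sends the fibre of \<open>p\<close> to the ratios \<open>pr p / p\<^sub>i\<close>; its inverse sends \<open>x\<close> to the
  line through \<open>Z x\<close>.\<close>

locale aff =
  fixes i :: 4 and lin :: "complex^3 \<Rightarrow> complex^4" and pr :: "complex^4 \<Rightarrow> complex^3" and d :: CP3_chart
  assumes lin_add: "lin (u + v) = lin u + lin v" and lin_smult: "lin (c *s u) = c *s lin u"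
    and lin_i [simp]: "lin u $ i = 0" and pr_lin [simp]: "pr (lin u) = u"
    and pr_add: "pr (p + q) = pr p + pr q" and pr_smult: "pr (c *s p) = c *s pr p"
    and lin_pr: "p = p $ i *s axis i 1 + lin (pr p)"
    and dom: "fst d = hopf ` {p \<in> sphere 0 1. p $ i \<noteq> 0}"
    and map: "p $ i \<noteq> 0 \<Longrightarrow> snd d (hopf p) = (1 / p $ i) *s pr p"

lemma affine_chart_aff:
  assumes "i \<noteq> j" "i \<noteq> k" "i \<noteq> l" "j \<noteq> k" "j \<noteq> l" "k \<noteq> l" "UNIV = {i, j, k, l}"
  shows "aff i (\<lambda>x. \<chi> m. if m = j then x $ 1 else if m = k then x $ 2 else if m = l then x $ 3 else 0)
    (\<lambda>p. vector [p $ j, p $ k, p $ l]) (affine_chart i j k l)"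
proof
  fix p :: "complex^4"
  show "p = p $ i *s axis i 1 + (\<chi> m. if m = j then (vector [p $ j, p $ k, p $ l] :: complex^3) $ 1 else
      if m = k then (vector [p $ j, p $ k, p $ l] :: complex^3) $ 2 else
      if m = l then (vector [p $ j, p $ k, p $ l] :: complex^3) $ 3 else 0)"
    unfolding vec_eq_iff
  proof
    fix m
    have "m = i \<or> m = j \<or> m = k \<or> m = l" using assms(7) by blast
    then show "p $ m = (p $ i *s axis i 1 + (\<chi> m. if m = j then (vector [p $ j, p $ k, p $ l] :: complex^3) $ 1 else
      if m = k then (vector [p $ j, p $ k, p $ l] :: complex^3) $ 2 else
      if m = l then (vector [p $ j, p $ k, p $ l] :: complex^3) $ 3 else 0)) $ m"
      using assms(1-6) by (elim disjE) (simp_all add: axis_def)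
  qed
  show "snd (affine_chart i j k l) (hopf p) = (1 / p $ i) *s vector [p $ j, p $ k, p $ l]" if "p $ i \<noteq> 0"
  proof -
    \<comment> \<open>The representative picked by the chart differs from \<open>p\<close> by a
      phase, which cancels in the ratios.\<close>
    have "(SOME q. q \<in> hopf p) \<in> hopf p" using hopf_self by (rule someI)
    then obtain c where "cmod c = 1" "(SOME q. q \<in> hopf p) = c *s p" by (rule hopf_memD)
    then show ?thesis by (auto simp: affine_chart_def vec_eq_iff forall_3)
  qed
qed (use assms(1-6) in \<open>simp_all add: vec_eq_iff forall_3 affine_chart_def\<close>)

lemma CP3_atlas_aff:
  assumes "d \<in> CP3_atlas" obtains i lin pr where "aff i lin pr d"
proof -
  have U: "UNIV = {1, 2, 3, 4::4}" using exhaust_4 by auto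
  have "aff 1 (\<lambda>x. \<chi> m. if m = 2 then x $ 1 else if m = 3 then x $ 2 else if m = 4 then x $ 3 else 0)
      (\<lambda>p. vector [p $ 2, p $ 3, p $ 4]) (affine_chart 1 2 3 4)"
    "aff 2 (\<lambda>x. \<chi> m. if m = 1 then x $ 1 else if m = 3 then x $ 2 else if m = 4 then x $ 3 else 0)
      (\<lambda>p. vector [p $ 1, p $ 3, p $ 4]) (affine_chart 2 1 3 4)"
    "aff 3 (\<lambda>x. \<chi> m. if m = 1 then x $ 1 else if m = 2 then x $ 2 else if m = 4 then x $ 3 else 0)
      (\<lambda>p. vector [p $ 1, p $ 2, p $ 4]) (affine_chart 3 1 2 4)"
    "aff 4 (\<lambda>x. \<chi> m. if m = 1 then x $ 1 else if m = 2 then x $ 2 else if m = 3 then x $ 3 else 0)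
      (\<lambda>p. vector [p $ 1, p $ 2, p $ 3]) (affine_chart 4 1 2 3)"
    by (rule affine_chart_aff; (simp | use U in auto))+
  then show ?thesis using assms that unfolding CP3_atlas_def by blast
qed

lemma CP3_atlas_cover:
  assumes "X \<in> topspace CP3" obtains d where "d \<in> CP3_atlas" "X \<in> fst d"
proof -
  obtain p where p: "p \<in> sphere 0 1" "X = hopf p" using assms by (auto simp: topspace_CP3)
  have "p \<noteq> 0" using p by auto
  then consider "p $ 1 \<noteq> 0" | "p $ 2 \<noteq> 0" | "p $ 3 \<noteq> 0" | "p $ 4 \<noteq> 0"
    by (auto simp: vec_eq_iff forall_4)
  then show ?thesis
  proof cases
    case 1 then show ?thesis using that[of "affine_chart 1 2 3 4"] p
      by (auto simp: CP3_atlas_def affine_chart_def)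
  next
    case 2 then show ?thesis using that[of "affine_chart 2 1 3 4"] p
      by (auto simp: CP3_atlas_def affine_chart_def)
  next
    case 3 then show ?thesis using that[of "affine_chart 3 1 2 4"] p
      by (auto simp: CP3_atlas_def affine_chart_def)
  next
    case 4 then show ?thesis using that[of "affine_chart 4 1 2 3"] p
      by (auto simp: CP3_atlas_def affine_chart_def)
  qed
qed

lemma bounded_bilinear_smult: "bounded_bilinear (\<lambda>(a::complex) (v::complex^'n::finite). a *s v)"
proof
  show "\<exists>K. \<forall>a b. norm (a *s (b::complex^'n::finite)) \<le> norm a * norm b * K"
  proof (intro exI[of _ "real CARD('n)"] allI)
    fix a :: complex and b :: "complex^'n::finite"
    have "norm (a *s b) \<le> (\<Sum>m\<in>UNIV. norm ((a *s b) $ m))" by (simp add: norm_vec_def L2_set_le_sum)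
    also have "\<dots> \<le> (\<Sum>m\<in>(UNIV::'n set). norm a * norm b)"
      by (intro sum_mono) (simp add: norm_mult norm_vec_def, intro mult_left_mono norm_ge_zero member_le_L2_set, simp_all)
    finally show "norm (a *s b) \<le> norm a * norm b * CARD('n)" by (simp add: mult_ac)
  qed
qed (simp_all add: vec_eq_iff algebra_simps scaleR_conv_of_real[where 'a=complex])

context aff
begin

definition Z :: "complex^3 \<Rightarrow> complex^4" where "Z x = axis i 1 + lin x"

text \<open>The coefficient of the projection of \<open>lin v\<close> to the line of
  \<open>Z x\<close>. It is also the (1,0)-part of the differential of the logarithm of the squared
  norm of \<open>Z\<close>, and so enters the Fubini-Study connection.\<close>

definition h :: "complex^3 \<Rightarrow> complex^3 \<Rightarrow> complex" where
  "h x v = herm (lin v) (Z x) / of_real ((norm (Z x))\<^sup>2)"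

text \<open>The horizontal lift at the unnormalised point \<open>Z x\<close>. A scalar
  \<open>c\<close> with \<open>cmod c * norm (Z x) = 1\<close> turns it into the lift
  \<open>c *s lift x v\<close> at the unit point \<open>c *s Z x\<close>.\<close>

definition lift :: "complex^3 \<Rightarrow> complex^3 \<Rightarrow> complex^4" where
  "lift x v = lin v - h x v *s Z x"

lemma lin_scaleR: "lin (r *\<^sub>R u) = r *\<^sub>R lin u"
proof -
  have "r *\<^sub>R u = of_real r *s u" by (simp add: vec_eq_iff scaleR_conv_of_real[where 'a=complex])
  then show ?thesis by (simp add: lin_smult scaleR_smult)
qed

lemma pr_scaleR: "pr (r *\<^sub>R u) = r *\<^sub>R pr u"
proof -
  have "r *\<^sub>R pr u = of_real r *s pr u" by (simp add: vec_eq_iff scaleR_conv_of_real[where 'a=complex])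
  then show ?thesis by (simp add: pr_smult scaleR_smult)
qed

lemma linear_lin: "linear lin" by (rule linearI) (simp_all add: lin_add lin_scaleR)
lemma linear_pr: "linear pr" by (rule linearI) (simp_all add: pr_add pr_scaleR)
lemma bounded_linear_lin: "bounded_linear lin" by (rule linear_linear[THEN iffD2, OF linear_lin])
lemma bounded_linear_pr: "bounded_linear pr" by (rule linear_linear[THEN iffD2, OF linear_pr])

lemma lin_diff: "lin (u - v) = lin u - lin v" by (rule linear_diff[OF linear_lin])
lemma pr_diff: "pr (u - v) = pr u - pr v" by (rule linear_diff[OF linear_pr])

lemma pr_axis [simp]: "pr (axis i 1) = 0"
proof -
  have "pr (axis i 1 - (axis i 1 $ i) *s axis i 1) = pr (lin (pr (axis i 1)))"
    using lin_pr[of "axis i 1"] by (metis add_diff_cancel_left')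
  then show ?thesis by (simp add: linear_0[OF linear_pr])
qed

lemma Z_i [simp]: "Z x $ i = 1" by (simp add: Z_def)

lemma Z_nonzero [simp]: "Z x \<noteq> 0"
  using Z_i[of x] by (metis zero_index zero_neq_one)

lemma pr_Z [simp]: "pr (Z x) = x" by (simp add: Z_def pr_add)

lemma Z_has_derivative: "(Z has_derivative lin) (at x within S)"
  unfolding Z_def using bounded_linear.has_derivative[OF bounded_linear_lin has_derivative_ident]
  by (auto intro!: derivative_eq_intros)

lemma Z_unique: "p $ i \<noteq> 0 \<Longrightarrow> p = p $ i *s Z ((1 / p $ i) *s pr p)"
  by (subst lin_pr[of p]) (simp add: Z_def vec_eq_iff lin_smult algebra_simps)

lemma NZ: "herm (Z x) (Z x) = of_real ((norm (Z x))\<^sup>2)" "of_real ((norm (Z x))\<^sup>2) \<noteq> (0::complex)"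
  by (simp_all add: herm_self)

lemma herm_lift_Z [simp]: "herm (lift x v) (Z x) = 0" "herm (Z x) (lift x v) = 0"
proof -
  show "herm (lift x v) (Z x) = 0"
    using NZ by (simp add: lift_def herm_diff herm_scale h_def)
  then show "herm (Z x) (lift x v) = 0" using cnj_herm complex_cnj_zero by metis
qed

lemma om_Z_lift: "om (Z x) (lift x v) = om (Z x) (lin v)"
  by (simp add: lift_def om_diff om_scale)

lemma h_add: "h x (u + v) = h x u + h x v" by (simp add: h_def lin_add herm_add add_divide_distrib)
lemma h_smult: "h x (c *s u) = c * h x u" by (simp add: h_def lin_smult herm_scale)
lemma h_scaleR: "h x (r *\<^sub>R u) = r * h x u" by (simp add: h_def lin_scaleR herm_scaleR)

lemma lift_add: "lift x (u + v) = lift x u + lift x v"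
  by (simp add: lift_def lin_add h_add vec_eq_iff algebra_simps)
lemma lift_smult: "lift x (c *s u) = c *s lift x u"
  by (simp add: lift_def lin_smult h_smult vec_eq_iff algebra_simps)
lemma lift_scaleR: "lift x (r *\<^sub>R u) = r *\<^sub>R lift x u"
  by (simp add: lift_def lin_scaleR h_scaleR vec_eq_iff scaleR_conv_of_real[where 'a=complex] algebra_simps)
lemma lift_linear: "linear (lift x)"
  by (rule linearI) (simp_all add: lift_add lift_scaleR)
lemma lift_eq_0 [simp]: "lift x v = 0 \<longleftrightarrow> v = 0"
proof
  assume a: "lift x v = 0"
  have "lift x v $ i = - h x v" by (simp add: lift_def)
  then have "h x v = 0" unfolding a by simp
  then have "lin v = 0" using a by (simp add: lift_def)
  then have "pr (lin v) = pr (lin 0)" using linear_0[OF linear_lin] by simp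
  then show "v = 0" by simp
qed (simp add: linear_0[OF lift_linear])

lemma lift_surj:
  assumes "herm X (Z x) = 0" obtains v where "X = lift x v"
proof
  \<comment> \<open>The differential at \<open>Z x\<close> of the quotient
    \<open>pr z / z $ i\<close>, applied to \<open>X\<close>.\<close>
  let ?v = "pr X - X $ i *s x"
  have X: "X = X $ i *s Z x + lin ?v"
    by (subst lin_pr[of X]) (simp add: Z_def lin_diff lin_smult vec_eq_iff algebra_simps)
  then have "0 = herm (X $ i *s Z x + lin ?v) (Z x)" using assms by simp
  then have "herm (lin ?v) (Z x) = - (X $ i) * of_real ((norm (Z x))\<^sup>2)"
    unfolding herm_add herm_scale NZ(1) by (simp add: eq_neg_iff_add_eq_0 add.commute)
  then have "h x ?v = - (X $ i)" using NZ(2)[of x] by (simp add: h_def)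
  then show "X = lift x ?v" using X by (simp add: lift_def add.commute)
qed

lemma chart_inv_Z: "chart_inv d x = hopf (sgn (Z x))" and dom_Z: "hopf (sgn (Z x)) \<in> fst d"
  and map_Z: "snd d (hopf (sgn (Z x))) = x"
proof -
  have nz: "sgn (Z x) $ i \<noteq> 0" by (simp add: vec_sgn_smult)
  then show in_dom: "hopf (sgn (Z x)) \<in> fst d" by (auto simp: dom norm_sgn)
  show eq: "snd d (hopf (sgn (Z x))) = x"
  proof -
    define r :: complex where "r = of_real (1 / norm (Z x))"
    have "r \<noteq> 0" by (simp add: r_def)
    then have "(1 / r) *s (r *s x) = x" by (simp add: vec_eq_iff)
    then show ?thesis unfolding map[OF nz] by (simp add: vec_sgn_smult pr_smult flip: r_def)
  qed
  have "inj_on (snd d) (fst d)"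
  proof (rule inj_onI)
    fix X Y assume "X \<in> fst d" "Y \<in> fst d" and XY: "snd d X = snd d Y"
    then obtain p q where p: "norm p = 1" "p $ i \<noteq> 0" "X = hopf p" and q: "norm q = 1" "q $ i \<noteq> 0" "Y = hopf q"
      by (auto simp: dom)
    let ?z = "Z ((1 / p $ i) *s pr p)"
    have "(1 / p $ i) *s pr p = (1 / q $ i) *s pr q"
      using XY p q by (simp add: map)
    then have *: "p = p $ i *s ?z" "q = q $ i *s ?z" using Z_unique p q by metis+
    have "hopf (sgn p) = hopf (sgn ?z)" "hopf (sgn q) = hopf (sgn ?z)"
      using hopf_sgn_smult p(2) q(2) * by metis+
    then show "X = Y" using p q by (simp add: sgn_div_norm)
  qed
  then show "chart_inv d x = hopf (sgn (Z x))"
    unfolding chart_inv_def using inv_into_f_eq in_dom eq by metis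
qed

lemma fst_sub: "fst d \<subseteq> topspace CP3"
  by (auto simp: dom topspace_CP3)

lemma chart_inv_map: "X \<in> fst d \<Longrightarrow> chart_inv d (snd d X) = X"
proof -
  assume "X \<in> fst d"
  then obtain p where p: "norm p = 1" "p $ i \<noteq> 0" "X = hopf p" by (auto simp: dom)
  have "hopf (sgn p) = hopf (sgn (Z ((1 / p $ i) *s pr p)))"
    using hopf_sgn_smult[OF p(2)] Z_unique[OF p(2)] by metis
  moreover have "sgn p = p" using p(1) by (simp add: sgn_div_norm)
  ultimately show ?thesis unfolding p(3) map[OF p(2)] chart_inv_Z by simp
qed

lemma pt_over_Z: obtains c where "cmod c * norm (Z x) = 1" "pt_over d x = c *s Z x"
proof -
  have "pt_over d x \<in> hopf (sgn (Z x))"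
    unfolding pt_over_def chart_inv_Z by (rule someI[of _ "sgn (Z x)"]) simp
  then obtain e where e: "cmod e = 1" "pt_over d x = e *s sgn (Z x)" by (rule hopf_memD)
  show ?thesis
    by (rule that[of "e * of_real (1 / norm (Z x))"])
       (use e in \<open>simp_all add: vec_sgn_smult smult_assoc norm_mult norm_divide\<close>)
qed

text \<open>Radial scaling cancels in ratios, so near the point the extended fibration is the
  quotient of \<open>pr z\<close> by the coordinate \<open>z $ i\<close>, and the quotient rule
  applies.\<close>

lemma dhopf_Z:
  assumes "c \<noteq> 0"
  shows "dhopf d (c *s Z x) X = (1 / c) *s (pr X - X $ i *s x)"
proof -
  let ?p = "c *s Z x"
  have pi: "?p $ i = c" by simp
  have op: "open {z :: complex^4. z $ i \<noteq> 0}"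
    by (intro open_Collect_neq continuous_intros)
  have eq: "(1 / z $ i) *s pr z = snd d (hopf (sgn z))" if "z \<in> {z. z $ i \<noteq> 0}" for z
  proof -
    have "norm z \<noteq> 0" using that by auto
    moreover from this have "sgn z $ i \<noteq> 0" using that by (simp add: vec_sgn_smult)
    ultimately show ?thesis
      by (simp add: map vec_sgn_smult pr_smult smult_assoc vec_eq_iff)
  qed
  have "((\<lambda>z. z $ i) has_derivative (\<lambda>z. z $ i)) (at ?p)"
    by (intro bounded_linear_imp_has_derivative bounded_linear_vec_nth)
  then have "((\<lambda>z. 1 / z $ i) has_derivative (\<lambda>X. - (X $ i) / (c * c))) (at ?p)"
    using pi assms by (auto intro!: derivative_eq_intros simp: field_simps)
  moreover have "(pr has_derivative pr) (at ?p)"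
    by (rule bounded_linear_imp_has_derivative[OF bounded_linear_pr])
  ultimately have "((\<lambda>z. (1 / z $ i) *s pr z) has_derivative
      (\<lambda>X. (1 / ?p $ i) *s pr X + (- (X $ i) / (c * c)) *s pr ?p)) (at ?p)"
    by (rule bounded_bilinear.FDERIV[OF bounded_bilinear_smult])
  then have "((\<lambda>z. snd d (hopf (sgn z))) has_derivative
      (\<lambda>X. (1 / ?p $ i) *s pr X + (- (X $ i) / (c * c)) *s pr ?p)) (at ?p)"
    by (rule has_derivative_transform_within_open[OF _ op]) (use assms eq in auto)
  then have "dhopf d ?p X = (1 / ?p $ i) *s pr X + (- (X $ i) / (c * c)) *s pr ?p"
    unfolding dhopf_def by (simp only: frechet_derivativeI)
  also have "\<dots> = (1 / c) *s (pr X - X $ i *s x)"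
    using assms by (simp add: pr_smult vec_eq_iff field_simps)
  finally show ?thesis .
qed

lemma dhopf_lift: "c \<noteq> 0 \<Longrightarrow> dhopf d (c *s Z x) (c *s lift x v) = v"
  by (simp add: dhopf_Z lift_def pr_diff pr_smult vec_eq_iff)

lemma horizontal_herm: "horizontal p = {X. herm X p = 0}"
  by (auto simp: horizontal_def complex_eq_iff Re_herm Im_herm)

lemma horizontal_lift:
  assumes "c \<noteq> 0" "herm X (c *s Z x) = 0"
  shows "c *s lift x (dhopf d (c *s Z x) X) = X"
proof -
  have "herm ((1 / c) *s X) (Z x) = 0" using assms by (simp add: herm_scale)
  then obtain v where "(1 / c) *s X = lift x v" by (rule lift_surj)
  then have "X = c *s lift x v" using assms(1) by (auto simp: vec_eq_iff field_simps)
  then show ?thesis using dhopf_lift[OF assms(1)] by simp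
qed

lemma hlift_Z: "c \<noteq> 0 \<Longrightarrow> hlift d (c *s Z x) v = c *s lift x v"
  unfolding hlift_def horizontal_herm
proof (rule the_equality)
  assume c: "c \<noteq> 0"
  show "c *s lift x v \<in> {X. herm X (c *s Z x) = 0} \<and> dhopf d (c *s Z x) (c *s lift x v) = v"
    using dhopf_lift[OF c] by (simp add: herm_scale)
  show "X = c *s lift x v" if "X \<in> {X. herm X (c *s Z x) = 0} \<and> dhopf d (c *s Z x) X = v" for X
    using horizontal_lift[OF c, of X x] that by simp
qed

lemma herm_unit_scale:
  assumes "cmod c * norm (Z x) = 1"
  shows "herm (c *s u) (c *s v) = herm u v / of_real ((norm (Z x))\<^sup>2)"
proof -
  have "(c * cnj c) * of_real ((norm (Z x))\<^sup>2) = of_real ((cmod c * norm (Z x))\<^sup>2)"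
    by (simp add: complex_norm_square[symmetric] power_mult_distrib)
  then have "(c * cnj c) * of_real ((norm (Z x))\<^sup>2) = 1" using assms by simp
  then have "c * cnj c = 1 / of_real ((norm (Z x))\<^sup>2)" using NZ(2)[of x] by (simp add: eq_divide_eq)
  moreover have "herm (c *s u) (c *s v) = (c * cnj c) * herm u v" by (simp add: herm_scale mult_ac)
  ultimately show ?thesis by simp
qed

lemma om_unit_scale:
  assumes "cmod c * norm (Z x) = 1"
  shows "om (c *s Z x) (c *s u) * cnj (om (c *s Z x) (c *s v)) =
    om (Z x) u * cnj (om (Z x) v) / of_real ((norm (Z x))^4)"
proof -
  have "(c * cnj c) * of_real ((norm (Z x))\<^sup>2) = of_real ((cmod c * norm (Z x))\<^sup>2)"
    by (simp add: complex_norm_square[symmetric] power_mult_distrib)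
  then have "(c * cnj c) * of_real ((norm (Z x))\<^sup>2) = 1" using assms by simp
  then have c: "c * cnj c = 1 / of_real ((norm (Z x))\<^sup>2)" using NZ(2)[of x] by (simp add: eq_divide_eq)
  have "om (c *s Z x) (c *s u) * cnj (om (c *s Z x) (c *s v)) =
      (c * cnj c)\<^sup>2 * (om (Z x) u * cnj (om (Z x) v))"
    by (simp add: om_scale power2_eq_square mult_ac)
  then show ?thesis unfolding c by (simp add: power_divide flip: power_mult)
qed

lemma unit_nonzero: "cmod c * norm (Z x) = 1 \<Longrightarrow> c \<noteq> 0"
  by auto

lemma norm_unit: "cmod c * norm (Z x) = 1 \<Longrightarrow> norm (c *s Z x) = 1"
  by (simp add: norm_smult)

section \<open>Both metrics and the nearly Kaehler complex structure, expressed through horizontal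
  lifts\<close>

lemma g_FS_raw: "g_FS d x v w = Re (herm (lift x v) (lift x w)) / (norm (Z x))\<^sup>2"
proof -
  obtain c where c: "cmod c * norm (Z x) = 1" "pt_over d x = c *s Z x" by (rule pt_over_Z)
  show ?thesis
    unfolding g_FS_def c(2) hlift_Z[OF unit_nonzero[OF c(1)]] Re_herm[symmetric] herm_unit_scale[OF c(1)]
    by simp
qed

lemma g_FS_unit:
  assumes "cmod c * norm (Z x) = 1"
  shows "g_FS d x v w = (c *s lift x v) \<bullet> (c *s lift x w)"
  unfolding g_FS_raw Re_herm[symmetric] herm_unit_scale[OF assms] by simp

lemma span_jmul_kmul: "span {jmul p, kmul p} = {a *s jmul p | a. True}"
proof -
  have "span {jmul p, kmul p} = {s *\<^sub>R jmul p + t *\<^sub>R kmul p | s t. True}"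
  proof (intro equalityI subsetI)
    fix v assume "v \<in> span {jmul p, kmul p}"
    then obtain s t where "v - s *\<^sub>R jmul p = t *\<^sub>R kmul p"
      unfolding span_insert[of "jmul p"] span_singleton by blast
    then have "v = s *\<^sub>R jmul p + t *\<^sub>R kmul p" by (simp add: diff_eq_eq add.commute)
    then show "v \<in> {s *\<^sub>R jmul p + t *\<^sub>R kmul p | s t. True}" by blast
  next
    fix v assume "v \<in> {s *\<^sub>R jmul p + t *\<^sub>R kmul p | s t. True}"
    then obtain s t where "v = s *\<^sub>R jmul p + t *\<^sub>R kmul p" by blast
    then show "v \<in> span {jmul p, kmul p}" by (simp add: span_add span_scale span_base)
  qed
  also have "\<dots> = {a *s jmul p | a. True}"
  proof (intro equalityI subsetI)
    fix v assume "v \<in> {s *\<^sub>R jmul p + t *\<^sub>R kmul p | s t. True}"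
    then obtain s t where "v = s *\<^sub>R jmul p + t *\<^sub>R kmul p" by auto
    then have "v = Complex s t *s jmul p" by (simp add: kmul_def smult_Re_Im[of "Complex s t"])
    then show "v \<in> {a *s jmul p | a. True}" by blast
  next
    fix v assume "v \<in> {a *s jmul p | a. True}"
    then obtain a where v: "v = a *s jmul p" by auto
    have "v = Re a *\<^sub>R jmul p + Im a *\<^sub>R kmul p" unfolding v kmul_def by (rule smult_Re_Im)
    then show "v \<in> {s *\<^sub>R jmul p + t *\<^sub>R kmul p | s t. True}" by blast
  qed
  finally show ?thesis .
qed

text \<open>On lifts \<open>P\<close> is the Hermitian reflection in the complex line of
  \<open>jmul p\<close>: the coefficient of a horizontal vector along \<open>jmul p\<close> is its
  \<open>om p\<close>, and twice that component is removed.\<close>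

lemma P_NK_lift:
  assumes "pt_over d x = p" "p = c *s Z x" "cmod c * norm (Z x) = 1"
  shows "c *s lift x (P_NK d x v) = c *s lift x v - (2 * om p (c *s lift x v)) *s jmul p"
proof -
  have c: "c \<noteq> 0" using unit_nonzero[OF assms(3)] .
  have np: "norm p = 1" using norm_unit[OF assms(3)] assms(2) by simp
  have jp: "herm (a *s jmul p) p = 0" for a by (simp add: herm_scale herm_jmul_left)
  have jj: "herm (jmul p) (jmul p) = 1" by (simp add: herm_jmul herm_self np)
  let ?L = "\<lambda>v. c *s lift x v"
  let ?D = "dhopf d p"
  have LD: "?L (?D X) = X" if "herm X p = 0" for X
    using horizontal_lift[OF c] that assms(2) by simp
  have DL: "?D (?L v) = v" for v using dhopf_lift[OF c] assms(2) by simp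
  have Ladd: "?L (u + v) = ?L u + ?L v" "?L (u - v) = ?L u - ?L v" for u v
    by (simp_all add: lift_add linear_diff[OF lift_linear] vec_eq_iff algebra_simps)
  have Linj: "u = v" if "?L u = ?L v" for u v using DL that by metis
  have D1: "v \<in> D1 d x \<longleftrightarrow> (\<exists>a. ?L v = a *s jmul p)" for v
    unfolding D1_def assms(1) span_jmul_kmul using LD[OF jp] DL by (smt (verit) image_iff mem_Collect_eq)
  have gFS: "g_FS d x u v = ?L u \<bullet> ?L v" for u v by (rule g_FS_unit[OF assms(3)])
  have D2: "v \<in> D2 d x \<longleftrightarrow> herm (?L v) (jmul p) = 0" for v
  proof
    assume v: "v \<in> D2 d x"
    have "(?L v) \<bullet> (a *s jmul p) = 0" for a
    proof -
      have "?D (a *s jmul p) \<in> D1 d x" using D1 LD[OF jp] by blast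
      then have "g_FS d x v (?D (a *s jmul p)) = 0" using v by (simp add: D2_def)
      then show ?thesis by (simp add: gFS LD[OF jp])
    qed
    from this[of 1] this[of \<i>] show "herm (?L v) (jmul p) = 0"
      by (simp add: complex_eq_iff Re_herm Im_herm)
  next
    assume v: "herm (?L v) (jmul p) = 0"
    have "g_FS d x v w = 0" if w: "w \<in> D1 d x" for w
    proof -
      obtain a where "?L w = a *s jmul p" using w D1 by blast
      then show ?thesis unfolding gFS Re_herm[symmetric] by (simp only: herm_scale(2)[of "?L v"] v) simp
    qed
    then show "v \<in> D2 d x" by (simp add: D2_def)
  qed
  define V where "V = ?L v"
  have hV: "herm V p = 0" by (simp add: V_def assms(2) herm_scale)
  define b where "b = om p V"
  have b: "herm V (jmul p) = b" by (simp add: b_def om_swap[of p] herm_jmul_right)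
  define w where "w = ?D (V - (2 * b) *s jmul p)"
  have w: "?L w = V - (2 * b) *s jmul p"
    unfolding w_def by (rule LD) (simp add: herm_diff hV jp)
  have "P_NK d x v = w"
    unfolding P_NK_def
  proof (rule the_equality)
    show "\<exists>v1\<in>D1 d x. \<exists>v2\<in>D2 d x. v = v1 + v2 \<and> w = - v1 + v2"
    proof (intro bexI conjI)
      let ?v1 = "?D (b *s jmul p)"
      have L1: "?L ?v1 = b *s jmul p" by (rule LD[OF jp])
      show "?v1 \<in> D1 d x" using D1 L1 by blast
      show "v - ?v1 \<in> D2 d x"
        unfolding D2 Ladd L1 herm_diff herm_scale(1)[of b] jj b[unfolded V_def] by simp
      show "v = ?v1 + (v - ?v1)" by simp
      show "w = - ?v1 + (v - ?v1)"
      proof (rule Linj)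
        have "?L (- ?v1 + (v - ?v1)) = ?L (v - ?v1 - ?v1)" by (simp add: algebra_simps)
        also have "\<dots> = V - b *s jmul p - b *s jmul p" unfolding Ladd L1 V_def ..
        finally show "?L w = ?L (- ?v1 + (v - ?v1))" by (simp add: w vec_eq_iff algebra_simps)
      qed
    qed
  next
    fix w' assume "\<exists>v1\<in>D1 d x. \<exists>v2\<in>D2 d x. v = v1 + v2 \<and> w' = - v1 + v2"
    then obtain v1 v2 where v: "v1 \<in> D1 d x" "v2 \<in> D2 d x" "v = v1 + v2" "w' = - v1 + v2" by blast
    obtain a where a: "?L v1 = a *s jmul p" using v(1) D1 by blast
    have "b = herm (?L v1 + ?L v2) (jmul p)" using b v(3) by (simp add: V_def Ladd)
    also have "\<dots> = a" using v(2) a by (simp add: D2 herm_add herm_scale jj)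
    finally have "a = b" ..
    have "w' = v - v1 - v1" using v by simp
    then have "?L w' = ?L (v - v1 - v1)" by (simp only:)
    also have "\<dots> = V - a *s jmul p - a *s jmul p" unfolding Ladd a V_def ..
    finally have "?L w' = ?L w" using \<open>a = b\<close> by (simp add: w vec_eq_iff algebra_simps)
    then show "w' = w" by (rule Linj)
  qed
  then show ?thesis using w by (simp add: V_def b_def)
qed

text \<open>The weights 3/2 and 1/2 add up to 2 on the inner product, while half of the doubled
  reflection term leaves \<open>om\<close> with weight 1.\<close>

lemma g_NK_unit0:
  assumes "pt_over d x = p" "p = c *s Z x" "cmod c * norm (Z x) = 1"
  shows "g_NK d x v w = 2 * ((c *s lift x v) \<bullet> (c *s lift x w))
    - Re (om p (c *s lift x v) * cnj (om p (c *s lift x w)))"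
proof -
  define V W where "V = c *s lift x v" and "W = c *s lift x w"
  have "herm V ((2 * om p W) *s jmul p) = 2 * (om p V * cnj (om p W))"
    by (simp add: herm_scale om_swap[of p V] herm_jmul_right)
  then have "V \<bullet> (W - (2 * om p W) *s jmul p) = V \<bullet> W - 2 * Re (om p V * cnj (om p W))"
    by (simp add: Re_herm[symmetric] herm_diff)
  then show ?thesis
    unfolding g_NK_def g_FS_unit[OF assms(3)] P_NK_lift[OF assms] V_def[symmetric] W_def[symmetric]
    by linarith
qed

text \<open>No representative of the fibre occurs any more, so the formula at the point chosen by
  \<open>pt_over\<close> extends to every unit point of the fibre in
  \<open>g_NK_unit\<close>.\<close>

lemma g_NK_raw:
  "g_NK d x v w = 2 * Re (herm (lift x v) (lift x w)) / (norm (Z x))\<^sup>2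
    - Re (om (Z x) (lin v) * cnj (om (Z x) (lin w))) / (norm (Z x))^4"
proof -
  obtain c where c: "cmod c * norm (Z x) = 1" "pt_over d x = c *s Z x" by (rule pt_over_Z)
  show ?thesis
    unfolding g_NK_unit0[OF c(2) refl c(1)] Re_herm[symmetric] herm_unit_scale[OF c(1)]
      om_unit_scale[OF c(1)] om_Z_lift
    by (simp only: Re_divide_of_real)
qed

lemma g_NK_unit:
  assumes "cmod c * norm (Z x) = 1"
  shows "g_NK d x v w = 2 * ((c *s lift x v) \<bullet> (c *s lift x w))
    - Re (om (c *s Z x) (c *s lift x v) * cnj (om (c *s Z x) (c *s lift x w)))"
  unfolding g_NK_raw Re_herm[symmetric] herm_unit_scale[OF assms]
      om_unit_scale[OF assms] om_Z_lift
  by (simp only: Re_divide_of_real)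

text \<open>The factor 3 is 4 - 1. The reflection subtracts \<open>2 * om p (\<i> *s V)\<close>
  times \<open>jmul p\<close>, which costs 4 in the doubled Hermitian term; and \<open>om p\<close>
  of the image of \<open>V\<close> is \<open>- \<i> * om p V\<close>, which gives 1 back through the
  second term of the metric.\<close>

lemma g_NK_J:
  assumes "cmod c * norm (Z x) = 1"
  shows "g_NK d x (J_NK d x v) w = 2 * Re (\<i> * herm (c *s lift x v) (c *s lift x w))
    - 3 * Re (\<i> * (om (c *s Z x) (c *s lift x v) * cnj (om (c *s Z x) (c *s lift x w))))"
proof -
  obtain e where e: "cmod e * norm (Z x) = 1" "pt_over d x = e *s Z x" by (rule pt_over_Z)
  define p where "p = e *s Z x"
  have np: "norm p = 1" using norm_unit[OF e(1)] p_def by simp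
  have pt: "pt_over d x = p" using e p_def by simp
  have e0: "e \<noteq> 0" using unit_nonzero[OF e(1)] .
  let ?L = "\<lambda>v. e *s lift x v"
  have hp: "herm (?L v) p = 0" for v by (simp add: p_def herm_scale)
  have "?L (J_FS d x v) = \<i> *s ?L v"
    unfolding J_FS_def pt p_def hlift_Z[OF e0]
    by (rule horizontal_lift[OF e0]) (simp add: herm_scale)
  then have LJ: "?L (J_NK d x v) = \<i> *s ?L v - (2 * om p (\<i> *s ?L v)) *s jmul p"
    unfolding J_NK_def using P_NK_lift[OF pt p_def e(1)] by simp
  have "om p (jmul p) = 1" by (simp add: om_jmul herm_self np)
  then have o: "om p (?L (J_NK d x v)) = - \<i> * om p (?L v)"
    unfolding LJ by (simp add: om_diff om_scale algebra_simps)
  have j: "herm (jmul p) (?L w) = cnj (om p (?L w))"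
    by (simp add: herm_jmul_left om_swap[of p])
  have "g_NK d x (J_NK d x v) w = 2 * Re (herm (?L (J_NK d x v)) (?L w)) - Re (om p (?L (J_NK d x v)) * cnj (om p (?L w)))"
    unfolding g_NK_unit0[OF pt p_def e(1)] Re_herm ..
  also have "\<dots> = 2 * Re (\<i> * herm (?L v) (?L w)) - 3 * Re (\<i> * (om p (?L v) * cnj (om p (?L w))))"
  proof -
    define V W where "V = ?L v" and "W = ?L w"
    have E: "herm (?L (J_NK d x v)) W = \<i> * herm V W - 2 * \<i> * (om p V * cnj (om p W))"
      unfolding LJ V_def[symmetric] herm_diff herm_scale(1) j[folded W_def] om_scale(2)
      by simp
    show ?thesis unfolding o V_def[symmetric] W_def[symmetric] E by (simp add: algebra_simps)
  qed
  also have "\<dots> = 2 * Re (\<i> * herm (c *s lift x v) (c *s lift x w))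
    - 3 * Re (\<i> * (om (c *s Z x) (c *s lift x v) * cnj (om (c *s Z x) (c *s lift x w))))"
    unfolding p_def herm_unit_scale[OF e(1)] herm_unit_scale[OF assms]
      om_unit_scale[OF e(1)] om_unit_scale[OF assms] ..
  finally show ?thesis .
qed

end

section \<open>Quaternionic unitary maps act by isometries\<close>

lemma (in aff) mem_dom:
  assumes "norm p = 1" shows "hopf p \<in> fst d \<longleftrightarrow> p $ i \<noteq> 0"
proof
  assume "hopf p \<in> fst d"
  then obtain q where q: "q $ i \<noteq> 0" "hopf q = hopf p" by (auto simp: dom)
  then obtain c where "q = c *s p" using hopf_eqD by blast
  then show "p $ i \<noteq> 0" using q by auto
qed (use assms in \<open>auto simp: dom\<close>)

lemma (in aff) lift_unique:
  assumes "herm X (Z x) = 0" "X = lin v + c *s Z x"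
  shows "lift x v = X"
proof -
  have "X - lift x v = (c + h x v) *s Z x"
    unfolding assms(2) lift_def by (simp add: vec_eq_iff algebra_simps)
  moreover have "herm (X - lift x v) (Z x) = 0" by (simp add: herm_diff assms(1))
  ultimately have "(c + h x v) * of_real ((norm (Z x))\<^sup>2) = 0" by (simp only: herm_scale herm_self)
  then have "c + h x v = 0" using NZ(2)[of x] by simp
  then have "X - lift x v = 0" using \<open>X - lift x v = (c + h x v) *s Z x\<close> by simp
  then show ?thesis by simp
qed

context
  fixes A
  assumes A: "qunitary A"
begin

context
  fixes \<phi> :: "(complex^4) set \<Rightarrow> (complex^4) set"
  assumes \<phi>: "\<And>p. norm p = 1 \<Longrightarrow> \<phi> (hopf p) = hopf (A p)"
begin

text \<open>Only the values of \<open>\<phi>\<close> on fibres of unit vectors are prescribed, so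
  that everything in this context applies both to the image map of \<open>A\<close> and to its
  \<open>inv_into\<close>. Continuity is checked on the sphere, as the topology of
  \<open>CP3\<close> is a quotient.\<close>

lemma qunitary_continuous_map: "continuous_map CP3 CP3 \<phi>"
  unfolding continuous_map
proof (intro conjI allI impI)
  show "\<phi> ` topspace CP3 \<subseteq> topspace CP3"
    using \<phi> qunitary_norm[OF A] by (auto simp: topspace_CP3)
  fix U assume U: "openin CP3 U"
  have "{p \<in> sphere 0 1. hopf p \<in> {X \<in> topspace CP3. \<phi> X \<in> U}} = sphere 0 1 \<inter> A -` {p \<in> sphere 0 1. hopf p \<in> U}"
    using \<phi> qunitary_norm[OF A] by (auto simp: topspace_CP3)
  moreover have "openin (top_of_set (sphere 0 1)) (sphere 0 1 \<inter> A -` {p \<in> sphere 0 1. hopf p \<in> U})"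
    using U qunitary_norm[OF A]
    by (intro continuous_openin_preimage[where T = "sphere 0 1"] linear_continuous_on qunitary_bounded_linear[OF A])
       (auto simp: openin_CP3)
  ultimately show "openin CP3 {X \<in> topspace CP3. \<phi> X \<in> U}"
    by (auto simp: openin_CP3 topspace_CP3)
qed

context
  fixes i i' lin lin' pr pr' c d
  assumes c: "aff i lin pr c" and d: "aff i' lin' pr' d"
begin

interpretation c: aff i lin pr c by (rule c)
interpretation d: aff i' lin' pr' d by (rule d)

lemma qunitary_rep_dom: "rep_dom c d \<phi> = {x. A (c.Z x) $ i' \<noteq> 0}"
proof -
  have 1: "\<phi> (hopf (sgn (c.Z x))) \<in> fst d \<longleftrightarrow> A (c.Z x) $ i' \<noteq> 0" for x
  proof -
    have n: "norm (sgn (c.Z x)) = 1" by (simp add: norm_sgn)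
    have "norm (A (sgn (c.Z x))) = 1" using qunitary_norm[OF A] n by simp
    then show ?thesis unfolding \<phi>[OF n] d.mem_dom[OF \<open>norm (A (sgn (c.Z x))) = 1\<close>]
      by (simp add: vec_sgn_smult qunitary_smult[OF A])
  qed
  show ?thesis
  proof (intro equalityI subsetI)
    fix x assume "x \<in> rep_dom c d \<phi>"
    then obtain X where X: "X \<in> fst c" "\<phi> X \<in> fst d" "x = snd c X" by (auto simp: rep_dom_def)
    then have "hopf (sgn (c.Z x)) = X" using c.chart_inv_map c.chart_inv_Z by metis
    then show "x \<in> {x. A (c.Z x) $ i' \<noteq> 0}" using X(2) 1[of x] by simp
  next
    fix x assume "x \<in> {x. A (c.Z x) $ i' \<noteq> 0}"
    then have "hopf (sgn (c.Z x)) \<in> fst c \<inter> \<phi> -` fst d" using 1 c.dom_Z by auto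
    then show "x \<in> rep_dom c d \<phi>" unfolding rep_dom_def using c.map_Z by (metis imageI)
  qed
qed

lemma open_symp_rep_dom: "open (rep_dom c d \<phi>)"
  unfolding qunitary_rep_dom c.Z_def qunitary_add[OF A]
  by (intro open_Collect_neq continuous_intros linear_continuous_on
      bounded_linear_compose[OF qunitary_bounded_linear[OF A] c.bounded_linear_lin])

lemma qunitary_rep:
  assumes "A (c.Z x) $ i' \<noteq> 0"
  shows "rep c d \<phi> x = (1 / (A (c.Z x) $ i')) *s pr' (A (c.Z x))"
    and "d.Z (rep c d \<phi> x) = (1 / (A (c.Z x) $ i')) *s A (c.Z x)"
proof -
  have n: "norm (sgn (c.Z x)) = 1" by (simp add: norm_sgn)
  define r :: complex where "r = of_real (1 / norm (c.Z x))"
  have r: "r \<noteq> 0" "A (sgn (c.Z x)) = r *s A (c.Z x)"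
    by (simp_all add: r_def vec_sgn_smult qunitary_smult[OF A])
  have "rep c d \<phi> x = snd d (hopf (A (sgn (c.Z x))))"
    by (simp add: rep_def c.chart_inv_Z \<phi> n)
  also have "\<dots> = (1 / (r * A (c.Z x) $ i')) *s (r *s pr' (A (c.Z x)))"
    using assms r by (subst d.map) (simp_all add: d.pr_smult)
  also have "\<dots> = (1 / (A (c.Z x) $ i')) *s pr' (A (c.Z x))"
    using r by (simp add: vec_eq_iff)
  finally show 1: "rep c d \<phi> x = (1 / (A (c.Z x) $ i')) *s pr' (A (c.Z x))" .
  show "d.Z (rep c d \<phi> x) = (1 / (A (c.Z x) $ i')) *s A (c.Z x)"
  proof -
    define m where "m = A (c.Z x) $ i'"
    have "A (c.Z x) = m *s d.Z ((1 / m) *s pr' (A (c.Z x)))"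
      unfolding m_def by (rule d.Z_unique[OF assms])
    then have "(1 / m) *s A (c.Z x) = (1 / m) *s (m *s d.Z ((1 / m) *s pr' (A (c.Z x))))" by (rule arg_cong)
    then show ?thesis using assms unfolding 1 m_def[symmetric] by (simp add: smult_assoc)
  qed
qed

lemma qunitary_rep_smooth: "smooth_on (rep_dom c d \<phi>) (rep c d \<phi>)"
proof -
  have lin: "bounded_linear (\<lambda>x. A (lin x))"
    by (rule bounded_linear_compose[OF qunitary_bounded_linear[OF A] c.bounded_linear_lin])
  have li: "bounded_linear (\<lambda>x. A (lin x) $ i')"
    by (rule bounded_linear_compose[OF bounded_linear_vec_nth lin])
  have lp: "bounded_linear (\<lambda>x. pr' (A (lin x)))"
    by (rule bounded_linear_compose[OF d.bounded_linear_pr lin])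
  have op: "open (rep_dom c d \<phi>)" by (rule open_symp_rep_dom)
  have "Ck_on k (rep_dom c d \<phi>) (\<lambda>x. inverse (A (c.Z x) $ i') *s pr' (A (c.Z x)))" for k
  proof (intro Ck_on_bilinear[OF op bounded_bilinear_smult] Ck_on_inverse[OF op])
    show "A (c.Z x) $ i' \<noteq> 0" if "x \<in> rep_dom c d \<phi>" for x using that qunitary_rep_dom by simp
    show "Ck_on k (rep_dom c d \<phi>) (\<lambda>x. A (c.Z x) $ i')"
      unfolding c.Z_def qunitary_add[OF A] vector_add_component
      by (intro Ck_on_add[OF op] Ck_on_const Ck_on_bounded_linear li)
    show "Ck_on k (rep_dom c d \<phi>) (\<lambda>x. pr' (A (c.Z x)))"
      unfolding c.Z_def qunitary_add[OF A] d.pr_add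
      by (intro Ck_on_add[OF op] Ck_on_const Ck_on_bounded_linear lp)
  qed
  then have "Ck_on k (rep_dom c d \<phi>) (rep c d \<phi>)" for k
    by (rule Ck_on_cong[OF op, rotated]) (simp add: qunitary_rep_dom qunitary_rep(1) inverse_eq_divide)
  then show ?thesis by (simp add: smooth_on_def)
qed

text \<open>On the source chart \<open>A (c.Z x)\<close> equals \<open>\<mu> x\<close> times the
  vector \<open>d.Z\<close> of the image point. Differentiating this relation yields the wanted lift
  and a multiple of \<open>d.Z\<close>, and horizontality fixes that multiple.\<close>

lemma qunitary_rep_lift:
  assumes x: "x \<in> rep_dom c d \<phi>"
  shows "d.lift (rep c d \<phi> x) (frechet_derivative (rep c d \<phi>) (at x) u)
    = (1 / (A (c.Z x) $ i')) *s A (c.lift x u)"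
proof (rule d.lift_unique)
  define \<mu> where "\<mu> x = A (c.Z x) $ i'" for x
  define D where "D = frechet_derivative (rep c d \<phi>) (at x)"
  have \<mu>: "\<mu> x \<noteq> 0" using x by (simp add: qunitary_rep_dom \<mu>_def)
  have "(rep c d \<phi> has_derivative D) (at x)"
    using smooth_onD(1)[OF qunitary_rep_smooth x] by (simp add: D_def)
  from has_derivative_compose[OF this d.Z_has_derivative]
  have dZ: "((\<lambda>y. d.Z (rep c d \<phi> y)) has_derivative (\<lambda>u. lin' (D u))) (at x)" .
  have bA: "((\<lambda>y. A (c.Z y)) has_derivative (\<lambda>u. A (lin u))) (at x)"
    by (rule bounded_linear.has_derivative[OF qunitary_bounded_linear[OF A] c.Z_has_derivative])
  have "((\<lambda>y. A (c.Z y)) has_derivative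
       (\<lambda>u. \<mu> x *s lin' (D u) + (A (lin u) $ i') *s d.Z (rep c d \<phi> x))) (at x)"
  proof -
    have "((\<lambda>y. A (c.Z y) $ i') has_derivative (\<lambda>u. A (lin u) $ i')) (at x)"
      by (rule bounded_linear.has_derivative[OF bounded_linear_vec_nth bA])
    then have m: "(\<mu> has_derivative (\<lambda>u. A (lin u) $ i')) (at x)" by (simp add: \<mu>_def[abs_def])
    have "((\<lambda>y. \<mu> y *s d.Z (rep c d \<phi> y)) has_derivative
       (\<lambda>u. \<mu> x *s lin' (D u) + (A (lin u) $ i') *s d.Z (rep c d \<phi> x))) (at x)"
      by (rule bounded_bilinear.FDERIV[OF bounded_bilinear_smult m dZ])
    then show ?thesis
      by (rule has_derivative_transform_within_open[OF _ open_symp_rep_dom x])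
         (simp add: qunitary_rep_dom qunitary_rep(2) \<mu>_def smult_assoc)
  qed
  note eq = fun_cong[OF has_derivative_unique[OF bA this], of u]
  define s where "s = A (lin u) $ i'"
  have Al: "A (lin u) = \<mu> x *s lin' (D u) + s *s d.Z (rep c d \<phi> x)"
    unfolding s_def by (rule eq)
  have "A (c.Z x) = \<mu> x *s d.Z (rep c d \<phi> x)"
    using \<mu> by (simp add: qunitary_rep(2) \<mu>_def smult_assoc)
  then have AL: "A (c.lift x u) = \<mu> x *s lin' (D u) + (s - c.h x u * \<mu> x) *s d.Z (rep c d \<phi> x)"
    by (simp add: c.lift_def qunitary_diff[OF A] qunitary_smult[OF A] Al vec_eq_iff algebra_simps)
  show "(1 / (A (c.Z x) $ i')) *s A (c.lift x u) = lin' (frechet_derivative (rep c d \<phi>) (at x) u)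
      + ((s - c.h x u * \<mu> x) / \<mu> x) *s d.Z (rep c d \<phi> x)"
    unfolding \<mu>_def[of x, symmetric] D_def[symmetric] AL using \<mu>
    by (simp add: vector_add_ldistrib vector_sub_rdistrib smult_assoc diff_divide_distrib)
  show "herm ((1 / (A (c.Z x) $ i')) *s A (c.lift x u)) (d.Z (rep c d \<phi> x)) = 0"
    unfolding qunitary_rep(2)[OF \<mu>[unfolded \<mu>_def]] herm_scale qunitary_herm[OF A] by simp
qed

lemma qunitary_g_NK:
  assumes x: "x \<in> rep_dom c d \<phi>"
  shows "g_NK d (rep c d \<phi> x) (frechet_derivative (rep c d \<phi>) (at x) u) (frechet_derivative (rep c d \<phi>) (at x) v)
    = g_NK c x u v"
proof -
  define \<mu> where "\<mu> = A (c.Z x) $ i'"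
  have \<mu>: "\<mu> \<noteq> 0" using x by (simp add: qunitary_rep_dom \<mu>_def)
  define e :: complex where "e = of_real (1 / norm (c.Z x))"
  have e: "cmod e * norm (c.Z x) = 1" by (simp add: e_def norm_divide)
  have Z: "(e * \<mu>) *s d.Z (rep c d \<phi> x) = A (e *s c.Z x)"
    using \<mu> by (simp add: qunitary_rep(2) \<mu>_def smult_assoc qunitary_smult[OF A])
  have L: "(e * \<mu>) *s d.lift (rep c d \<phi> x) (frechet_derivative (rep c d \<phi>) (at x) u) = A (e *s c.lift x u)" for u
    using \<mu> by (simp add: qunitary_rep_lift[OF x] \<mu>_def smult_assoc qunitary_smult[OF A])
  have "norm ((e * \<mu>) *s d.Z (rep c d \<phi> x)) = 1"
    unfolding Z qunitary_norm[OF A] using e by (simp add: norm_smult)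
  then have e': "cmod (e * \<mu>) * norm (d.Z (rep c d \<phi> x)) = 1" by (simp add: norm_smult)
  show ?thesis
    unfolding d.g_NK_unit[OF e'] c.g_NK_unit[OF e] L Z Re_herm[symmetric] qunitary_herm[OF A] qunitary_om[OF A] ..
qed

end

lemma qunitary_smooth_map: "smooth_map CP3 CP3_atlas CP3 CP3_atlas \<phi>"
  unfolding smooth_map_def
proof (intro conjI ballI qunitary_continuous_map)
  fix c d assume "c \<in> CP3_atlas" "d \<in> CP3_atlas"
  then obtain i lin pr i' lin' pr' where "aff i lin pr c" "aff i' lin' pr' d"
    by (metis CP3_atlas_aff)
  then show "smooth_on (rep_dom c d \<phi>) (rep c d \<phi>)" by (rule qunitary_rep_smooth)
qed

end

end

lemma qunitary_isometry:
  assumes A: "qunitary A"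
  defines "\<phi> \<equiv> \<lambda>X. A ` X"
  shows "isometry CP3 CP3_atlas g_NK \<phi>" and "\<phi> (hopf p) = hopf (A p)"
proof -
  obtain B where B: "qunitary B" and AB: "\<And>v. A (B v) = v" and BA: "\<And>v. B (A v) = v"
    using qunitary_inverse[OF A] by blast
  show \<phi>: "\<phi> (hopf p) = hopf (A p)" for p
    unfolding \<phi>_def hopf_def by (simp add: full_SetCompr_eq image_image qunitary_smult[OF A])
  have inj: "inj \<phi>" unfolding \<phi>_def
    by (metis BA injI inj_image_eq_iff)
  have bij: "bij_betw \<phi> (topspace CP3) (topspace CP3)"
  proof (rule bij_betw_imageI)
    show "inj_on \<phi> (topspace CP3)" using inj inj_on_subset by blast
    show "\<phi> ` topspace CP3 = topspace CP3"
    proof (intro equalityI subsetI)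
      fix X assume "X \<in> \<phi> ` topspace CP3"
      then show "X \<in> topspace CP3" using \<phi> qunitary_norm[OF A] by (auto simp: topspace_CP3)
    next
      fix X assume "X \<in> topspace CP3"
      then obtain p where p: "norm p = 1" "X = hopf p" by (auto simp: topspace_CP3)
      then have "X = \<phi> (hopf (B p))" using \<phi> AB by simp
      then show "X \<in> \<phi> ` topspace CP3" using p qunitary_norm[OF B] by (auto simp: topspace_CP3)
    qed
  qed
  have inv: "inv_into (topspace CP3) \<phi> (hopf p) = hopf (B p)" if "norm p = 1" for p
  proof (rule inv_into_f_eq)
    show "inj_on \<phi> (topspace CP3)" using inj inj_on_subset by blast
    show "hopf (B p) \<in> topspace CP3" using that qunitary_norm[OF B] by (auto simp: topspace_CP3)
    show "\<phi> (hopf (B p)) = hopf p" using \<phi> AB by simp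
  qed
  show "isometry CP3 CP3_atlas g_NK \<phi>"
    unfolding isometry_def diffeomorphism_def
  proof (intro conjI ballI allI bij)
    show "smooth_map CP3 CP3_atlas CP3 CP3_atlas \<phi>" using qunitary_smooth_map[OF A] \<phi> by blast
    show "smooth_map CP3 CP3_atlas CP3 CP3_atlas (inv_into (topspace CP3) \<phi>)"
      using qunitary_smooth_map[OF B] inv by blast
    fix c d x u v assume cd: "c \<in> CP3_atlas" "d \<in> CP3_atlas" and x: "x \<in> rep_dom c d \<phi>"
    then obtain i lin pr i' lin' pr' where cd: "aff i lin pr c" "aff i' lin' pr' d"
      by (metis CP3_atlas_aff)
    show "let d\<phi> = frechet_derivative (rep c d \<phi>) (at x) in
      g_NK d (rep c d \<phi> x) (d\<phi> u) (d\<phi> v) = g_NK c x u v"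
      unfolding Let_def using qunitary_g_NK[OF A _ cd x] \<phi> by blast
  qed
qed

section \<open>The Levi-Civita connections in affine charts\<close>

context aff
begin

lemma h_minus: "h x (- u) = - h x u"
  using h_scaleR[of x "-1" u] by simp

lemma h_diff: "h x (u - v) = h x u - h x v"
  using h_add[of x u "- v"] by (simp add: h_minus)

definition N :: "complex^3 \<Rightarrow> real" where "N x = (norm (Z x))\<^sup>2"

lemma N_pos [simp]: "N x > 0" "N x \<noteq> 0" by (simp_all add: N_def)

lemma herm_lin_Z: "herm (lin u) (Z x) = h x u * N x" and herm_Z_lin: "herm (Z x) (lin u) = cnj (h x u) * N x"
proof -
  show 1: "herm (lin u) (Z x) = h x u * N x" using NZ(2)[of x] by (simp add: h_def N_def)
  show "herm (Z x) (lin u) = cnj (h x u) * N x"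
    using arg_cong[OF 1, of cnj] by (simp add: cnj_herm)
qed

lemma herm_lift: "herm (lift x u) (lift x v) / N x = herm (lin u) (lin v) / N x - h x u * cnj (h x v)"
proof -
  have "herm (lift x u) (lift x v) = herm (lin u) (lin v) - h x u * cnj (h x v) * N x"
    unfolding lift_def herm_diff herm_scale herm_lin_Z herm_Z_lin
    by (simp add: herm_self N_def algebra_simps)
  then show ?thesis by (simp add: diff_divide_distrib)
qed

lemma g_FS_h: "g_FS d x u v = Re (herm (lin u) (lin v) / N x - h x u * cnj (h x v))"
proof -
  have "g_FS d x u v = Re (herm (lift x u) (lift x v) / N x)"
    by (simp add: g_FS_raw N_def[symmetric])
  then show ?thesis by (simp only: herm_lift)
qed

text \<open>The correction that separates the nearly Kaehler metric from twice the Fubini-Study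
  metric: the real square of the contact form, divided by the power of \<open>N\<close> that
  compensates the length of \<open>Z x\<close>.\<close>

definition B :: "complex^3 \<Rightarrow> complex^3 \<Rightarrow> complex^3 \<Rightarrow> real" where
  "B x u v = Re (om (Z x) (lin u) * cnj (om (Z x) (lin v))) / (N x)\<^sup>2"

lemma g_NK_B: "g_NK d x u v = 2 * g_FS d x u v - B x u v"
  unfolding g_NK_raw g_FS_raw B_def N_def by (simp flip: power_mult)

lemma N_has_derivative: "(N has_derivative (\<lambda>a. 2 * Re (h x a) * N x)) (at x)"
proof -
  have "((\<lambda>x. Z x \<bullet> Z x) has_derivative (\<lambda>a. Z x \<bullet> lin a + lin a \<bullet> Z x)) (at x)"
    by (rule has_derivative_inner[OF Z_has_derivative Z_has_derivative])
  moreover have "lin a \<bullet> Z x = Re (h x a) * N x" for a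
    by (simp add: Re_herm[symmetric] herm_lin_Z)
  moreover have "N = (\<lambda>x. Z x \<bullet> Z x)" by (simp add: fun_eq_iff N_def power2_norm_eq_inner)
  ultimately show ?thesis by (simp add: inner_commute mult.assoc)
qed

lemma invN_has_derivative:
  "((\<lambda>x. complex_of_real (1 / N x)) has_derivative (\<lambda>a. - 2 * Re (h x a) * complex_of_real (1 / N x))) (at x)"
proof -
  have "((\<lambda>x. 1 / N x) has_derivative (\<lambda>a. - 2 * Re (h x a) * (1 / N x))) (at x)"
    by (rule has_derivative_eq_rhs, rule has_derivative_divide[OF has_derivative_const N_has_derivative])
       (auto simp: fun_eq_iff field_simps)
  from has_derivative_of_real[OF this, where 'a = complex] show ?thesis by simp
qed

definition hderiv :: "complex^3 \<Rightarrow> complex^3 \<Rightarrow> complex^3 \<Rightarrow> complex" where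
  "hderiv x u a = herm (lin u) (lin a) / N x - 2 * h x u * Re (h x a)"

lemma hderiv_cnj: "hderiv x u a = herm (lin u) (lin a) / N x - h x u * (h x a + cnj (h x a))"
proof -
  have "h x a + cnj (h x a) = 2 * of_real (Re (h x a))" by (simp add: complex_eq_iff)
  then show ?thesis by (simp add: hderiv_def)
qed

lemma h_has_derivative: "((\<lambda>x. h x u) has_derivative hderiv x u) (at x)"
proof -
  have "((\<lambda>x. herm (lin u) (Z x)) has_derivative (\<lambda>a. herm (lin u) (lin a))) (at x)"
    by (rule bounded_linear.has_derivative[OF bounded_bilinear.bounded_linear_right[OF bounded_bilinear_herm] Z_has_derivative])
  from has_derivative_mult[OF this invN_has_derivative]
  have "((\<lambda>x. herm (lin u) (Z x) * complex_of_real (1 / N x)) has_derivative hderiv x u) (at x)"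
    by (rule has_derivative_eq_rhs) (simp add: fun_eq_iff hderiv_def herm_lin_Z)
  then show ?thesis by (simp add: h_def[abs_def] N_def)
qed

lemma g_FS_has_derivative:
  "((\<lambda>x. g_FS d x u v) has_derivative (\<lambda>a. Re (- 2 * Re (h x a) * (herm (lin u) (lin v) / N x)
     - hderiv x u a * cnj (h x v) - h x u * cnj (hderiv x v a)))) (at x)"
proof -
  have "((\<lambda>x. herm (lin u) (lin v) * complex_of_real (1 / N x)) has_derivative
      (\<lambda>a. - 2 * Re (h x a) * (herm (lin u) (lin v) / N x))) (at x)"
    by (rule has_derivative_eq_rhs, rule has_derivative_mult_right[OF invN_has_derivative])
       (simp add: fun_eq_iff)
  moreover have "((\<lambda>x. h x u * cnj (h x v)) has_derivative
      (\<lambda>a. h x u * cnj (hderiv x v a) + hderiv x u a * cnj (h x v))) (at x)"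
    by (intro has_derivative_mult h_has_derivative bounded_linear.has_derivative[OF bounded_linear_cnj])
  ultimately have "((\<lambda>x. herm (lin u) (lin v) * complex_of_real (1 / N x) - h x u * cnj (h x v)) has_derivative
      (\<lambda>a. - 2 * Re (h x a) * (herm (lin u) (lin v) / N x) - (h x u * cnj (hderiv x v a) + hderiv x u a * cnj (h x v)))) (at x)"
    by (rule has_derivative_diff)
  from bounded_linear.has_derivative[OF bounded_linear_Re this]
  show ?thesis unfolding g_FS_h by (simp add: algebra_simps)
qed

lemma B_has_derivative:
  "((\<lambda>x. B x u v) has_derivative (\<lambda>a. Re (om (lin a) (lin u) * cnj (om (Z x) (lin v))
     + om (Z x) (lin u) * cnj (om (lin a) (lin v))) / (N x)\<^sup>2 - 4 * Re (h x a) * B x u v)) (at x)"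
proof -
  have o: "((\<lambda>x. om (Z x) w) has_derivative (\<lambda>a. om (lin a) w)) (at x)" for w
    by (rule bounded_linear.has_derivative[OF bounded_bilinear.bounded_linear_left[OF bounded_bilinear_om] Z_has_derivative])
  have 1: "((\<lambda>x. Re (om (Z x) (lin u) * cnj (om (Z x) (lin v)))) has_derivative
      (\<lambda>a. Re (om (Z x) (lin u) * cnj (om (lin a) (lin v)) + om (lin a) (lin u) * cnj (om (Z x) (lin v))))) (at x)"
    by (intro bounded_linear.has_derivative[OF bounded_linear_Re] has_derivative_mult
        bounded_linear.has_derivative[OF bounded_linear_cnj] o)
  have 2: "((\<lambda>x. (N x)\<^sup>2) has_derivative (\<lambda>a. 4 * Re (h x a) * (N x)\<^sup>2)) (at x)"
    by (rule has_derivative_eq_rhs, rule has_derivative_power[OF N_has_derivative])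
       (simp add: fun_eq_iff power2_eq_square)
  show ?thesis unfolding B_def
    by (rule has_derivative_eq_rhs, rule has_derivative_divide[OF 1 2])
       (auto simp: fun_eq_iff divide_simps power2_eq_square algebra_simps)
qed

lemma g_NK_has_derivative:
  "((\<lambda>x. g_NK d x u v) has_derivative (\<lambda>a. 2 * Re (- 2 * Re (h x a) * (herm (lin u) (lin v) / N x)
     - hderiv x u a * cnj (h x v) - h x u * cnj (hderiv x v a)) - (Re (om (lin a) (lin u) * cnj (om (Z x) (lin v))
     + om (Z x) (lin u) * cnj (om (lin a) (lin v))) / (N x)\<^sup>2 - 4 * Re (h x a) * B x u v))) (at x)"
  unfolding g_NK_B
  by (intro has_derivative_diff has_derivative_mult_right g_FS_has_derivative B_has_derivative)

lemma inner_form_FS: "inner_form (g_FS d x)"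
proof (rule inner_form.intro)
  show "linear (\<lambda>u. g_FS d x u v)" for v
    by (rule linearI) (simp_all add: g_FS_raw lift_add lift_scaleR herm_add herm_scaleR add_divide_distrib)
  show "g_FS d x u v = g_FS d x v u" for u v
    by (simp add: g_FS_raw Re_herm inner_commute)
  show "g_FS d x u u > 0" if "u \<noteq> 0" for u
    using that by (simp add: g_FS_raw Re_herm)
qed

lemma inner_form_NK: "inner_form (g_NK d x)"
proof (rule inner_form.intro)
  show "linear (\<lambda>u. g_NK d x u v)" for v
    by (rule linearI) (simp_all add: g_NK_raw lift_add lift_scaleR lin_add lin_scaleR herm_add herm_scaleR
        om_add om_scaleR add_divide_distrib algebra_simps)
  show "g_NK d x u v = g_NK d x v u" for u v
    by (simp add: g_NK_raw Re_herm inner_commute mult.commute)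
  show "g_NK d x u u > 0" if "u \<noteq> 0" for u
  proof -
    obtain c where c: "cmod c * norm (Z x) = 1" by (metis pt_over_Z)
    let ?u = "c *s lift x u" and ?p = "c *s Z x"
    have "norm ?u > 0" using that unit_nonzero[OF c] by (simp add: norm_smult)
    moreover have "cmod (om ?p ?u) \<le> norm ?u"
      using herm_bound[of ?p "jmul ?u"] norm_unit[OF c] by (simp add: om_herm)
    moreover have "Re (om ?p ?u * cnj (om ?p ?u)) = (cmod (om ?p ?u))\<^sup>2"
      by (simp only: complex_norm_square[symmetric] Re_complex_of_real)
    ultimately show ?thesis
      unfolding g_NK_unit[OF c] dot_square_norm
      by (smt (verit) norm_ge_zero power_mono zero_less_power)
  qed
qed

text \<open>The metric has the Kaehler potential log \<open>N\<close>, whose (1,0)-differential is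
  \<open>h\<close>. For this potential the Christoffel symbols are complex bilinear and have the
  projective form on the left; the Koszul expression confirms it.\<close>

lemma koszul_FS: "g_FS d x (- (h x u *s v + h x v *s u)) z =
    (frechet_derivative (\<lambda>y. g_FS d y v z) (at x) u + frechet_derivative (\<lambda>y. g_FS d y u z) (at x) v
     - frechet_derivative (\<lambda>y. g_FS d y u v) (at x) z) / 2"
proof -
  have "frechet_derivative (\<lambda>y. g_FS d y b c) (at x) = (\<lambda>a. Re (- 2 * Re (h x a) * (herm (lin b) (lin c) / N x)
     - hderiv x b a * cnj (h x c) - h x b * cnj (hderiv x c a)))" for b c
    by (rule frechet_derivativeI[OF g_FS_has_derivative])
  note fd = this
  have lw: "lin (- (h x u *s v + h x v *s u)) = - (h x u *s lin v + h x v *s lin u)"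
    unfolding linear_neg[OF linear_lin] lin_add lin_smult ..
  have hw: "h x (- (h x u *s v + h x v *s u)) = - 2 * h x u * h x v"
    unfolding h_minus h_add h_smult by simp
  define E where "E u v = herm (lin u) (lin v) / N x" for u v
  have Ec: "E v u = cnj (E u v)" for u v by (simp add: E_def cnj_herm)
  have "g_FS d x (- (h x u *s v + h x v *s u)) z =
    Re (- (h x u * E v z + h x v * E u z) + 2 * h x u * h x v * cnj (h x z))"
  proof -
    have "herm (- (h x u *s lin v + h x v *s lin u)) (lin z) / N x = - (h x u * E v z + h x v * E u z)"
      unfolding herm_minus herm_add herm_scale E_def by (simp add: add_divide_distrib diff_divide_distrib)
    then show ?thesis unfolding g_FS_h lw hw by simp
  qed
  then show ?thesis
    unfolding fd hderiv_def E_def[symmetric] Ec[of v u] Ec[of z v] Ec[of z u]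
    by (simp add: field_simps)
qed

lemma christoffel_FS: "christoffel (g_FS d) x u v = - (h x u *s v + h x v *s u)"
proof -
  interpret FS: inner_form "g_FS d x" by (rule inner_form_FS)
  show ?thesis unfolding christoffel_def Let_def
  proof (rule the_equality, intro allI koszul_FS)
    fix w
    assume w: "\<forall>z. g_FS d x w z = (frechet_derivative (\<lambda>y. g_FS d y v z) (at x) u
      + frechet_derivative (\<lambda>y. g_FS d y u z) (at x) v - frechet_derivative (\<lambda>y. g_FS d y u v) (at x) z) / 2"
    define w0 where "w0 = - (h x u *s v + h x v *s u)"
    have "g_FS d x w z = g_FS d x w0 z" for z
      unfolding w0_def koszul_FS using w by blast
    then have "g_FS d x (w - w0) (w - w0) = 0" unfolding FS.diff(1)[of w w0] by simp
    then show "w = - (h x u *s v + h x v *s u)" by (simp add: FS.eq_zero w0_def)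
  qed
qed

text \<open>The connection is kept implicit: \<open>riesz\<close> supplies the vector, and the
  Koszul identity is enough because only pairings with it are compared later.\<close>

lemma christoffel_NK:
  "g_NK d x (christoffel (g_NK d) x u v) z =
    (frechet_derivative (\<lambda>y. g_NK d y v z) (at x) u + frechet_derivative (\<lambda>y. g_NK d y u z) (at x) v
     - frechet_derivative (\<lambda>y. g_NK d y u v) (at x) z) / 2"
proof -
  interpret NK: inner_form "g_NK d x" by (rule inner_form_NK)
  have hdl: "hderiv x (a + b) c = hderiv x a c + hderiv x b c" "hderiv x a (b + c) = hderiv x a b + hderiv x a c"
     "hderiv x (r *\<^sub>R a) c = r * hderiv x a c" "hderiv x a (r *\<^sub>R c) = r * hderiv x a c" for a b c r
    by (simp_all add: hderiv_def lin_add h_add lin_scaleR h_scaleR herm_add herm_scaleR add_divide_distrib algebra_simps)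
  have Bl: "B x a (b + c) = B x a b + B x a c" "B x a (r *\<^sub>R c) = r * B x a c" for a b c r
    by (simp_all add: B_def lin_add lin_scaleR om_add om_scaleR add_divide_distrib algebra_simps)
  have "linear (\<lambda>z. (frechet_derivative (\<lambda>y. g_NK d y v z) (at x) u + frechet_derivative (\<lambda>y. g_NK d y u z) (at x) v
     - frechet_derivative (\<lambda>y. g_NK d y u v) (at x) z) / 2)"
    unfolding frechet_derivativeI[OF g_NK_has_derivative]
    by (rule linearI) (simp_all add: hdl Bl lin_add h_add lin_scaleR h_scaleR herm_add herm_scaleR
        om_add om_scaleR add_divide_distrib diff_divide_distrib algebra_simps)
  from NK.riesz[OF this] show ?thesis
    unfolding christoffel_def Let_def by (rule theI'[THEN spec])
qed

text \<open>The difference of the two connections comes from the contact form \<open>\<eta> = om (Z x) \<circ> lin\<close>, whose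
  covariant derivative along lifts is the symplectic form, hence antisymmetric.\<close>

lemma christoffel_diff:
  "g_NK d x (christoffel (g_NK d) x u u - christoffel (g_FS d) x u u) n =
    - 2 * Re (cnj (om (Z x) (lift x u)) * om (lift x u) (lift x n)) / (N x)\<^sup>2"
proof -
  interpret NK: inner_form "g_NK d x" by (rule inner_form_NK)
  define dF where "dF a b c = frechet_derivative (\<lambda>y. g_FS d y b c) (at x) a" for a b c
  define dB where "dB a b c = frechet_derivative (\<lambda>y. B y b c) (at x) a" for a b c
  have dN: "frechet_derivative (\<lambda>y. g_NK d y b c) (at x) a = 2 * dF a b c - dB a b c" for a b c
    unfolding dF_def dB_def frechet_derivativeI[OF g_NK_has_derivative]
      frechet_derivativeI[OF g_FS_has_derivative] frechet_derivativeI[OF B_has_derivative] ..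
  have G: "g_FS d x (christoffel (g_FS d) x u u) n = dF u u n - dF n u u / 2"
    unfolding christoffel_FS koszul_FS dF_def by simp
  have "g_NK d x (christoffel (g_NK d) x u u) n = 2 * dF u u n - dB u u n - (2 * dF n u u - dB n u u) / 2"
    unfolding christoffel_NK dN by (simp add: field_simps)
  moreover have "g_NK d x (christoffel (g_FS d) x u u) n
      = 2 * (dF u u n - dF n u u / 2) - B x (christoffel (g_FS d) x u u) n"
    unfolding g_NK_B G ..
  \<comment> \<open>Since \<open>g_NK\<close> is twice \<open>g_FS\<close> minus \<open>B\<close>,
    all derivatives of \<open>g_FS\<close> cancel and only \<open>B\<close> survives.\<close>
  ultimately have 1: "g_NK d x (christoffel (g_NK d) x u u - christoffel (g_FS d) x u u) n
      = B x (christoffel (g_FS d) x u u) n + dB n u u / 2 - dB u u n"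
    unfolding NK.diff by (simp add: field_simps)
  have dBe: "dB a b c = Re (om (lin a) (lin b) * cnj (om (Z x) (lin c)) + om (Z x) (lin b) * cnj (om (lin a) (lin c)))
      / (N x)\<^sup>2 - 4 * Re (h x a) * B x b c" for a b c
    unfolding dB_def frechet_derivativeI[OF B_has_derivative] ..
  define a b w where "a = om (Z x) (lin u)" and "b = om (Z x) (lin n)" and "w = om (lin u) (lin n)"
  have wn: "om (lin n) (lin u) = - w" by (simp add: w_def om_swap[of "lin n"])
  have e1: "B x (christoffel (g_FS d) x u u) n = - 2 * Re (h x u * (a * cnj b)) / (N x)\<^sup>2"
    unfolding B_def christoffel_FS linear_neg[OF linear_lin] lin_add lin_smult om_minus om_add om_scale
      a_def[symmetric] b_def[symmetric] by (simp add: algebra_simps)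
  have e2: "dB n u u = (- 2 * Re (w * cnj a) - 4 * Re (h x n) * Re (a * cnj a)) / (N x)\<^sup>2"
    unfolding dBe B_def a_def[symmetric] wn
    by (simp add: diff_divide_distrib add_divide_distrib algebra_simps)
  have e3: "dB u u n = (Re (a * cnj w) - 4 * Re (h x u) * Re (a * cnj b)) / (N x)\<^sup>2"
    unfolding dBe B_def a_def[symmetric] b_def[symmetric] w_def[symmetric]
    by (simp add: diff_divide_distrib add_divide_distrib algebra_simps)
  have e4: "om (lift x u) (lift x n) = w + h x n * a - h x u * b"
    by (simp add: lift_def om_diff om_scale a_def b_def w_def om_swap[of "lin u" "Z x"])
  have "- 2 * Re (h x u * (a * cnj b)) + (- 2 * Re (w * cnj a) - 4 * Re (h x n) * Re (a * cnj a)) / 2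
      - (Re (a * cnj w) - 4 * Re (h x u) * Re (a * cnj b)) = - 2 * Re (cnj a * (w + h x n * a - h x u * b))"
    by (simp add: field_simps)
  moreover have "s / M + (t / M) / 2 - r / M = (s + t / 2 - r) / M" for s t r M :: real
    by (simp add: add_divide_distrib diff_divide_distrib)
  ultimately show ?thesis
    unfolding 1 om_Z_lift a_def[symmetric] e1 e2 e3 e4 by presburger
qed

end

section \<open>Totally geodesic surfaces in a chart\<close>

lemma real2_expand: "(u::real^2) = u $ 1 *\<^sub>R axis 1 1 + u $ 2 *\<^sub>R axis 2 1"
  by (simp add: vec_eq_iff forall_2 axis_def)

text \<open>Strict Cauchy-Schwarz, from positivity at the Gram-Schmidt vector of \<open>Y\<close>
  against \<open>X\<close>.\<close>

lemma (in inner_form) gram_pos: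
  assumes "\<And>a b. a *\<^sub>R X + b *\<^sub>R Y = 0 \<Longrightarrow> a = 0 \<and> b = 0"
  shows "G X X * G Y Y - G X Y * G X Y > 0"
proof -
  have X: "G X X > 0" using assms[of 1 0] pos[of X] by auto
  have "(- (G X Y / G X X)) *\<^sub>R X + 1 *\<^sub>R Y \<noteq> 0" using assms by (metis zero_neq_one)
  then have "G ((- (G X Y / G X X)) *\<^sub>R X + 1 *\<^sub>R Y) ((- (G X Y / G X X)) *\<^sub>R X + 1 *\<^sub>R Y) > 0" by (rule pos)
  also have "G ((- (G X Y / G X X)) *\<^sub>R X + 1 *\<^sub>R Y) ((- (G X Y / G X X)) *\<^sub>R X + 1 *\<^sub>R Y)
      = G Y Y - G X Y * G X Y / G X X"
    unfolding add scale using X sym[of Y X] by (simp add: field_simps)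
  finally have "G Y Y - G X Y * G X Y / G X X > 0" .
  then have "G X X * (G Y Y - G X Y * G X Y / G X X) > 0" using X by simp
  then show ?thesis using X by (simp add: algebra_simps)
qed

text \<open>The coefficients are given by Cramer's rule for the Gram matrix, hence depend differentiably
  on the point.\<close>

lemma differentiable_coefficients:
  fixes V X Y :: "'a::euclidean_space \<Rightarrow> 'b::euclidean_space"
  assumes d: "\<And>q. q \<in> U \<Longrightarrow> V differentiable (at q)" "\<And>q. q \<in> U \<Longrightarrow> X differentiable (at q)"
      "\<And>q. q \<in> U \<Longrightarrow> Y differentiable (at q)"
    and V: "\<And>q. q \<in> U \<Longrightarrow> \<exists>a b. V q = a *\<^sub>R X q + b *\<^sub>R Y q"
    and ind: "\<And>q a b. q \<in> U \<Longrightarrow> a *\<^sub>R X q + b *\<^sub>R Y q = 0 \<Longrightarrow> a = 0 \<and> b = 0"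
  obtains \<alpha> \<beta> :: "'a \<Rightarrow> real" where
    "\<And>q. q \<in> U \<Longrightarrow> \<alpha> differentiable (at q)" "\<And>q. q \<in> U \<Longrightarrow> \<beta> differentiable (at q)"
    "\<And>q. q \<in> U \<Longrightarrow> V q = \<alpha> q *\<^sub>R X q + \<beta> q *\<^sub>R Y q"
proof -
  have I: "inner_form ((\<bullet>) :: 'b \<Rightarrow> 'b \<Rightarrow> real)"
    by (rule inner_form.intro) (auto simp: inner_commute intro!: linearI simp: inner_add_left inner_add_right)
  define \<Delta> where "\<Delta> q = (X q \<bullet> X q) * (Y q \<bullet> Y q) - (X q \<bullet> Y q) * (X q \<bullet> Y q)" for q
  have \<Delta>: "\<Delta> q \<noteq> 0" if "q \<in> U" for q
    using inner_form.gram_pos[OF I, of "X q" "Y q"] ind[OF that] unfolding \<Delta>_def by fastforce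
  define \<alpha> where "\<alpha> q = ((Y q \<bullet> Y q) * (V q \<bullet> X q) - (X q \<bullet> Y q) * (V q \<bullet> Y q)) / \<Delta> q" for q
  define \<beta> where "\<beta> q = ((X q \<bullet> X q) * (V q \<bullet> Y q) - (X q \<bullet> Y q) * (V q \<bullet> X q)) / \<Delta> q" for q
  show ?thesis
  proof (rule that[of \<alpha> \<beta>])
    fix q assume q: "q \<in> U"
    have D: "\<Delta> differentiable (at q)" unfolding \<Delta>_def
      by (intro differentiable_diff differentiable_mult differentiable_inner d q)
    show "\<alpha> differentiable (at q)" "\<beta> differentiable (at q)" unfolding \<alpha>_def \<beta>_def
      by (intro differentiable_divide differentiable_diff differentiable_mult differentiable_inner d q D \<Delta>)+
    obtain a b where ab: "V q = a *\<^sub>R X q + b *\<^sub>R Y q" using V[OF q] by blast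
    have "\<alpha> q = a * \<Delta> q / \<Delta> q" "\<beta> q = b * \<Delta> q / \<Delta> q"
      unfolding \<alpha>_def \<beta>_def ab \<Delta>_def by (simp_all add: inner_add_left inner_commute[of "Y q" "X q"] algebra_simps)
    then show "V q = \<alpha> q *\<^sub>R X q + \<beta> q *\<^sub>R Y q" using \<Delta>[OF q] ab by simp
  qed
qed

section \<open>Curvature of the Fubini-Study connection\<close>

context aff
begin

text \<open>The full Hermitian Fubini-Study form: its real part is the metric, and its imaginary
  part is, up to sign, the Kaehler form, which tells real from complex tangent planes.\<close>

definition gH :: "complex^3 \<Rightarrow> complex^3 \<Rightarrow> complex^3 \<Rightarrow> complex" where
  "gH x u v = herm (lin u) (lin v) / N x - h x u * cnj (h x v)"

lemma gH_lift: "gH x u v = herm (lift x u) (lift x v) / N x"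
  by (simp add: gH_def herm_lift)

lemma Re_gH: "Re (gH x u v) = g_FS d x u v"
  by (simp add: gH_def g_FS_h)

lemma gH_cnj: "cnj (gH x u v) = gH x v u"
  by (simp add: gH_lift cnj_herm)

lemma gH_add: "gH x (u + u') v = gH x u v + gH x u' v" "gH x u (v + v') = gH x u v + gH x u v'"
  by (simp_all add: gH_lift lift_add herm_add add_divide_distrib)

lemma gH_smult: "gH x (c *s u) v = c * gH x u v" "gH x u (c *s v) = cnj c * gH x u v"
  by (simp_all add: gH_lift lift_smult herm_scale)

lemma gH_scaleR: "gH x (r *\<^sub>R u) v = r * gH x u v" "gH x u (r *\<^sub>R v) = r * gH x u v"
  by (simp_all add: gH_lift lift_scaleR herm_scaleR)

lemma h_comp_has_derivative:
  assumes F: "(F has_derivative F') (at q within S)" and V: "(V has_derivative V') (at q within S)"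
  shows "((\<lambda>q. h (F q) (V q)) has_derivative (\<lambda>a. hderiv (F q) (V q) (F' a) + h (F q) (V' a))) (at q within S)"
proof -
  have lV: "((\<lambda>q. lin (V q)) has_derivative (\<lambda>a. lin (V' a))) (at q within S)"
    by (rule bounded_linear.has_derivative[OF bounded_linear_lin V])
  have ZF: "((\<lambda>q. Z (F q)) has_derivative (\<lambda>a. lin (F' a))) (at q within S)"
    by (rule has_derivative_compose[OF F Z_has_derivative])
  have iN: "((\<lambda>q. complex_of_real (1 / N (F q))) has_derivative
     (\<lambda>a. - 2 * Re (h (F q) (F' a)) * complex_of_real (1 / N (F q)))) (at q within S)"
    by (rule has_derivative_compose[OF F invN_has_derivative])
  have "((\<lambda>q. herm (lin (V q)) (Z (F q)) * complex_of_real (1 / N (F q))) has_derivative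
      (\<lambda>a. hderiv (F q) (V q) (F' a) + h (F q) (V' a))) (at q within S)"
    by (rule has_derivative_eq_rhs, rule has_derivative_mult[OF bounded_bilinear.FDERIV[OF bounded_bilinear_herm lV ZF] iN])
       (simp add: fun_eq_iff hderiv_def herm_lin_Z add_divide_distrib)
  then show ?thesis by (simp add: h_def[abs_def] N_def)
qed

text \<open>The covariant derivative along \<open>F\<close> of a field with value \<open>V\<close> and derivative \<open>V'\<close>, in the
  direction whose image is \<open>t\<close>.\<close>

definition cov :: "complex^3 \<Rightarrow> complex^3 \<Rightarrow> complex^3 \<Rightarrow> complex^3 \<Rightarrow> complex^3" where
  "cov x t V V' = V' - h x t *s V - h x V *s t"

lemma cov_has_derivative:
  assumes F: "(F has_derivative F') (at q)" and V: "(V has_derivative V') (at q)"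
    and T: "(T has_derivative T') (at q)" and W: "(W has_derivative W') (at q)"
  shows "((\<lambda>q. cov (F q) (T q) (V q) (W q)) has_derivative
     (\<lambda>a. W' a - (h (F q) (T q) *s V' a + (hderiv (F q) (T q) (F' a) + h (F q) (T' a)) *s V q)
        - (h (F q) (V q) *s T' a + (hderiv (F q) (V q) (F' a) + h (F q) (V' a)) *s T q))) (at q)"
  unfolding cov_def
  by (intro has_derivative_diff bounded_bilinear.FDERIV[OF bounded_bilinear_smult]
      h_comp_has_derivative assms)

text \<open>\<open>V12\<close> and \<open>T12\<close> stand for mixed second derivatives; then \<open>c1\<close> and \<open>c2\<close> are the iterated covariant
  derivatives of \<open>V\<close>, and their difference is the curvature of the Fubini-Study connection.\<close>

lemma curvature:
  fixes x T1 T2 V V1 V2 V12 T12 :: "complex^3"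
  defines "c1 \<equiv> cov x T1 (cov x T2 V V2) (V12 - (h x T2 *s V1 + (hderiv x T2 T1 + h x T12) *s V)
      - (h x V *s T12 + (hderiv x V T1 + h x V1) *s T2))"
    and "c2 \<equiv> cov x T2 (cov x T1 V V1) (V12 - (h x T1 *s V2 + (hderiv x T1 T2 + h x T12) *s V)
      - (h x V *s T12 + (hderiv x V T2 + h x V2) *s T1))"
  shows "c1 - c2 = gH x V T2 *s T1 - gH x V T1 *s T2 + (2 * \<i> * Im (gH x T1 T2)) *s V"
proof -
  have im: "2 * \<i> * complex_of_real (Im (gH x T1 T2)) = gH x T1 T2 - gH x T2 T1"
    using gH_cnj[of x T1 T2] by (simp add: complex_eq_iff flip: gH_cnj[of x T1 T2])
  have "(c1 - c2) $ m = (gH x V T2 *s T1 - gH x V T1 *s T2 + (gH x T1 T2 - gH x T2 T1) *s V) $ m" for m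
    unfolding c1_def c2_def cov_def h_diff h_smult hderiv_cnj gH_def
    by (simp add: algebra_simps)
  then show ?thesis unfolding im vec_eq_iff by blast
qed

end

text \<open>Total geodesy enters as tangency of the covariant derivative. Convexity of
  \<open>U\<close> provides the straight segments for the transport and the connectedness for the
  dichotomy of types.\<close>

locale patch = aff +
  fixes U :: "(real^2) set" and F :: "real^2 \<Rightarrow> complex^3"
  assumes U: "open U" "convex U"
    and F: "smooth_on U F"
    and inj: "q \<in> U \<Longrightarrow> inj (frechet_derivative F (at q))"
    and geo: "q \<in> U \<Longrightarrow> cov_deriv_along (g_FS d) F q u v \<in> range (frechet_derivative F (at q))"
begin

lemma gH_self: "Im (gH x u u) = 0"
  using arg_cong[OF gH_cnj[of x u u], of Im] by simp

definition T :: "real^2 \<Rightarrow> real^2 \<Rightarrow> complex^3" where "T q = frechet_derivative F (at q)"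
definition T' :: "real^2 \<Rightarrow> real^2 \<Rightarrow> real^2 \<Rightarrow> complex^3" where
  "T' q v u = frechet_derivative (\<lambda>q. T q v) (at q) u"

abbreviation e1 :: "real^2" where "e1 \<equiv> axis 1 1"
abbreviation e2 :: "real^2" where "e2 \<equiv> axis 2 1"

lemma F_deriv: "q \<in> U \<Longrightarrow> (F has_derivative T q) (at q)"
  unfolding T_def by (rule smooth_onD(1)[OF F])

lemma T_smooth: "smooth_on U (\<lambda>q. T q v)"
  unfolding T_def by (rule smooth_onD(2)[OF F])

lemma T_deriv: "q \<in> U \<Longrightarrow> ((\<lambda>q. T q v) has_derivative T' q v) (at q)"
proof -
  have "T' q v = frechet_derivative (\<lambda>q. T q v) (at q)" by (simp add: T'_def fun_eq_iff)
  then show "q \<in> U \<Longrightarrow> ?thesis" using smooth_onD(1)[OF T_smooth] by simp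
qed

lemma T'_smooth: "smooth_on U (\<lambda>q. T' q v u)"
  unfolding T'_def by (rule smooth_onD(2)[OF T_smooth])

lemma T_linear: "q \<in> U \<Longrightarrow> linear (T q)"
  using F_deriv has_derivative_linear by blast

lemma T_expand: "q \<in> U \<Longrightarrow> T q u = u $ 1 *\<^sub>R T q e1 + u $ 2 *\<^sub>R T q e2"
  by (subst real2_expand[of u]) (simp add: linear_add[OF T_linear] linear_scale[OF T_linear])

lemma T_range: "q \<in> U \<Longrightarrow> range (T q) = {a *\<^sub>R T q e1 + b *\<^sub>R T q e2 | a b. True}"
proof (intro equalityI subsetI)
  fix v assume "q \<in> U" "v \<in> range (T q)"
  then show "v \<in> {a *\<^sub>R T q e1 + b *\<^sub>R T q e2 | a b. True}" using T_expand by blast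
next
  fix v assume q: "q \<in> U" and "v \<in> {a *\<^sub>R T q e1 + b *\<^sub>R T q e2 | a b. True}"
  then obtain a b where "v = a *\<^sub>R T q e1 + b *\<^sub>R T q e2" by blast
  then have "v = T q (a *\<^sub>R e1 + b *\<^sub>R e2)"
    using q by (simp add: linear_add[OF T_linear] linear_scale[OF T_linear])
  then show "v \<in> range (T q)" by blast
qed

lemma T_independent:
  assumes "q \<in> U" "a *\<^sub>R T q e1 + b *\<^sub>R T q e2 = 0" shows "a = 0 \<and> b = 0"
proof -
  have "T q (a *\<^sub>R e1 + b *\<^sub>R e2) = T q 0"
    using assms by (simp add: linear_add[OF T_linear] linear_scale[OF T_linear] linear_0[OF T_linear])
  then have "a *\<^sub>R e1 + b *\<^sub>R e2 = (0 :: real^2)" using inj[OF assms(1)] by (simp add: T_def inj_eq)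
  then show ?thesis by (simp add: vec_eq_iff forall_2 axis_def)
qed

lemma cov_deriv: "cov_deriv_along (g_FS d) F q u v = cov (F q) (T q u) (T q v) (T' q v u)"
  unfolding cov_deriv_along_def christoffel_FS T_def[symmetric] T'_def[symmetric] cov_def by simp

lemma cov_T:
  "q \<in> U \<Longrightarrow> \<exists>a b. cov (F q) (T q u) (T q v) (T' q v u) = a *\<^sub>R T q e1 + b *\<^sub>R T q e2"
  using geo[of q u v] T_range[of q] by (simp add: cov_deriv T_def[symmetric])

lemma T_differentiable: "q \<in> U \<Longrightarrow> (\<lambda>q. T q v) differentiable (at q)"
  using T_deriv differentiable_def by blast

lemma T'_deriv: "q \<in> U \<Longrightarrow> ((\<lambda>q. T' q v u) has_derivative frechet_derivative (\<lambda>q. T' q v u) (at q)) (at q)"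
  using smooth_onD(1)[OF T'_smooth] .

lemma T'_sym: "q \<in> U \<Longrightarrow> T' q u v = T' q v u"
  using second_derivative_symmetric[OF U(1) _ F] by (simp add: T'_def T_def)

text \<open>Differentiability of the coefficients allows the tangency relation to be differentiated
  again for the curvature, and it bounds the coefficients of the linear system in
  \<open>transport\<close>.\<close>

lemma cov_coefficients:
  obtains \<alpha> \<beta> :: "real^2 \<Rightarrow> real" where
    "\<And>q. q \<in> U \<Longrightarrow> \<alpha> differentiable (at q)" "\<And>q. q \<in> U \<Longrightarrow> \<beta> differentiable (at q)"
    "\<And>q. q \<in> U \<Longrightarrow> cov (F q) (T q u) (T q v) (T' q v u) = \<alpha> q *\<^sub>R T q e1 + \<beta> q *\<^sub>R T q e2"
proof (rule differentiable_coefficients[of U "\<lambda>q. cov (F q) (T q u) (T q v) (T' q v u)" "\<lambda>q. T q e1" "\<lambda>q. T q e2"])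
  show "(\<lambda>q. cov (F q) (T q u) (T q v) (T' q v u)) differentiable (at q)" if "q \<in> U" for q
    unfolding differentiable_def
    using cov_has_derivative[OF F_deriv T_deriv T_deriv T'_deriv] that by blast
qed (use T_differentiable cov_T T_independent that in auto)

lemma cov_scaleR_add:
  "cov x t (a *\<^sub>R V + b *\<^sub>R W) (a *\<^sub>R V' + a' *\<^sub>R V + (b *\<^sub>R W' + b' *\<^sub>R W)) =
    a *\<^sub>R cov x t V V' + b *\<^sub>R cov x t W W' + (a' *\<^sub>R V + b' *\<^sub>R W)"
  by (simp add: cov_def h_add h_scaleR vec_eq_iff scaleR_conv_of_real[where 'a=complex] algebra_simps)

text \<open>Differentiating \<open>\<nabla>\<^sub>v T\<^sub>w \<in> T\<close> once more.\<close>

lemma second_cov_T: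
  assumes q: "q \<in> U"
    and D: "((\<lambda>q. cov (F q) (T q v) (T q w) (T' q w v)) has_derivative D) (at q)"
  shows "\<exists>a b. cov (F q) (T q u) (cov (F q) (T q v) (T q w) (T' q w v)) (D u) = a *\<^sub>R T q e1 + b *\<^sub>R T q e2"
proof -
  obtain \<alpha> \<beta> where d: "\<And>q. q \<in> U \<Longrightarrow> \<alpha> differentiable (at q)" "\<And>q. q \<in> U \<Longrightarrow> \<beta> differentiable (at q)"
    and c: "\<And>q. q \<in> U \<Longrightarrow> cov (F q) (T q v) (T q w) (T' q w v) = \<alpha> q *\<^sub>R T q e1 + \<beta> q *\<^sub>R T q e2"
    using cov_coefficients[where u = v and v = w] by blast
  obtain \<alpha>' \<beta>' where a: "(\<alpha> has_derivative \<alpha>') (at q)" and b: "(\<beta> has_derivative \<beta>') (at q)"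
    using d q unfolding differentiable_def by blast
  have "((\<lambda>q. \<alpha> q *\<^sub>R T q e1 + \<beta> q *\<^sub>R T q e2) has_derivative
      (\<lambda>u. \<alpha> q *\<^sub>R T' q e1 u + \<alpha>' u *\<^sub>R T q e1 + (\<beta> q *\<^sub>R T' q e2 u + \<beta>' u *\<^sub>R T q e2))) (at q)"
    by (intro has_derivative_add has_derivative_scaleR a b T_deriv q)
  then have "((\<lambda>q. cov (F q) (T q v) (T q w) (T' q w v)) has_derivative
      (\<lambda>u. \<alpha> q *\<^sub>R T' q e1 u + \<alpha>' u *\<^sub>R T q e1 + (\<beta> q *\<^sub>R T' q e2 u + \<beta>' u *\<^sub>R T q e2))) (at q)"
    by (rule has_derivative_transform_within_open[OF _ U(1) q]) (simp add: c)
  then have "D = (\<lambda>u. \<alpha> q *\<^sub>R T' q e1 u + \<alpha>' u *\<^sub>R T q e1 + (\<beta> q *\<^sub>R T' q e2 u + \<beta>' u *\<^sub>R T q e2))"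
    by (rule has_derivative_unique[OF D])
  then have "cov (F q) (T q u) (cov (F q) (T q v) (T q w) (T' q w v)) (D u) =
     \<alpha> q *\<^sub>R cov (F q) (T q u) (T q e1) (T' q e1 u) + \<beta> q *\<^sub>R cov (F q) (T q u) (T q e2) (T' q e2 u)
      + (\<alpha>' u *\<^sub>R T q e1 + \<beta>' u *\<^sub>R T q e2)"
    unfolding c[OF q] by (simp only: cov_scaleR_add)
  moreover obtain a1 b1 where "cov (F q) (T q u) (T q e1) (T' q e1 u) = a1 *\<^sub>R T q e1 + b1 *\<^sub>R T q e2"
    using cov_T[OF q] by blast
  moreover obtain a2 b2 where "cov (F q) (T q u) (T q e2) (T' q e2 u) = a2 *\<^sub>R T q e1 + b2 *\<^sub>R T q e2"
    using cov_T[OF q] by blast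
  ultimately have "cov (F q) (T q u) (cov (F q) (T q v) (T q w) (T' q w v)) (D u) =
    (\<alpha> q * a1 + \<beta> q * a2 + \<alpha>' u) *\<^sub>R T q e1 + (\<alpha> q * b1 + \<beta> q * b2 + \<beta>' u) *\<^sub>R T q e2"
    by (simp add: algebra_simps)
  then show ?thesis by blast
qed

text \<open>Both iterated covariant derivatives of \<open>T q e1\<close> are tangent, hence so is
  their difference, the curvature applied to \<open>T q e1\<close>. In the curvature formula every
  term is a real multiple of a tangent vector except a multiple of
  \<open>\<i> *s T q e1\<close>.\<close>

lemma real_or_complex_tangent:
  assumes q: "q \<in> U"
  shows "Im (gH (F q) (T q e1) (T q e2)) = 0 \<or> \<i> *s T q e1 \<in> range (T q)"
proof -
  let ?x = "F q" and ?T1 = "T q e1" and ?T2 = "T q e2"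
  define V1 V2 T12 where "V1 = T' q e1 e1" and "V2 = T' q e1 e2" and "T12 = T' q e2 e1"
  have T12: "T' q e1 e2 = T12" by (simp add: T12_def T'_sym[OF q])
  define V12 where "V12 = frechet_derivative (\<lambda>q. T' q e1 e2) (at q) e1"
  have V21: "frechet_derivative (\<lambda>q. T' q e1 e1) (at q) e2 = V12"
    using second_derivative_symmetric[OF U(1) q T_smooth[of e1], of e1 e2] by (simp add: V12_def T'_def)
  note D1 = cov_has_derivative[OF F_deriv[OF q] T_deriv[OF q, of e1] T_deriv[OF q, of e2] T'_deriv[OF q, of e1 e2]]
  note D2 = cov_has_derivative[OF F_deriv[OF q] T_deriv[OF q, of e1] T_deriv[OF q, of e1] T'_deriv[OF q, of e1 e1]]
  obtain a b where ab: "cov ?x ?T1 (cov ?x ?T2 ?T1 V2) (V12 - (h ?x ?T2 *s V1 + (hderiv ?x ?T2 ?T1 + h ?x T12) *s ?T1)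
      - (h ?x ?T1 *s T12 + (hderiv ?x ?T1 ?T1 + h ?x V1) *s ?T2)) = a *\<^sub>R ?T1 + b *\<^sub>R ?T2"
    using second_cov_T[OF q D1, of e1] by (auto simp: V1_def V2_def T12_def V12_def)
  obtain a' b' where ab': "cov ?x ?T2 (cov ?x ?T1 ?T1 V1) (V12 - (h ?x ?T1 *s V2 + (hderiv ?x ?T1 ?T2 + h ?x T12) *s ?T1)
      - (h ?x ?T1 *s T12 + (hderiv ?x ?T1 ?T2 + h ?x V2) *s ?T1)) = a' *\<^sub>R ?T1 + b' *\<^sub>R ?T2"
    using second_cov_T[OF q D2, of e2] by (auto simp: V1_def V2_def T12 V21)
  have "a *\<^sub>R ?T1 + b *\<^sub>R ?T2 - (a' *\<^sub>R ?T1 + b' *\<^sub>R ?T2) =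
    gH ?x ?T1 ?T2 *s ?T1 - gH ?x ?T1 ?T1 *s ?T2 + (2 * \<i> * Im (gH ?x ?T1 ?T2)) *s ?T1"
    unfolding ab[symmetric] ab'[symmetric] by (rule curvature)
  moreover have "Im (gH ?x ?T1 ?T1) = 0" using arg_cong[OF gH_cnj[of ?x ?T1 ?T1], of Im] by simp
  \<comment> \<open>3 = 1 + 2: one from the imaginary part of the coefficient of \<open>?T1\<close>,
    two from the last curvature term with \<open>V = ?T1\<close>.\<close>
  ultimately have "(3 * Im (gH ?x ?T1 ?T2)) *\<^sub>R (\<i> *s ?T1) =
      (a - a' - Re (gH ?x ?T1 ?T2)) *\<^sub>R ?T1 + (b - b' + Re (gH ?x ?T1 ?T1)) *\<^sub>R ?T2"
    by (simp add: vec_eq_iff complex_eq_iff algebra_simps)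
  note * = this
  show ?thesis
  proof (cases "Im (gH ?x ?T1 ?T2) = 0")
    case False
    define r where "r = 3 * Im (gH ?x ?T1 ?T2)"
    have r: "r \<noteq> 0" using False by (simp add: r_def)
    have "\<i> *s ?T1 = (1 / r) *\<^sub>R (r *\<^sub>R (\<i> *s ?T1))" using r by simp
    also have "\<dots> = ((a - a' - Re (gH ?x ?T1 ?T2)) / r) *\<^sub>R ?T1 + ((b - b' + Re (gH ?x ?T1 ?T1)) / r) *\<^sub>R ?T2"
      unfolding *[folded r_def] by (simp add: scaleR_right_distrib)
    finally show ?thesis using T_range[OF q] by blast
  qed simp
qed

text \<open>The equality case of Wirtinger's inequality: on a complex tangent plane the Kaehler form
  is the area form up to sign, so the ratio \<open>\<kappa>\<close> of \<open>type_dichotomy\<close>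
  equals 1.\<close>

lemma complex_tangent_gram:
  assumes q: "q \<in> U" and i: "\<i> *s T q e1 \<in> range (T q)"
  shows "(Im (gH (F q) (T q e1) (T q e2)))\<^sup>2 =
    g_FS d (F q) (T q e1) (T q e1) * g_FS d (F q) (T q e2) (T q e2)
     - g_FS d (F q) (T q e1) (T q e2) * g_FS d (F q) (T q e1) (T q e2)"
proof -
  let ?g = "gH (F q)" and ?T1 = "T q e1" and ?T2 = "T q e2"
  obtain a b where ab: "\<i> *s ?T1 = a *\<^sub>R ?T1 + b *\<^sub>R ?T2" using i T_range[OF q] by auto
  define A r t B where "A = Re (?g ?T1 ?T1)" and "r = Re (?g ?T1 ?T2)" and "t = Im (?g ?T1 ?T2)" and "B = Re (?g ?T2 ?T2)"
  have g11: "?g ?T1 ?T1 = of_real A" and g22: "?g ?T2 ?T2 = of_real B"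
    by (simp_all add: complex_eq_iff A_def B_def gH_self)
  have g12: "?g ?T1 ?T2 = Complex r t" by (simp add: complex_eq_iff r_def t_def)
  have g21: "?g ?T2 ?T1 = Complex r (- t)" using gH_cnj[of "F q" ?T1 ?T2] g12 by (simp add: complex_eq_iff)
  have "\<i> * ?g ?T1 ?T1 = of_real a * ?g ?T1 ?T1 + of_real b * ?g ?T2 ?T1"
    using arg_cong[OF ab, of "\<lambda>v. ?g v ?T1"] by (simp add: gH_smult gH_add gH_scaleR)
  note eq = this[unfolded g11 g21]
  have 1: "a * A + b * r = 0" "A = - (b * t)"
    using arg_cong[OF eq, of Re] arg_cong[OF eq, of Im] by simp_all
  have "\<i> * ?g ?T1 ?T2 = of_real a * ?g ?T1 ?T2 + of_real b * ?g ?T2 ?T2"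
    using arg_cong[OF ab, of "\<lambda>v. ?g v ?T2"] by (simp add: gH_smult gH_add gH_scaleR)
  then have 2: "- t = a * r + b * B" unfolding g12 g22 by (simp add: complex_eq_iff)
  have T1: "?T1 \<noteq> 0" using T_independent[OF q, of 1 0] by auto
  have A: "A \<noteq> 0" unfolding A_def Re_gH using inner_form.pos[OF inner_form_FS T1] by (metis less_irrefl)
  have "- t * A = a * A * r + b * B * A" using 2 by (simp add: algebra_simps)
  also have "a * A = - (b * r)" using 1(1) by linarith
  finally have 3: "- t * A = b * (A * B - r * r)" by (simp add: algebra_simps)
  have "A * t\<^sup>2 = (- t) * (- t * A)" by (simp add: power2_eq_square)
  also have "\<dots> = - (b * t) * (A * B - r * r)" unfolding 3 by simp
  finally have "A * t\<^sup>2 = A * (A * B - r * r)" using 1(2) by simp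
  then have "t\<^sup>2 = A * B - r * r" using A by simp
  then show ?thesis unfolding t_def A_def B_def r_def Re_gH .
qed

lemma gH_T_continuous: "continuous_on U (\<lambda>q. gH (F q) (T q u) (T q v))"
proof -
  have "continuous_on U (\<lambda>q. h (F q) (T q w))" for w
    by (intro continuous_at_imp_continuous_on ballI has_derivative_continuous[OF h_comp_has_derivative[OF F_deriv T_deriv]])
  moreover have l: "continuous_on U (\<lambda>q. lin (T q w))" for w
    using bounded_linear.continuous_on[OF bounded_linear_lin smooth_onD(3)[OF T_smooth]] .
  moreover have "continuous_on U (\<lambda>q. N (F q))"
    unfolding N_def by (intro continuous_intros continuous_on_compose2[OF _ smooth_onD(3)[OF F]])
      (auto intro!: continuous_at_imp_continuous_on has_derivative_continuous[OF Z_has_derivative])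
  ultimately show ?thesis unfolding gH_def
    by (intro continuous_intros bounded_bilinear.continuous_on[OF bounded_bilinear_herm]) auto
qed

definition real_type :: bool where
  "real_type \<longleftrightarrow> (\<forall>q\<in>U. \<forall>u v. Im (gH (F q) (T q u) (T q v)) = 0)"

definition complex_type :: bool where
  "complex_type \<longleftrightarrow> (\<forall>q\<in>U. \<forall>u. \<i> *s T q u \<in> range (T q))"

lemma Im_gH_T: "q \<in> U \<Longrightarrow> Im (gH (F q) (T q u) (T q v)) = (u $ 1 * v $ 2 - u $ 2 * v $ 1) * Im (gH (F q) (T q e1) (T q e2))"
proof -
  assume q: "q \<in> U"
  have s: "Im (gH (F q) X X) = 0" "Im (gH (F q) X Y) = - Im (gH (F q) Y X)" for X Y
    using arg_cong[OF gH_cnj[of "F q" X X], of Im] arg_cong[OF gH_cnj[of "F q" X Y], of Im] by simp_all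
  show ?thesis
    by (subst T_expand[OF q, of u], subst T_expand[OF q, of v])
       (simp add: gH_add gH_scaleR s(1) s(2)[of "T q e2" "T q e1"] algebra_simps)
qed

text \<open>\<open>\<kappa>\<close> is the squared cosine of the Kaehler angle. It is 0 on real and
  1 on complex tangent planes, and a continuous function with finitely many values on a connected
  set is constant.\<close>

lemma type_dichotomy: "real_type \<or> complex_type"
proof -
  define \<kappa> where "\<kappa> q = (Im (gH (F q) (T q e1) (T q e2)))\<^sup>2 /
    (g_FS d (F q) (T q e1) (T q e1) * g_FS d (F q) (T q e2) (T q e2)
     - g_FS d (F q) (T q e1) (T q e2) * g_FS d (F q) (T q e1) (T q e2))" for q
  have den: "g_FS d (F q) (T q e1) (T q e1) * g_FS d (F q) (T q e2) (T q e2)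
     - g_FS d (F q) (T q e1) (T q e2) * g_FS d (F q) (T q e1) (T q e2) > 0" if "q \<in> U" for q
    using inner_form.gram_pos[OF inner_form_FS T_independent[OF that]] by blast
  have cont: "continuous_on U \<kappa>"
    unfolding \<kappa>_def Re_gH[symmetric]
    by (intro continuous_intros gH_T_continuous) (auto simp: Re_gH dest!: den)
  have val: "\<kappa> q = 0 \<or> \<kappa> q = 1" if "q \<in> U" for q
    using real_or_complex_tangent[OF that] complex_tangent_gram[OF that] den[OF that]
    by (auto simp: \<kappa>_def)
  have "\<kappa> constant_on U"
    by (rule continuous_finite_range_constant[OF convex_connected[OF U(2)] cont])
       (rule finite_subset[of _ "{0, 1}"], use val in auto)
  then obtain k where k: "\<And>q. q \<in> U \<Longrightarrow> \<kappa> q = k" by (auto simp: constant_on_def)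
  show ?thesis
  proof (cases "k = 0")
    case True
    then have "Im (gH (F q) (T q e1) (T q e2)) = 0" if "q \<in> U" for q
      using k[OF that] den[OF that] by (simp add: \<kappa>_def)
    then have "Im (gH (F q) (T q u) (T q v)) = 0" if "q \<in> U" for q u v
      using that Im_gH_T[OF that, of u v] by (metis mult_zero_right)
    then have real_type unfolding real_type_def by blast
    then show ?thesis ..
  next
    case False
    have complex_type unfolding complex_type_def
    proof (intro ballI allI)
      fix q u assume q: "q \<in> U"
      have "Im (gH (F q) (T q e1) (T q e2)) \<noteq> 0" using k[OF q] False by (auto simp: \<kappa>_def)
      then have "\<i> *s T q e1 \<in> range (T q)" using real_or_complex_tangent[OF q] by blast
      then obtain a b where ab: "\<i> *s T q e1 = a *\<^sub>R T q e1 + b *\<^sub>R T q e2" using T_range[OF q] by auto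
      have b: "b \<noteq> 0"
      proof
        assume "b = 0"
        then have "(\<i> - of_real a) *s T q e1 = 0"
          using ab by (simp add: vec_eq_iff scaleR_conv_of_real[where 'a=complex] algebra_simps)
        moreover have "\<i> - of_real a \<noteq> 0" by (simp add: complex_eq_iff)
        ultimately have "T q e1 = 0" by (simp add: vec_eq_iff)
        then show False using T_independent[OF q, of 1 0] by auto
      qed
      have "T q e2 = (1 / b) *\<^sub>R (\<i> *s T q e1 - a *\<^sub>R T q e1)" unfolding ab using b by simp
      moreover have "\<i> *s (r *\<^sub>R (\<i> *s V - a *\<^sub>R V)) = r *\<^sub>R (- V - a *\<^sub>R (\<i> *s V))" for r and V :: "complex^3"
        by (simp add: vec_eq_iff complex_eq_iff algebra_simps)
      ultimately have "\<i> *s T q e2 = (1 / b) *\<^sub>R (- T q e1 - a *\<^sub>R (\<i> *s T q e1))"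
        by (simp only:)
      then have 2: "\<i> *s T q e2 = (1 / b) *\<^sub>R (- T q e1 - a *\<^sub>R (a *\<^sub>R T q e1 + b *\<^sub>R T q e2))"
        unfolding ab .
      have s: "subspace (range (T q))" by (rule linear_subspace_image[OF T_linear[OF q] subspace_UNIV])
      have "\<i> *s T q e1 \<in> range (T q)" "\<i> *s T q e2 \<in> range (T q)"
        unfolding ab 2 by (intro subspace_add subspace_diff subspace_scale subspace_neg s rangeI)+
      moreover have "\<i> *s T q u = u $ 1 *\<^sub>R (\<i> *s T q e1) + u $ 2 *\<^sub>R (\<i> *s T q e2)"
        by (subst T_expand[OF q, of u]) (simp add: vec_eq_iff complex_eq_iff)
      ultimately show "\<i> *s T q u \<in> range (T q)" by (simp add: subspace_add subspace_scale s)
    qed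
    then show ?thesis ..
  qed
qed

end

section \<open>Parallel transport of the tangent frame\<close>

text \<open>This turns membership in \<open>W\<close> into the vanishing of linear functionals, the
  form in which derivatives and differential equations can be handled.\<close>

lemma subspace_memI:
  fixes W :: "'a::euclidean_space set"
  assumes "subspace W" "\<And>n. (\<And>w. w \<in> W \<Longrightarrow> w \<bullet> n = 0) \<Longrightarrow> v \<bullet> n = 0"
  shows "v \<in> W"
proof -
  obtain y z where yz: "y \<in> span W" "\<And>w. w \<in> span W \<Longrightarrow> orthogonal z w" "v = y + z"
    using orthogonal_subspace_decomp_exists[of W v] by blast
  have W: "span W = W" using assms(1) by (simp add: span_eq_iff)
  have z: "w \<bullet> z = 0" if "w \<in> W" for w
    using yz(2)[of w] that W by (simp add: orthogonal_def inner_commute)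
  then have "v \<bullet> z = 0" using assms(2) by blast
  moreover have "y \<bullet> z = 0" using z yz(1) W by simp
  ultimately have "z \<bullet> z = 0" using yz(3) by (simp add: inner_add_left)
  then show ?thesis using yz W by simp
qed

lemma derivative_in_subspace:
  fixes f :: "'a::euclidean_space \<Rightarrow> 'b::euclidean_space"
  assumes "subspace W" "open V" "x \<in> V" "\<And>y. y \<in> V \<Longrightarrow> f y \<in> W" "(f has_derivative f') (at x)"
  shows "f' u \<in> W"
proof (rule subspace_memI[OF assms(1)])
  fix n assume n: "\<And>w. w \<in> W \<Longrightarrow> w \<bullet> n = 0"
  have "((\<lambda>y. f y \<bullet> n) has_derivative (\<lambda>u. f' u \<bullet> n)) (at x)"
    by (rule has_derivative_inner_left[OF assms(5)])
  moreover have "((\<lambda>y. f y \<bullet> n) has_derivative (\<lambda>u. 0)) (at x)"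
    by (rule has_derivative_transform_within_open[OF has_derivative_const assms(2,3), of "0::real"])
       (simp add: n assms(4))
  ultimately show "f' u \<bullet> n = 0" using has_derivative_unique by metis
qed

text \<open>The common property of isotropic and complex subspaces that permits a choice of phase
  inside \<open>W\<close>.\<close>

definition herm_closed :: "(complex^4) set \<Rightarrow> bool" where
  "herm_closed W \<longleftrightarrow> (\<forall>v\<in>W. \<forall>w\<in>W. herm v w *s w \<in> W)"

text \<open>With \<open>w = l *s z\<close>, the vector \<open>herm p w *s w\<close> involves
  \<open>l\<close> only through its squared modulus, a real factor. So an arbitrary multiplier can
  be replaced by the explicit one that makes the product with \<open>p\<close> equal to 1 and varies
  smoothly with \<open>z\<close>.\<close>

lemma herm_closed_normalize:
  assumes W: "subspace W" "herm_closed W" and "l *s z \<in> W" "l \<noteq> 0" "p \<in> W" "herm z p \<noteq> 0"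
  shows "(1 / herm z p) *s z \<in> W"
proof -
  define w where "w = l *s z"
  have w: "herm p w *s w \<in> W" using W(2) assms(3,5) unfolding herm_closed_def w_def by blast
  have "(1 / herm z p) *s z = (1 / ((cmod l)\<^sup>2 * (cmod (herm z p))\<^sup>2)) *\<^sub>R (herm p w *s w)"
  proof -
    have "of_real ((cmod l)\<^sup>2 * (cmod (herm z p))\<^sup>2) = (l * cnj l) * (herm z p * cnj (herm z p))"
      by (simp only: of_real_mult complex_norm_square)
    moreover have "herm p w *s w = ((l * cnj l) * cnj (herm z p)) *s z"
      by (simp add: w_def herm_scale smult_assoc cnj_herm mult_ac)
    ultimately show ?thesis using assms(4,6)
      by (simp add: scaleR_smult smult_assoc)
  qed
  then show ?thesis using subspace_scale[OF W(1) w] by simp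
qed

context patch
begin

definition P :: "real^2 \<Rightarrow> real^2 \<Rightarrow> complex^4" where "P q u = lift (F q) (T q u)"

lemma P_expand: "q \<in> U \<Longrightarrow> P q u = u $ 1 *\<^sub>R P q e1 + u $ 2 *\<^sub>R P q e2"
  unfolding P_def by (subst T_expand) (simp_all add: lift_add lift_scaleR)

lemma ZF_has_derivative: "q \<in> U \<Longrightarrow> ((\<lambda>q. Z (F q)) has_derivative (\<lambda>a. lin (T q a))) (at q)"
  by (rule has_derivative_compose[OF F_deriv Z_has_derivative])

text \<open>A Gauss formula for lifts. The \<open>h\<close> term also occurs in the derivative of
  \<open>Z (F q)\<close> and is removed by a rescaling; the last term is the radial component,
  present because \<open>P q u\<close> stays orthogonal to \<open>Z (F q)\<close>.\<close>

lemma P_has_derivative: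
  assumes q: "q \<in> U"
  shows "((\<lambda>q. P q u) has_derivative (\<lambda>a. lift (F q) (cov (F q) (T q a) (T q u) (T' q u a))
     + h (F q) (T q a) *s P q u - gH (F q) (T q u) (T q a) *s Z (F q))) (at q)"
proof -
  have lT: "((\<lambda>q. lin (T q u)) has_derivative (\<lambda>a. lin (T' q u a))) (at q)"
    by (rule bounded_linear.has_derivative[OF bounded_linear_lin T_deriv[OF q]])
  have "((\<lambda>q. lin (T q u) - h (F q) (T q u) *s Z (F q)) has_derivative
     (\<lambda>a. lin (T' q u a) - (h (F q) (T q u) *s lin (T q a)
        + (hderiv (F q) (T q u) (T q a) + h (F q) (T' q u a)) *s Z (F q)))) (at q)"
    by (intro has_derivative_diff lT bounded_bilinear.FDERIV[OF bounded_bilinear_smult]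
        h_comp_has_derivative F_deriv T_deriv ZF_has_derivative q)
  moreover have "lin (T' q u a) - (h (F q) (T q u) *s lin (T q a)
        + (hderiv (F q) (T q u) (T q a) + h (F q) (T' q u a)) *s Z (F q)) =
     lift (F q) (cov (F q) (T q a) (T q u) (T' q u a))
     + h (F q) (T q a) *s P q u - gH (F q) (T q u) (T q a) *s Z (F q)" for a
  proof -
    show ?thesis
      unfolding P_def lift_def cov_def hderiv_cnj gH_def lin_diff lin_smult h_diff h_smult
      by (simp add: vec_eq_iff algebra_simps)
  qed
  ultimately show ?thesis by (simp add: P_def[abs_def] lift_def)
qed

text \<open>The values of \<open>L\<close> on the three rescaled frame vectors solve a linear system
  with zero initial data. The multiplier \<open>l1\<close> is fixed before \<open>L\<close>, so one
  multiplier serves all functionals. The compatibility of \<open>L\<close> with the values of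
  \<open>gH\<close> is satisfied by complex-linear functionals and, where these values are real, by
  real-linear ones.\<close>

lemma transport:
  assumes q0: "q0 \<in> U" and q1: "q1 \<in> U" and l0: "l0 \<noteq> 0"
  obtains l1 where "l1 \<noteq> 0"
    "\<And>L. \<lbrakk>bounded_linear L; \<And>q u v x. q \<in> U \<Longrightarrow> L (gH (F q) (T q u) (T q v) *s x) = gH (F q) (T q u) (T q v) * L x;
       L (l0 *s Z (F q0)) = (0::complex); \<And>u. L (l0 *s P q0 u) = 0\<rbrakk>
     \<Longrightarrow> L (l1 *s Z (F q1)) = 0 \<and> (\<forall>u. L (l1 *s P q1 u) = 0)"
proof -
  define w where "w = q1 - q0"
  define c where "c t = q0 + t *\<^sub>R w" for t :: real
  have c01: "c 0 = q0" "c 1 = q1" by (simp_all add: c_def w_def)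
  have cU: "c t \<in> U" if "t \<in> {0..1}" for t
  proof -
    have "c t = (1 - t) *\<^sub>R q0 + t *\<^sub>R q1" by (simp add: c_def w_def algebra_simps)
    then show ?thesis using convexD[OF U(2) q0 q1, of "1 - t" t] that by simp
  qed
  have cd: "(c has_derivative (\<lambda>s. s *\<^sub>R w)) (at t within S)" for t S
    unfolding c_def by (auto intro!: derivative_eq_intros)
  have cc: "continuous_on {0..1} c" unfolding c_def by (intro continuous_intros)
  have comp: "continuous_on {0..1} (\<lambda>t. g (c t))" if "continuous_on U g" for g :: "real^2 \<Rightarrow> 'z::topological_space"
    by (rule continuous_on_compose2[OF that cc]) (use cU in auto)
  have hc: "continuous_on U (\<lambda>q. h (F q) (T q v))" for v
    by (intro continuous_at_imp_continuous_on ballI has_derivative_continuous[OF h_comp_has_derivative[OF F_deriv T_deriv]])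
  obtain H where H: "\<And>t. t \<in> {0..1} \<Longrightarrow>
      (H has_vector_derivative h (F (c t)) (T (c t) w)) (at t within {0..1})"
    using antiderivative_continuous[OF comp[OF hc[of w]]] by blast
  \<comment> \<open>\<open>H\<close> integrates the connection form along the segment, so this
    factor cancels the \<open>h\<close> terms in the derivatives of the frame.\<close>
  define l where "l t = l0 * exp (H 0 - H t)" for t
  have l: "l 0 = l0" "\<And>t. l t \<noteq> 0" using l0 by (simp_all add: l_def)
  have ld: "(l has_derivative (\<lambda>s. s *\<^sub>R (- h (F (c t)) (T (c t) w) * l t))) (at t within {0..1})"
    if "t \<in> {0..1}" for t
  proof -
    have "(H has_derivative (\<lambda>s. s *\<^sub>R h (F (c t)) (T (c t) w))) (at t within {0..1})"
      using H[OF that] by (simp add: has_vector_derivative_def)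
    then have "((\<lambda>t. H 0 - H t) has_derivative (\<lambda>s. 0 - s *\<^sub>R h (F (c t)) (T (c t) w))) (at t within {0..1})"
      by (intro has_derivative_diff has_derivative_const)
    from has_derivative_compose[OF this DERIV_exp[unfolded has_field_derivative_def]]
    have "((\<lambda>t. l0 * exp (H 0 - H t)) has_derivative
        (\<lambda>s. l0 * (exp (H 0 - H t) * (0 - s *\<^sub>R h (F (c t)) (T (c t) w))))) (at t within {0..1})"
      by (rule has_derivative_mult_right)
    then show ?thesis unfolding l_def by (simp add: mult_ac)
  qed
  define Y0 where "Y0 t = l t *s Z (F (c t))" for t
  define Y where "Y u t = l t *s P (c t) u" for u t
  have lP: "linear (lift x)" for x by (rule lift_linear)
  have Y0: "(Y0 has_vector_derivative w $ 1 *\<^sub>R Y e1 t + w $ 2 *\<^sub>R Y e2 t) (at t within {0..1})"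
    if t: "t \<in> {0..1}" for t
  proof -
    have "((\<lambda>t. Z (F (c t))) has_derivative (\<lambda>s. lin (T (c t) (s *\<^sub>R w)))) (at t within {0..1})"
      by (rule has_derivative_compose[OF cd ZF_has_derivative[OF cU[OF t]]])
    from bounded_bilinear.FDERIV[OF bounded_bilinear_smult ld[OF t] this]
    have "(Y0 has_derivative (\<lambda>s. l t *s lin (T (c t) (s *\<^sub>R w)) +
        (s *\<^sub>R (- h (F (c t)) (T (c t) w) * l t)) *s Z (F (c t)))) (at t within {0..1})"
      unfolding Y0_def .
    moreover have "l t *s lin (T (c t) (s *\<^sub>R w)) +
        (s *\<^sub>R (- h (F (c t)) (T (c t) w) * l t)) *s Z (F (c t)) = s *\<^sub>R Y w t" for s
      unfolding Y_def P_def lift_def linear_scale[OF T_linear[OF cU[OF t]]] lin_scaleR scaleR_conv_of_real[where 'a=complex] scaleR_smult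
      by (simp add: vec_eq_iff algebra_simps)
    moreover have "Y w t = w $ 1 *\<^sub>R Y e1 t + w $ 2 *\<^sub>R Y e2 t"
      unfolding Y_def by (subst P_expand[OF cU[OF t], of w]) (simp add: vec_eq_iff scaleR_conv_of_real[where 'a=complex] algebra_simps)
    ultimately show ?thesis unfolding has_vector_derivative_def by simp
  qed
  have "\<exists>\<alpha> \<beta> :: real^2 \<Rightarrow> real. (\<forall>q\<in>U. \<alpha> differentiable (at q) \<and> \<beta> differentiable (at q) \<and>
     cov (F q) (T q w) (T q u) (T' q u w) = \<alpha> q *\<^sub>R T q e1 + \<beta> q *\<^sub>R T q e2)" for u
    using cov_coefficients[where u = w and v = u] by metis
  then obtain \<alpha> \<beta> :: "real^2 \<Rightarrow> real^2 \<Rightarrow> real" where ab: "\<And>u q. q \<in> U \<Longrightarrow> \<alpha> u differentiable (at q)"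
    "\<And>u q. q \<in> U \<Longrightarrow> \<beta> u differentiable (at q)"
    "\<And>u q. q \<in> U \<Longrightarrow> cov (F q) (T q w) (T q u) (T' q u w) = \<alpha> u q *\<^sub>R T q e1 + \<beta> u q *\<^sub>R T q e2"
    by metis
  define g where "g u t = gH (F (c t)) (T (c t) u) (T (c t) w)" for u t
  have Yu: "(Y u has_vector_derivative \<alpha> u (c t) *\<^sub>R Y e1 t + \<beta> u (c t) *\<^sub>R Y e2 t - g u t *s Y0 t) (at t within {0..1})"
    if t: "t \<in> {0..1}" for t u
  proof -
    let ?q = "c t"
    define D where "D a = lift (F ?q) (cov (F ?q) (T ?q a) (T ?q u) (T' ?q u a))
     + h (F ?q) (T ?q a) *s P ?q u - gH (F ?q) (T ?q u) (T ?q a) *s Z (F ?q)" for a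
    have PD: "((\<lambda>q. P q u) has_derivative D) (at ?q)"
      unfolding D_def by (rule P_has_derivative[OF cU[OF t]])
    have D: "((\<lambda>t. P (c t) u) has_derivative (\<lambda>s. D (s *\<^sub>R w))) (at t within {0..1})"
      by (rule has_derivative_compose[OF cd PD])
    have lin: "D (s *\<^sub>R w) = s *\<^sub>R D w" for s
      using has_derivative_linear[OF PD] by (rule linear_scale)
    from bounded_bilinear.FDERIV[OF bounded_bilinear_smult ld[OF t] D]
    have "(Y u has_derivative (\<lambda>s. l t *s D (s *\<^sub>R w) +
        (s *\<^sub>R (- h (F ?q) (T ?q w) * l t)) *s P ?q u)) (at t within {0..1})"
      unfolding Y_def .
    moreover have "l t *s D (s *\<^sub>R w) + (s *\<^sub>R (- h (F ?q) (T ?q w) * l t)) *s P ?q u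
       = s *\<^sub>R (l t *s (\<alpha> u ?q *\<^sub>R P ?q e1 + \<beta> u ?q *\<^sub>R P ?q e2) - g u t *s Y0 t)" for s
      unfolding lin unfolding D_def ab(3)[OF cU[OF t]] g_def Y0_def P_def lift_add lift_scaleR
      by (simp add: vec_eq_iff scaleR_conv_of_real[where 'a=complex] algebra_simps)
    moreover have "l t *s (\<alpha> u ?q *\<^sub>R P ?q e1 + \<beta> u ?q *\<^sub>R P ?q e2) = \<alpha> u ?q *\<^sub>R Y e1 t + \<beta> u ?q *\<^sub>R Y e2 t"
      by (simp add: Y_def vec_eq_iff scaleR_conv_of_real[where 'a=complex] algebra_simps)
    ultimately show ?thesis unfolding has_vector_derivative_def by simp
  qed
  \<comment> \<open>The sum of the moduli of all coefficients of the system; its maximum on the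
    compact segment is the constant of the differential inequality.\<close>
  define \<kappa> where "\<kappa> t = \<bar>w $ 1\<bar> + \<bar>w $ 2\<bar> + (\<bar>\<alpha> e1 (c t)\<bar> + \<bar>\<beta> e1 (c t)\<bar> + cmod (g e1 t))
     + (\<bar>\<alpha> e2 (c t)\<bar> + \<bar>\<beta> e2 (c t)\<bar> + cmod (g e2 t))" for t
  have "continuous_on U (\<alpha> u)" "continuous_on U (\<beta> u)" for u
    using ab by (auto intro!: continuous_at_imp_continuous_on differentiable_imp_continuous_within)
  then have "continuous_on {0..1} \<kappa>"
    unfolding \<kappa>_def g_def by (intro continuous_intros comp gH_T_continuous)
  then have "compact (\<kappa> ` {0..1})" by (intro compact_continuous_image) auto
  then obtain C where C: "\<And>t. t \<in> {0..1} \<Longrightarrow> \<kappa> t \<le> C"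
    using compact_imp_bounded bounded_real by (metis abs_le_D1 imageI)
  show ?thesis
  proof (rule that[of "l 1"], rule l(2))
    fix L assume L: "bounded_linear L"
      and Lg: "\<And>q u v x. q \<in> U \<Longrightarrow> L (gH (F q) (T q u) (T q v) *s x) = gH (F q) (T q u) (T q v) * L x"
      and L0: "L (l0 *s Z (F q0)) = (0::complex)" and LP: "\<And>u. L (l0 *s P q0 u) = 0"
    have La: "L (a + b) = L a + L b" "L (a - b) = L a - L b" "L (r *\<^sub>R a) = of_real r * L a" for a b r
      using linear_add[OF bounded_linear.linear[OF L]] linear_diff[OF bounded_linear.linear[OF L]]
        linear_scale[OF bounded_linear.linear[OF L]] by (simp_all add: scaleR_conv_of_real)
    define y where "y t = (L (Y0 t), L (Y e1 t), L (Y e2 t))" for t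
    define y' where "y' t = (L (w $ 1 *\<^sub>R Y e1 t + w $ 2 *\<^sub>R Y e2 t),
      L (\<alpha> e1 (c t) *\<^sub>R Y e1 t + \<beta> e1 (c t) *\<^sub>R Y e2 t - g e1 t *s Y0 t),
      L (\<alpha> e2 (c t) *\<^sub>R Y e1 t + \<beta> e2 (c t) *\<^sub>R Y e2 t - g e2 t *s Y0 t))" for t
    have "y 1 = 0"
    proof (rule linear_ode_zero[where C = C])
      fix t :: real assume t: "t \<in> {0..1}"
      show "(y has_vector_derivative y' t) (at t within {0..1})"
        unfolding y_def y'_def
        by (intro has_vector_derivative_Pair bounded_linear.has_vector_derivative[OF L] Y0 Yu t)
      have ny: "cmod (L (Y0 t)) \<le> norm (y t)" "cmod (L (Y e1 t)) \<le> norm (y t)" "cmod (L (Y e2 t)) \<le> norm (y t)"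
        using norm_fst_le[of "L (Y0 t)" "(L (Y e1 t), L (Y e2 t))"] norm_snd_le[of "(L (Y e1 t), L (Y e2 t))" "L (Y0 t)"]
          norm_fst_le[of "L (Y e1 t)" "L (Y e2 t)"] norm_snd_le[of "L (Y e2 t)" "L (Y e1 t)"]
        unfolding y_def by linarith+
      have p: "cmod (z * a) \<le> cmod z * norm (y t)" if "cmod a \<le> norm (y t)" for z a
        using that by (simp add: norm_mult mult_left_mono)
      have 1: "cmod (L (w $ 1 *\<^sub>R Y e1 t + w $ 2 *\<^sub>R Y e2 t)) \<le> (\<bar>w $ 1\<bar> + \<bar>w $ 2\<bar>) * norm (y t)"
        unfolding La
        using norm_triangle_ineq[of "of_real (w $ 1) * L (Y e1 t)" "of_real (w $ 2) * L (Y e2 t)"]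
          p[OF ny(2), of "of_real (w $ 1)"] p[OF ny(3), of "of_real (w $ 2)"]
        by (simp add: distrib_right)
      have 2: "cmod (L (\<alpha> u (c t) *\<^sub>R Y e1 t + \<beta> u (c t) *\<^sub>R Y e2 t - g u t *s Y0 t))
          \<le> (\<bar>\<alpha> u (c t)\<bar> + \<bar>\<beta> u (c t)\<bar> + cmod (g u t)) * norm (y t)" for u
      proof -
        have "L (g u t *s Y0 t) = g u t * L (Y0 t)" unfolding g_def by (rule Lg[OF cU[OF t]])
        then show ?thesis unfolding La
          using norm_triangle_ineq4[of "of_real (\<alpha> u (c t)) * L (Y e1 t) + of_real (\<beta> u (c t)) * L (Y e2 t)" "g u t * L (Y0 t)"]
            norm_triangle_ineq[of "of_real (\<alpha> u (c t)) * L (Y e1 t)" "of_real (\<beta> u (c t)) * L (Y e2 t)"]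
            p[OF ny(2), of "of_real (\<alpha> u (c t))"] p[OF ny(3), of "of_real (\<beta> u (c t))"] p[OF ny(1), of "g u t"]
          by (simp add: distrib_right)
      qed
      have "norm (y' t) \<le> cmod (fst (y' t)) + (cmod (fst (snd (y' t))) + cmod (snd (snd (y' t))))"
        using norm_Pair_le[of "fst (y' t)" "snd (y' t)"] norm_Pair_le[of "fst (snd (y' t))" "snd (snd (y' t))"] by simp
      also have "\<dots> \<le> \<kappa> t * norm (y t)"
        using 1 2[of e1] 2[of e2] unfolding y'_def \<kappa>_def by (simp add: distrib_right)
      also have "\<dots> \<le> C * norm (y t)" by (rule mult_right_mono[OF C[OF t]]) simp
      finally show "norm (y' t) \<le> C * norm (y t)" .
    next
      show "y 0 = 0" using L0 LP by (simp add: y_def Y0_def Y_def c01 l zero_prod_def)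
    qed simp
    then have "L (Y0 1) = 0" "L (Y e1 1) = 0" "L (Y e2 1) = 0" by (simp_all add: y_def zero_prod_def)
    moreover have "l 1 *s P q1 u = u $ 1 *\<^sub>R Y e1 1 + u $ 2 *\<^sub>R Y e2 1" for u
      unfolding Y_def c01 by (subst P_expand[OF q1, of u]) (simp add: vec_eq_iff scaleR_conv_of_real[where 'a=complex] algebra_simps)
    ultimately show "L (l 1 *s Z (F q1)) = 0 \<and> (\<forall>u. L (l 1 *s P q1 u) = 0)"
      by (simp add: La Y0_def c01)
  qed
qed

definition framed :: "(complex^4) set \<Rightarrow> real^2 \<Rightarrow> bool" where
  "framed W q \<longleftrightarrow> (\<exists>l. l \<noteq> 0 \<and> l *s Z (F q) \<in> W \<and> (\<forall>u. l *s P q u \<in> W))"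

text \<open>For each \<open>n\<close> normal to \<open>W\<close> the functional is the real inner
  product with \<open>n\<close> in the real type, where \<open>gH\<close> is real on tangent
  vectors, and \<open>herm _ n\<close> when \<open>W\<close> is invariant under \<open>\<i>\<close>,
  since then \<open>n\<close> is also Hermitian-orthogonal to \<open>W\<close>.\<close>

lemma framed_transport:
  assumes W: "subspace W" and ty: "real_type \<or> (\<forall>w\<in>W. \<i> *s w \<in> W)"
    and q: "q0 \<in> U" "q1 \<in> U" and f: "framed W q0"
  shows "framed W q1"
proof -
  obtain l0 where l0: "l0 \<noteq> 0" "l0 *s Z (F q0) \<in> W" "\<And>u. l0 *s P q0 u \<in> W"
    using f by (auto simp: framed_def)
  obtain l1 where l1: "l1 \<noteq> 0" and tr: "\<And>L. \<lbrakk>bounded_linear L; \<And>q u v x. q \<in> U \<Longrightarrow> L (gH (F q) (T q u) (T q v) *s x) = gH (F q) (T q u) (T q v) * L x;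
       L (l0 *s Z (F q0)) = (0::complex); \<And>u. L (l0 *s P q0 u) = 0\<rbrakk>
     \<Longrightarrow> L (l1 *s Z (F q1)) = 0 \<and> (\<forall>u. L (l1 *s P q1 u) = 0)"
    using transport[OF q l0(1)] by metis
  have key: "(l1 *s Z (F q1)) \<bullet> n = 0 \<and> (\<forall>u. (l1 *s P q1 u) \<bullet> n = 0)" if n: "\<And>w. w \<in> W \<Longrightarrow> w \<bullet> n = 0" for n
    using ty
  proof
    assume r: real_type
    let ?L = "\<lambda>v. complex_of_real (v \<bullet> n)"
    have "?L (l1 *s Z (F q1)) = 0 \<and> (\<forall>u. ?L (l1 *s P q1 u) = 0)"
    proof (rule tr)
      show "bounded_linear ?L"
        by (rule bounded_linear_compose[OF bounded_linear_of_real bounded_linear_inner_left])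
      fix q u v x assume "q \<in> U"
      then have "Im (gH (F q) (T q u) (T q v)) = 0" using r by (auto simp: real_type_def)
      then have "gH (F q) (T q u) (T q v) = of_real (Re (gH (F q) (T q u) (T q v)))" by (simp add: complex_eq_iff)
      then obtain r where "gH (F q) (T q u) (T q v) = of_real r" by blast
      then show "?L (gH (F q) (T q u) (T q v) *s x) = gH (F q) (T q u) (T q v) * ?L x"
        by (simp add: scaleR_smult[symmetric])
    qed (use n l0 in auto)
    then show ?thesis by simp
  next
    assume i: "\<forall>w\<in>W. \<i> *s w \<in> W"
    have hn: "herm w n = 0" if "w \<in> W" for w
    proof -
      have "Re (herm w n) = 0" using n[OF that] by (simp add: Re_herm)
      moreover have "Re (herm (\<i> *s w) n) = 0" using n i that by (simp add: Re_herm)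
      ultimately show ?thesis by (simp add: herm_scale complex_eq_iff)
    qed
    have "herm (l1 *s Z (F q1)) n = 0 \<and> (\<forall>u. herm (l1 *s P q1 u) n = 0)"
      by (rule tr[OF bounded_bilinear.bounded_linear_left[OF bounded_bilinear_herm]])
         (use hn l0 in \<open>auto simp: herm_scale(1)[of "gH _ _ _"]\<close>)
    then show ?thesis by (simp add: Re_herm[symmetric])
  qed
  have "l1 *s Z (F q1) \<in> W" by (rule subspace_memI[OF W]) (use key in blast)
  moreover have "l1 *s P q1 u \<in> W" for u by (rule subspace_memI[OF W]) (use key in blast)
  ultimately show ?thesis using l1 by (auto simp: framed_def)
qed

text \<open>If the points near \<open>q0\<close> are represented by vectors of \<open>W\<close>,
  then the normalised section \<open>inverse (a q) *s Z (F q)\<close> lies in \<open>W\<close>,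
  hence so does its derivative, which is a multiple of the tangent lift.\<close>

lemma framed_if_local:
  assumes W: "subspace W" "herm_closed W" and V: "open V" "V \<subseteq> U" "q0 \<in> V"
    and loc: "\<And>q. q \<in> V \<Longrightarrow> \<exists>l. l \<noteq> 0 \<and> l *s Z (F q) \<in> W"
  shows "framed W q0"
proof -
  obtain l0 where l0: "l0 \<noteq> 0" "l0 *s Z (F q0) \<in> W" using loc[OF V(3)] by blast
  have q0: "q0 \<in> U" using V by blast
  define p where "p = l0 *s Z (F q0)"
  define a where "a q = herm (Z (F q)) p" for q
  have a0: "a q0 = cnj l0 * of_real (N (F q0))"
    by (simp add: a_def p_def herm_scale herm_self N_def)
  have a0': "a q0 \<noteq> 0" using l0 unfolding a0 by simp
  have ad: "(a has_derivative (\<lambda>u. h (F q0) (T q0 u) * a q0)) (at q0)"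
  proof -
    have "(a has_derivative (\<lambda>u. herm (lin (T q0 u)) p)) (at q0)" unfolding a_def
      by (rule bounded_linear.has_derivative[OF bounded_bilinear.bounded_linear_left[OF bounded_bilinear_herm] ZF_has_derivative[OF q0]])
    moreover have "herm (lin (T q0 u)) p = h (F q0) (T q0 u) * a q0" for u
      unfolding a0 by (simp add: p_def herm_scale herm_lin_Z)
    ultimately show ?thesis by simp
  qed
  have ac: "continuous_on V a" unfolding a_def
    using V(2) by (intro continuous_at_imp_continuous_on ballI
       bounded_bilinear.continuous[OF bounded_bilinear_herm] has_derivative_continuous[OF ZF_has_derivative] continuous_const) auto
  define V' where "V' = V \<inter> a -` (- {0})"
  have V': "open V'" unfolding V'_def
    by (rule continuous_open_preimage[OF ac V(1)]) (simp add: open_Compl)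
  have q0V: "q0 \<in> V'" using V a0' by (simp add: V'_def)
  have in_W: "inverse (a q) *s Z (F q) \<in> W" if qV: "q \<in> V'" for q
  proof -
    obtain l where "l \<noteq> 0" "l *s Z (F q) \<in> W" using loc[of q] qV by (auto simp: V'_def)
    then show ?thesis using herm_closed_normalize[OF W, of l "Z (F q)" p] l0 qV
      by (simp add: V'_def a_def p_def inverse_eq_divide)
  qed
  have "((\<lambda>q. inverse (a q) *s Z (F q)) has_derivative
      (\<lambda>u. inverse (a q0) *s lin (T q0 u) + (- (inverse (a q0) * (h (F q0) (T q0 u) * a q0) * inverse (a q0))) *s Z (F q0))) (at q0)"
    by (intro bounded_bilinear.FDERIV[OF bounded_bilinear_smult] ZF_has_derivative[OF q0]
        Deriv.has_derivative_inverse[OF a0' ad])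
  moreover have "inverse (a q0) *s lin (T q0 u) + (- (inverse (a q0) * (h (F q0) (T q0 u) * a q0) * inverse (a q0))) *s Z (F q0)
      = inverse (a q0) *s P q0 u" for u
    using a0' by (simp add: P_def lift_def vec_eq_iff algebra_simps)
  ultimately have "((\<lambda>q. inverse (a q) *s Z (F q)) has_derivative (\<lambda>u. inverse (a q0) *s P q0 u)) (at q0)" by simp
  note der = derivative_in_subspace[OF W(1) V' q0V in_W this]
  have "l0 *s P q0 u \<in> W" for u
  proof -
    \<comment> \<open>The real factor that turns \<open>inverse (a q0)\<close> into
      \<open>l0\<close>, since \<open>a q0\<close> is \<open>cnj l0 * N (F q0)\<close>.\<close>
    have "((cmod l0)\<^sup>2 * N (F q0)) *\<^sub>R (inverse (a q0) *s P q0 u) \<in> W"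
      by (rule subspace_scale[OF W(1) der])
    moreover have n: "of_real ((cmod l0)\<^sup>2 * N (F q0)) = (l0 * cnj l0) * of_real (N (F q0))"
      by (simp only: of_real_mult complex_norm_square)
    have "(l0 * cnj l0) * of_real (N (F q0)) * inverse (cnj l0 * of_real (N (F q0))) = l0"
      using l0 by (simp add: field_simps)
    then have "((cmod l0)\<^sup>2 * N (F q0)) *\<^sub>R (inverse (a q0) *s P q0 u) = l0 *s P q0 u"
      unfolding scaleR_smult a0 smult_assoc n by simp
    ultimately show ?thesis by simp
  qed
  then show ?thesis using l0 by (auto simp: framed_def)
qed

end

section \<open>Totally geodesic surfaces lie in projective planes\<close>

definition isotropic :: "(complex^4) set \<Rightarrow> bool" where
  "isotropic W \<longleftrightarrow> (\<forall>v\<in>W. \<forall>w\<in>W. Im (herm v w) = 0)"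

definition complex_closed :: "(complex^4) set \<Rightarrow> bool" where
  "complex_closed W \<longleftrightarrow> (\<forall>w\<in>W. \<i> *s w \<in> W)"

text \<open>Dimensions are real: 3 for the cone over a real projective plane, 4 for that over a
  complex projective line. The bounds are from above; a framed point supplies the lower
  ones.\<close>

definition plane :: "(complex^4) set \<Rightarrow> bool" where
  "plane W \<longleftrightarrow> subspace W \<and> (isotropic W \<and> dim W \<le> 3 \<or> complex_closed W \<and> dim W \<le> 4)"

definition proj :: "(complex^4) set \<Rightarrow> (complex^4) set set" where
  "proj W = hopf ` (W \<inter> sphere 0 1)"

lemma complex_closedD:
  assumes "subspace W" "complex_closed W" "w \<in> W" shows "a *s w \<in> W"
  using assms by (subst smult_Re_Im) (auto simp: complex_closed_def intro!: subspace_add subspace_scale)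

lemma plane_herm_closed:
  assumes "plane W" shows "herm_closed W"
proof -
  have W: "subspace W" using assms by (simp add: plane_def)
  consider "isotropic W" | "complex_closed W" using assms by (auto simp: plane_def)
  then show ?thesis
  proof cases
    case 1
    show ?thesis unfolding herm_closed_def
    proof (intro ballI)
      fix v w assume vw: "v \<in> W" "w \<in> W"
      then have "herm v w *s w = Re (herm v w) *\<^sub>R w"
        using 1 by (subst smult_Re_Im) (simp add: isotropic_def)
      then show "herm v w *s w \<in> W" using subspace_scale[OF W vw(2)] by simp
    qed
  next
    case 2
    then show ?thesis unfolding herm_closed_def using complex_closedD[OF W] by blast
  qed
qed

lemma sgn_scaleR_mem: "subspace W \<Longrightarrow> (z::complex^4) \<in> W \<Longrightarrow> sgn z \<in> W"
  by (simp add: sgn_div_norm subspace_scale)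

lemma hopf_in_proj:
  assumes W: "subspace W" and z: "z \<noteq> 0"
  shows "hopf (sgn z) \<in> proj W \<longleftrightarrow> (\<exists>l. l \<noteq> 0 \<and> l *s z \<in> W)"
proof
  assume "hopf (sgn z) \<in> proj W"
  then obtain p where p: "p \<in> W" "hopf p = hopf (sgn z)" by (auto simp: proj_def)
  then obtain c where c: "cmod c = 1" "p = c *s sgn z" using hopf_eqD by blast
  then show "\<exists>l. l \<noteq> 0 \<and> l *s z \<in> W"
    using p z by (intro exI[of _ "c * of_real (1 / norm z)"]) (auto simp: vec_sgn_smult smult_assoc)
next
  assume "\<exists>l. l \<noteq> 0 \<and> l *s z \<in> W"
  then obtain l where l: "l \<noteq> 0" "l *s z \<in> W" by blast
  then have "l *s z \<noteq> 0" using z by (metis mult_eq_0_iff norm_eq_zero norm_smult)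
  then have "hopf (sgn (l *s z)) \<in> proj W"
    using sgn_scaleR_mem[OF W l(2)] by (auto simp: proj_def norm_sgn)
  then show "hopf (sgn z) \<in> proj W" using hopf_sgn_smult[OF l(1)] by simp
qed

text \<open>On an isotropic \<open>W\<close> the Hermitian condition reduces to a single real
  equation; for complex \<open>W\<close> it removes both \<open>p\<close> and
  \<open>\<i> *s p\<close>.\<close>

lemma isotropic_complement_dim:
  assumes W: "subspace W" and iso: "isotropic W" and p: "p \<in> W" and p0: "p \<noteq> 0"
  shows "dim {v \<in> W. herm v p = 0} + 1 = dim W"
proof -
  have A: "span {p} \<subseteq> W" using W p by (simp add: span_minimal)
  have "{v \<in> W. herm v p = 0} = {y \<in> W. \<forall>x\<in>span {p}. orthogonal x y}"
  proof -
    have "herm y p = 0 \<longleftrightarrow> p \<bullet> y = 0" if "y \<in> W" for y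
      using iso that p by (simp add: isotropic_def complex_eq_iff Re_herm inner_commute)
    then show ?thesis by (auto simp: span_singleton orthogonal_def)
  qed
  then have "dim {v \<in> W. herm v p = 0} + dim (span {p}) = dim W"
    using dim_subspace_orthogonal_to_vectors[OF subspace_span W A] by simp
  moreover have "dim (span {p}) = 1" using p0 by (simp add: dim_span dim_insert)
  ultimately show ?thesis by simp
qed

lemma complex_complement_dim:
  assumes W: "subspace W" and cW: "complex_closed W" and p: "p \<in> W" and p0: "p \<noteq> 0"
  shows "dim {v \<in> W. herm v p = 0} + 2 = dim W"
proof -
  define A where "A = span {p, \<i> *s p}"
  define S where "S = {v \<in> W. herm v p = 0}"
  have A: "A \<subseteq> W" unfolding A_def
    using W p cW by (intro span_minimal) (auto simp: complex_closed_def)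
  have "S = {y \<in> W. \<forall>x\<in>A. orthogonal x y}"
  proof (intro equalityI subsetI)
    fix y assume y: "y \<in> S"
    have "orthogonal x y" if "x \<in> A" for x
    proof -
      have "orthogonal y x" using that unfolding A_def
      proof (rule orthogonal_to_span)
        fix x assume "x \<in> {p, \<i> *s p}"
        then show "orthogonal y x" using y
          by (auto simp: S_def orthogonal_def Re_herm[symmetric] herm_scale)
      qed
      then show ?thesis by (simp add: orthogonal_commute)
    qed
    then show "y \<in> {y \<in> W. \<forall>x\<in>A. orthogonal x y}" using y by (simp add: S_def)
  next
    fix y assume y: "y \<in> {y \<in> W. \<forall>x\<in>A. orthogonal x y}"
    have "p \<in> A" "\<i> *s p \<in> A" by (auto simp: A_def span_base)
    then have "y \<bullet> p = 0" "y \<bullet> (\<i> *s p) = 0" using y by (auto simp: orthogonal_def inner_commute)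
    then have "herm y p = 0" by (simp add: complex_eq_iff Re_herm Im_herm)
    then show "y \<in> S" using y by (simp add: S_def)
  qed
  then have "dim S + dim A = dim W"
    using dim_subspace_orthogonal_to_vectors[OF subspace_span W A[unfolded A_def]] by (simp add: A_def)
  moreover have "dim A = 2"
  proof -
    have ip: "\<i> *s p \<notin> span {p}"
    proof
      assume "\<i> *s p \<in> span {p}"
      then obtain r where "\<i> *s p = r *\<^sub>R p" by (auto simp: span_singleton)
      then have "herm (\<i> *s p) p = herm (r *\<^sub>R p) p" by simp
      then have "\<i> * herm p p = r * herm p p" by (simp add: herm_scale herm_scaleR)
      then show False using p0 unfolding herm_self by (simp add: complex_eq_iff)
    qed
    have "independent {p}" using p0 by (simp add: independent_insert)
    then have "independent {\<i> *s p, p}" using ip by (metis independent_insertI)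
    moreover have "\<i> *s p \<noteq> p" using ip span_base by (metis insertI1)
    ultimately have "dim {\<i> *s p, p} = 2" by (simp add: dim_eq_card_independent)
    then show ?thesis by (simp add: A_def dim_span insert_commute)
  qed
  ultimately show ?thesis by (simp add: S_def)
qed

lemma complement_subspace: "subspace W \<Longrightarrow> subspace {v \<in> W. herm v p = 0}"
  unfolding subspace_def by (auto simp: herm_add herm_scaleR)

context patch
begin

lemma P_linear: "q \<in> U \<Longrightarrow> linear (P q)"
  unfolding P_def[abs_def] using linear_compose[OF T_linear lift_linear] by (simp add: o_def)

lemma P_inj: "q \<in> U \<Longrightarrow> P q u = 0 \<longleftrightarrow> u = 0"
proof -
  assume q: "q \<in> U"
  have "T q u = 0 \<longleftrightarrow> u = 0"
    using inj[OF q] linear_0[OF T_linear[OF q]] unfolding T_def by (metis injD)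
  then show ?thesis by (simp add: P_def)
qed

lemma smult_P_linear: "q \<in> U \<Longrightarrow> linear (\<lambda>u. l *s P q u)"
  by (rule linearI) (simp_all add: linear_add[OF P_linear] linear_scale[OF P_linear]
      vec_eq_iff scaleR_conv_of_real[where 'a=complex] algebra_simps)

lemma smult_P_inj: "q \<in> U \<Longrightarrow> l \<noteq> 0 \<Longrightarrow> inj (\<lambda>u. l *s P q u)"
  unfolding linear_injective_0[OF smult_P_linear] using P_inj by (metis mult_eq_0_iff norm_eq_zero norm_smult)

lemma dim_smult_P: "q \<in> U \<Longrightarrow> l \<noteq> 0 \<Longrightarrow> dim (range (\<lambda>u. l *s P q u)) = 2"
  using dim_image_eq[OF smult_P_linear] smult_P_inj by (simp add: inj_on_subset dim_UNIV)

lemma framedE: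
  assumes W: "subspace W" and "framed W q"
  obtains l where "cmod l * norm (Z (F q)) = 1" "l *s Z (F q) \<in> W" "\<And>u. l *s P q u \<in> W"
proof -
  obtain l where l: "l \<noteq> 0" "l *s Z (F q) \<in> W" "\<And>u. l *s P q u \<in> W"
    using assms(2) by (auto simp: framed_def)
  define r where "r = 1 / (cmod l * norm (Z (F q)))"
  have "r *\<^sub>R (l *s v) = (of_real r * l) *s v" for v :: "complex^4" by (simp add: scaleR_smult smult_assoc)
  then have "(of_real r * l) *s v \<in> W" if "l *s v \<in> W" for v :: "complex^4"
    using subspace_scale[OF W that, of r] by simp
  then show ?thesis
    using that[of "of_real r * l"] l by (simp add: r_def norm_mult norm_divide)
qed

text \<open>A dimension count: the lifted tangent vectors already form a space of dimension 2 inside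
  the complement of the point in \<open>W\<close>, whose dimension is at most 2. So vectors of
  \<open>W\<close> can be read as tangent vectors.\<close>

lemma frame_complement:
  assumes W: "plane W" and q: "q \<in> U" and l: "l \<noteq> 0" "l *s Z (F q) \<in> W" "\<And>u. l *s P q u \<in> W"
    and v: "v \<in> W" "herm v (l *s Z (F q)) = 0"
  shows "\<exists>u. v = l *s P q u"
proof -
  have sW: "subspace W" using W by (simp add: plane_def)
  define p where "p = l *s Z (F q)"
  have p0: "p \<noteq> 0" using l(1) by (metis Z_nonzero norm_eq_zero norm_smult mult_eq_0_iff p_def)
  have hlp: "herm (l *s P q u) p = 0" for u by (simp add: p_def P_def herm_scale)
  define R where "R = range (\<lambda>u. l *s P q u)"
  have R: "subspace R" unfolding R_def by (rule linear_subspace_image[OF smult_P_linear[OF q] subspace_UNIV])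
  have dimR: "dim R = 2" unfolding R_def by (rule dim_smult_P[OF q l(1)])
  define S where "S = {v \<in> W. herm v p = 0}"
  have S: "subspace S" unfolding S_def by (rule complement_subspace[OF sW])
  have RS: "R \<subseteq> S" unfolding R_def S_def using l(3) hlp by auto
  have dimS: "dim S \<le> 2"
    using W isotropic_complement_dim[OF sW _ l(2)[folded p_def] p0]
      complex_complement_dim[OF sW _ l(2)[folded p_def] p0]
    unfolding plane_def S_def by fastforce
  have "R = S" by (rule subspace_dim_equal[OF R S RS]) (use dimR dimS in simp)
  then show ?thesis using v unfolding S_def R_def p_def by auto
qed

text \<open>This is why the image is open in \<open>proj W\<close>. The section
  \<open>\<psi>\<close> takes values in the affine slice \<open>herm w p0 = 1\<close> of
  \<open>W\<close>, and in the linear coordinates \<open>\<kappa>\<close> it covers a ball by an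
  open mapping theorem; hence every point of the slice near \<open>p0\<close> is attained.\<close>

lemma local_open:
  assumes W: "plane W" and q0: "q0 \<in> U" and f: "\<And>q. q \<in> U \<Longrightarrow> framed W q"
    and l: "cmod l * norm (Z (F q0)) = 1" "l *s Z (F q0) \<in> W" "\<And>u. l *s P q0 u \<in> W"
  defines "p0 \<equiv> l *s Z (F q0)"
  obtains \<delta> where "\<delta> > 0" "\<And>p. \<lbrakk>p \<in> W; herm p p0 \<noteq> 0; norm ((1 / herm p p0) *s p - p0) < \<delta>\<rbrakk>
    \<Longrightarrow> \<exists>q\<in>U. hopf (sgn p) = hopf (sgn (Z (F q)))"
proof -
  have sW: "subspace W" and hW: "herm_closed W" using W plane_herm_closed by (auto simp: plane_def)
  have l0: "l \<noteq> 0" using l(1) by auto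
  define a where "a q = herm (Z (F q)) p0" for q
  have a0: "a q0 = cnj l * of_real (N (F q0))"
    by (simp add: a_def p0_def herm_scale herm_self N_def)
  have la: "l * a q0 = 1"
  proof -
    have n: "l * cnj l = of_real ((cmod l)\<^sup>2)" by (rule complex_norm_square[symmetric])
    have "l * a q0 = (l * cnj l) * of_real (N (F q0))" unfolding a0 by simp
    also have "\<dots> = of_real ((cmod l * norm (Z (F q0)))\<^sup>2)"
      unfolding n N_def by (simp add: power_mult_distrib)
    finally have "l * a q0 = of_real ((cmod l * norm (Z (F q0)))\<^sup>2)" .
    then show ?thesis using l(1) by simp
  qed
  then have a0': "a q0 \<noteq> 0" "inverse (a q0) = l" by (auto simp: inverse_unique mult.commute)
  have adg: "(a has_derivative (\<lambda>u. herm (lin (T q u)) p0)) (at q)" if "q \<in> U" for q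
    unfolding a_def
    by (rule bounded_linear.has_derivative[OF bounded_bilinear.bounded_linear_left[OF bounded_bilinear_herm] ZF_has_derivative[OF that]])
  have ac: "continuous_on U a"
    by (intro continuous_at_imp_continuous_on ballI has_derivative_continuous[OF adg])
  define V where "V = U \<inter> a -` (- {0})"
  have V: "open V" unfolding V_def
    by (rule continuous_open_preimage[OF ac U(1)]) (simp add: open_Compl)
  have q0V: "q0 \<in> V" using q0 a0' by (simp add: V_def)
  define \<psi> where "\<psi> q = inverse (a q) *s Z (F q)" for q
  have \<psi>d: "(\<psi> has_derivative (\<lambda>u. inverse (a q) *s lin (T q u) +
      (- (inverse (a q) * herm (lin (T q u)) p0 * inverse (a q))) *s Z (F q))) (at q)" if "q \<in> V" for q
    unfolding \<psi>_def using that
    by (intro bounded_bilinear.FDERIV[OF bounded_bilinear_smult] ZF_has_derivative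
        Deriv.has_derivative_inverse adg) (auto simp: V_def)
  have \<psi>c: "continuous_on V \<psi>"
    by (intro continuous_at_imp_continuous_on ballI has_derivative_continuous[OF \<psi>d])
  have "inverse (a q0) *s lin (T q0 u) + (- (inverse (a q0) * herm (lin (T q0 u)) p0 * inverse (a q0))) *s Z (F q0)
      = l *s P q0 u" for u
  proof -
    have "herm (lin (T q0 u)) p0 = h (F q0) (T q0 u) * a q0"
      unfolding a0 by (simp add: p0_def herm_scale herm_lin_Z)
    then have e: "inverse (a q0) * herm (lin (T q0 u)) p0 * inverse (a q0) = l * h (F q0) (T q0 u)"
      using a0' la by (simp add: mult.commute)
    show ?thesis unfolding e unfolding P_def lift_def a0'(2) by (simp add: vec_eq_iff algebra_simps)
  qed
  then have \<psi>d0: "(\<psi> has_derivative (\<lambda>u. l *s P q0 u)) (at q0)" using \<psi>d[OF q0V] by simp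
  have linl: "linear (\<lambda>u. l *s P q0 u)" by (rule smult_P_linear[OF q0])
  have "inj (\<lambda>u. l *s P q0 u)" by (rule smult_P_inj[OF q0 l0])
  \<comment> \<open>A left inverse of the tangent map at \<open>q0\<close>, used as coordinates on
    the slice; it makes the derivative of \<open>\<kappa> \<circ> \<psi>\<close> at
    \<open>q0\<close> the identity.\<close>
  then obtain \<kappa> where \<kappa>: "linear \<kappa>" "\<kappa> \<circ> (\<lambda>u. l *s P q0 u) = id"
    using linear_injective_left_inverse[OF linl] by blast
  have \<kappa>P: "\<kappa> (l *s P q0 u) = u" for u using \<kappa>(2) by (metis comp_apply id_apply)
  have bl: "bounded_linear \<kappa>" using \<kappa>(1) by (simp add: linear_linear)
  have "\<psi> q0 = p0" by (simp add: \<psi>_def a0' p0_def)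
  have "((\<lambda>q. \<kappa> (\<psi> q)) has_derivative (\<lambda>u. \<kappa> (l *s P q0 u))) (at q0)"
    by (rule bounded_linear.has_derivative[OF bl \<psi>d0])
  then have kd: "((\<lambda>q. \<kappa> (\<psi> q)) has_derivative id) (at q0)" by (simp add: \<kappa>P id_def)
  have "\<kappa> (\<psi> q0) \<in> interior ((\<lambda>q. \<kappa> (\<psi> q)) ` V)"
  \<comment> \<open>This open mapping theorem takes the derivative at the single point
    \<open>q0\<close>, together with a right inverse of it.\<close>
  proof (rule sussmann_open_mapping[OF V _ q0V kd])
    show "continuous_on V (\<lambda>q. \<kappa> (\<psi> q))"
      by (rule bounded_linear.continuous_on[OF bl \<psi>c])
    show "bounded_linear (id :: real^2 \<Rightarrow> real^2)" by (simp add: id_def)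
    show "q0 \<in> interior V" using V q0V by (simp add: interior_open)
  qed auto
  then obtain \<epsilon> where \<epsilon>: "\<epsilon> > 0" "ball (\<kappa> p0) \<epsilon> \<subseteq> (\<lambda>q. \<kappa> (\<psi> q)) ` V"
    unfolding \<open>\<psi> q0 = p0\<close> mem_interior by blast
  have "isCont \<kappa> p0" by (rule linear_continuous_at[OF bl])
  then obtain \<delta> where \<delta>: "\<delta> > 0" "\<And>w. dist w p0 < \<delta> \<Longrightarrow> dist (\<kappa> w) (\<kappa> p0) < \<epsilon>"
    unfolding continuous_at_eps_delta using \<epsilon>(1) by metis
  show ?thesis
  proof (rule that[OF \<delta>(1)])
    fix p assume p: "p \<in> W" "herm p p0 \<noteq> 0" "norm ((1 / herm p p0) *s p - p0) < \<delta>"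
    define w where "w = (1 / herm p p0) *s p"
    have wW: "w \<in> W" unfolding w_def
      by (rule herm_closed_normalize[OF sW hW, of 1]) (use p l(2) in \<open>auto simp: p0_def\<close>)
    have hw: "herm w p0 = 1" using p(2) by (simp add: w_def herm_scale)
    have "dist (\<kappa> w) (\<kappa> p0) < \<epsilon>" by (rule \<delta>(2)) (use p(3) in \<open>simp add: dist_norm w_def\<close>)
    then have "\<kappa> w \<in> ball (\<kappa> p0) \<epsilon>" by (simp add: dist_commute)
    then obtain q where q: "q \<in> V" "\<kappa> w = \<kappa> (\<psi> q)" using \<epsilon>(2) by auto
    have qU: "q \<in> U" and aq: "a q \<noteq> 0" using q(1) by (auto simp: V_def)
    obtain l' where l': "l' \<noteq> 0" "l' *s Z (F q) \<in> W" using f[OF qU] by (auto simp: framed_def)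
    have \<psi>W: "\<psi> q \<in> W" unfolding \<psi>_def a_def inverse_eq_divide
      by (rule herm_closed_normalize[OF sW hW l'(2,1)]) (use l(2) aq in \<open>auto simp: p0_def a_def\<close>)
    have h\<psi>: "herm (\<psi> q) p0 = 1" using aq by (simp add: \<psi>_def herm_scale flip: a_def)
    have "w - \<psi> q \<in> W" using wW \<psi>W by (rule subspace_diff[OF sW])
    \<comment> \<open>Two points of the slice differ by a vector of \<open>W\<close> orthogonal to
      \<open>p0\<close>, hence by a tangent lift at \<open>q0\<close>, and \<open>\<kappa>\<close>
      is injective on those. Equal coordinates thus give equal points.\<close>
    moreover have "herm (w - \<psi> q) (l *s Z (F q0)) = 0" unfolding p0_def[symmetric] by (simp add: herm_diff hw h\<psi>)
    ultimately obtain u where u: "w - \<psi> q = l *s P q0 u"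
      using frame_complement[OF W q0 l0 l(2,3)] by blast
    have "\<kappa> (w - \<psi> q) = 0" using q(2) by (simp add: linear_diff[OF \<kappa>(1)])
    then have "u = 0" unfolding u \<kappa>P .
    then have "w = \<psi> q" using u linear_0[OF linl] by simp
    moreover have "hopf (sgn w) = hopf (sgn p)" unfolding w_def by (rule hopf_sgn_smult) (use p(2) in simp)
    moreover have "hopf (sgn (\<psi> q)) = hopf (sgn (Z (F q)))" unfolding \<psi>_def by (rule hopf_sgn_smult) (use aq in simp)
    ultimately show "\<exists>q\<in>U. hopf (sgn p) = hopf (sgn (Z (F q)))" using qU by auto
  qed
qed

lemma plane_exists:
  assumes q: "q0 \<in> U"
  obtains W where "plane W" "framed W q0" "real_type \<or> complex_closed W"
proof -
  define z where "z = Z (F q0)"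
  have hzP: "herm z (P q0 u) = 0" "herm (P q0 u) z = 0" for u by (simp_all add: z_def P_def)
  have hPP: "herm (P q0 u) (P q0 v) = gH (F q0) (T q0 u) (T q0 v) * N (F q0)" for u v
    by (simp add: gH_lift P_def)
  show ?thesis
  proof (cases real_type)
    case True
    define W where "W = span {z, P q0 e1, P q0 e2}"
    have sW: "subspace W" by (simp add: W_def)
    have "dim W \<le> card {z, P q0 e1, P q0 e2}" unfolding W_def dim_span by (rule dim_le_card') simp
    also have "\<dots> \<le> 3" by (simp add: card_insert_if)
    finally have dW: "dim W \<le> 3" .
    have PW: "P q0 u \<in> W" for u
      unfolding W_def by (subst P_expand[OF q]) (intro span_add span_scale span_base; simp)
    have W_eq: "\<exists>r u. w = r *\<^sub>R z + P q0 u" if "w \<in> W" for w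
    proof -
      obtain r s t where "w - r *\<^sub>R z - s *\<^sub>R P q0 e1 = t *\<^sub>R P q0 e2"
        using \<open>w \<in> W\<close> unfolding W_def span_insert span_empty by auto
      then have "w = r *\<^sub>R z + P q0 (s *\<^sub>R e1 + t *\<^sub>R e2)"
        by (simp add: linear_add[OF P_linear[OF q]] linear_scale[OF P_linear[OF q]] algebra_simps)
      then show ?thesis by blast
    qed
    have "isotropic W" unfolding isotropic_def
    proof (intro ballI)
      fix v w assume "v \<in> W" "w \<in> W"
      then obtain r u s t where "v = r *\<^sub>R z + P q0 u" "w = s *\<^sub>R z + P q0 t" using W_eq by blast
      then show "Im (herm v w) = 0"
        using True q by (simp add: herm_add herm_scaleR hzP hPP herm_self real_type_def)
    qed
    then have "plane W" using sW dW by (simp add: plane_def)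
    moreover have "framed W q0" unfolding framed_def
      by (rule exI[of _ 1]) (use PW in \<open>auto simp: W_def z_def span_base\<close>)
    ultimately show ?thesis using that True by blast
  next
    case False
    then have ct: complex_type using type_dichotomy by blast
    have iP: "\<exists>u'. \<i> *s P q0 u = P q0 u'" for u
    proof -
      obtain u' where "\<i> *s T q0 u = T q0 u'" using ct q unfolding complex_type_def by blast
      then have "\<i> *s P q0 u = P q0 u'" unfolding P_def by (metis lift_smult)
      then show ?thesis by blast
    qed
    \<comment> \<open>Only the point needs complex coefficients: the tangent plane is already
      invariant under \<open>\<i>\<close>.\<close>
    define W where "W = {a *s z + P q0 u | a u. True}"
    have mem: "a *s z + P q0 u \<in> W" for a u by (auto simp: W_def)
    have sW: "subspace W" unfolding subspace_def
    proof (intro conjI ballI allI)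
      show "0 \<in> W" using mem[of 0 0] by (simp add: linear_0[OF P_linear[OF q]])
      fix v w assume "v \<in> W" "w \<in> W"
      then obtain a u b t where v: "v = a *s z + P q0 u" and w: "w = b *s z + P q0 t" by (auto simp: W_def)
      have "v + w = (a + b) *s z + P q0 (u + t)"
        unfolding v w linear_add[OF P_linear[OF q]] by (simp add: vec_eq_iff algebra_simps)
      then show "v + w \<in> W" using mem by (simp only:)
      show "r *\<^sub>R v \<in> W" for r
      proof -
        have "r *\<^sub>R v = (of_real r * a) *s z + P q0 (r *\<^sub>R u)"
          unfolding v linear_scale[OF P_linear[OF q]] scaleR_smult by (simp add: vec_eq_iff algebra_simps)
        then show ?thesis using mem by (simp only:)
      qed
    qed
    have cW: "complex_closed W" unfolding complex_closed_def
    proof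
      fix w assume "w \<in> W"
      then obtain a u where w: "w = a *s z + P q0 u" by (auto simp: W_def)
      obtain u' where u': "\<i> *s P q0 u = P q0 u'" using iP by blast
      have "\<i> *s w = (\<i> * a) *s z + \<i> *s P q0 u" unfolding w by (simp add: vec_eq_iff algebra_simps)
      then show "\<i> *s w \<in> W" unfolding u' using mem by simp
    qed
    have "W \<subseteq> span {z, \<i> *s z, P q0 e1, P q0 e2}"
    proof
      fix w assume "w \<in> W"
      then obtain a u where w: "w = a *s z + P q0 u" by (auto simp: W_def)
      show "w \<in> span {z, \<i> *s z, P q0 e1, P q0 e2}"
        unfolding w smult_Re_Im[of a] P_expand[OF q, of u]
        by (intro span_add span_scale span_base; simp)
    qed
    then have "dim W \<le> card {z, \<i> *s z, P q0 e1, P q0 e2}"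
      by (rule dim_le_card) simp
    also have "\<dots> \<le> 4" by (simp add: card_insert_if)
    finally have "plane W" using sW cW by (simp add: plane_def)
    moreover have "framed W q0" unfolding framed_def
      using mem[of 1 0] mem[of 0] linear_0[OF P_linear[OF q]] by (intro exI[of _ 1]) (auto simp: z_def)
    ultimately show ?thesis using that cW by blast
  qed
qed

text \<open>In the complex type \<open>W\<close> would contain both \<open>X\<close> and
  \<open>\<i> *s X\<close> for some nonzero \<open>X\<close>, whose Hermitian product has a nonzero
  imaginary part.\<close>

lemma isotropic_real_type:
  assumes W: "isotropic W" and q: "q \<in> U" and f: "framed W q"
  shows real_type
proof (rule ccontr)
  assume "\<not> real_type"
  then have ct: complex_type using type_dichotomy by blast
  obtain l where l: "l \<noteq> 0" "\<And>u. l *s P q u \<in> W" using f by (auto simp: framed_def)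
  obtain u where "\<i> *s T q e1 = T q u" using ct q unfolding complex_type_def by blast
  then have "P q u = \<i> *s P q e1" unfolding P_def by (metis lift_smult)
  then have "Im (herm (l *s (\<i> *s P q e1)) (l *s P q e1)) = 0" using W l(2) unfolding isotropic_def by metis
  moreover have "herm (l *s (\<i> *s P q e1)) (l *s P q e1) = \<i> * herm (l *s P q e1) (l *s P q e1)"
    by (simp add: herm_scale)
  ultimately have "norm (l *s P q e1) = 0" by (simp add: herm_self)
  then have "P q e1 = 0" using l(1) by (simp add: norm_smult)
  then show False using P_inj[OF q] by (simp add: axis_eq_0_iff)
qed

lemma plane_transport:
  assumes W: "plane W" and q: "q0 \<in> U" "q1 \<in> U" and f: "framed W q0"
  shows "framed W q1"
proof -
  have "real_type \<or> (\<forall>w\<in>W. \<i> *s w \<in> W)"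
    using W isotropic_real_type[OF _ q(1) f] by (auto simp: plane_def complex_closed_def)
  then show ?thesis using framed_transport[OF _ _ q f] W by (simp add: plane_def)
qed

end

section \<open>From patches to the whole connected surface\<close>

locale geodesic_surface =
  fixes M :: "'m topology" and A :: "('m, real^2) chart set" and f :: "'m \<Rightarrow> (complex^4) set"
  assumes M: "smooth_manifold M A" "connected_space M"
    and imm: "immersion M A CP3 CP3_atlas f"
    and geod: "totally_geodesic A CP3_atlas g_FS f"
begin

lemma chart:
  assumes "c \<in> A"
  shows "openin M (fst c)" "open (snd c ` fst c)"
    "homeomorphic_map (subtopology M (fst c)) (top_of_set (snd c ` fst c)) (snd c)" "inj_on (snd c) (fst c)"
    "fst c \<subseteq> topspace M"
proof -
  show 1: "openin M (fst c)" "open (snd c ` fst c)"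
    and 2: "homeomorphic_map (subtopology M (fst c)) (top_of_set (snd c ` fst c)) (snd c)"
    using M(1) assms by (auto simp: smooth_manifold_def smooth_atlas_def)
  show 3: "fst c \<subseteq> topspace M" using 1 by (simp add: openin_subset)
  have "inj_on (snd c) (topspace (subtopology M (fst c)))"
    using 2 by (rule homeomorphic_imp_injective_map)
  then show "inj_on (snd c) (fst c)" using 3 by (simp add: inf.absorb2)
qed

lemma chart_image_open:
  assumes c: "c \<in> A" and "E \<subseteq> fst c"
  shows "open (snd c ` E) \<longleftrightarrow> openin M E"
proof -
  have "openin (top_of_set (snd c ` fst c)) (snd c ` E) \<longleftrightarrow> openin (subtopology M (fst c)) E"
    by (rule homeomorphic_map_openness[OF chart(3)[OF c]]) (use assms chart(5)[OF c] in auto)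
  then show ?thesis
    using chart(1,2)[OF c] assms(2) by (auto simp: openin_open_eq openin_open_subtopology)
qed

lemma f_topspace: "x \<in> topspace M \<Longrightarrow> f x \<in> topspace CP3"
  using imm continuous_map_image_subset_topspace unfolding immersion_def smooth_map_def by blast

lemma CP3_chart_open: "d \<in> CP3_atlas \<Longrightarrow> openin CP3 (fst d)"
proof -
  assume "d \<in> CP3_atlas"
  then obtain i lin pr where "aff i lin pr d" by (rule CP3_atlas_aff)
  then interpret aff i lin pr d .
  have "{p \<in> sphere 0 1. hopf p \<in> fst d} = sphere 0 1 \<inter> {p. p $ i \<noteq> 0}"
    using mem_dom by auto
  moreover have "open {p :: complex^4. p $ i \<noteq> 0}"
    by (intro open_Collect_neq continuous_intros)
  ultimately show ?thesis unfolding openin_CP3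
    using fst_sub by (auto simp: topspace_CP3 openin_open)
qed

lemma rep_dom_open:
  assumes c: "c \<in> A" and d: "d \<in> CP3_atlas"
  shows "open (rep_dom c d f)"
proof -
  have "continuous_map M CP3 f" using imm unfolding immersion_def smooth_map_def by blast
  then have "openin M {y \<in> topspace M. f y \<in> fst d}"
    using CP3_chart_open[OF d] unfolding continuous_map_alt by (simp add: Collect_conj_eq Int_commute vimage_def)
  then have "openin M (fst c \<inter> {y \<in> topspace M. f y \<in> fst d})"
    using chart(1)[OF c] by blast
  moreover have "fst c \<inter> {y \<in> topspace M. f y \<in> fst d} = fst c \<inter> f -` fst d"
    using chart(5)[OF c] by auto
  ultimately show ?thesis unfolding rep_dom_def using chart_image_open[OF c] by simp
qed

definition patch_of where
  "patch_of c d i lin pr B \<longleftrightarrow> c \<in> A \<and> d \<in> CP3_atlas \<and> B \<subseteq> rep_dom c d f \<and> patch i lin pr d B (rep c d f)"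

lemma patch_exists:
  assumes c: "c \<in> A" and d: "d \<in> CP3_atlas" and q: "q \<in> rep_dom c d f"
  obtains B i lin pr where "q \<in> B" "patch_of c d i lin pr B"
proof -
  obtain r where r: "r > 0" "ball q r \<subseteq> rep_dom c d f"
    using rep_dom_open[OF c d] q openE by blast
  obtain i lin pr where aff: "aff i lin pr d" using d by (rule CP3_atlas_aff)
  interpret aff i lin pr d by (rule aff)
  have sm: "smooth_on (rep_dom c d f) (rep c d f)"
    and inj: "\<And>q. q \<in> rep_dom c d f \<Longrightarrow> inj (frechet_derivative (rep c d f) (at q))"
    using imm c d by (auto simp: immersion_def smooth_map_def)
  have "patch i lin pr d (ball q r) (rep c d f)"
  proof (intro patch.intro patch_axioms.intro aff)
    show "smooth_on (ball q r) (rep c d f)" by (rule smooth_on_subset[OF sm r(2)])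
    fix p assume "p \<in> ball q r"
    then have p: "p \<in> rep_dom c d f" using r by blast
    show i: "inj (frechet_derivative (rep c d f) (at p))" by (rule inj[OF p])
    have l: "linear (frechet_derivative (rep c d f) (at p))"
      using smooth_onD(1)[OF sm p] has_derivative_linear by blast
    fix u v
    have "second_ff (g_FS d) (rep c d f) p u v = 0" using geod c d p by (auto simp: totally_geodesic_def)
    then show "cov_deriv_along (g_FS d) (rep c d f) p u v \<in> range (frechet_derivative (rep c d f) (at p))"
      using inner_form.normal_part(2)[OF inner_form_FS l i, of "cov_deriv_along (g_FS d) (rep c d f) p u v" "rep c d f p"]
      by (simp add: second_ff_def)
  qed auto
  then show ?thesis using that[of "ball q r" i lin pr] r c d by (auto simp: patch_of_def)
qed

lemma rep_dom_inv:
  assumes c: "c \<in> A" and q: "q \<in> rep_dom c d f"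
  shows "chart_inv c q \<in> fst c" "f (chart_inv c q) \<in> fst d" "snd c (chart_inv c q) = q"
proof -
  obtain y where y: "y \<in> fst c" "f y \<in> fst d" "q = snd c y" using q by (auto simp: rep_dom_def)
  then have "chart_inv c q = y" unfolding chart_inv_def using chart(4)[OF c] by (simp add: inv_into_f_f)
  then show "chart_inv c q \<in> fst c" "f (chart_inv c q) \<in> fst d" "snd c (chart_inv c q) = q" using y by auto
qed

lemma point_in_patch:
  assumes x: "x \<in> topspace M"
  obtains c d i lin pr B q where "patch_of c d i lin pr B" "q \<in> B" "x = chart_inv c q"
proof -
  have "x \<in> (\<Union>c\<in>A. fst c)" using x M(1) unfolding smooth_manifold_def smooth_atlas_def by blast
  then obtain c where c: "c \<in> A" "x \<in> fst c" by blast
  obtain d where d: "d \<in> CP3_atlas" "f x \<in> fst d" using CP3_atlas_cover[OF f_topspace[OF x]] by blast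
  have "snd c x \<in> rep_dom c d f" using c d by (auto simp: rep_dom_def)
  then obtain B i lin pr where "snd c x \<in> B" "patch_of c d i lin pr B" by (rule patch_exists[OF c(1) d(1)])
  moreover have "x = chart_inv c (snd c x)"
    unfolding chart_inv_def using chart(4)[OF c(1)] c(2) by (simp add: inv_into_f_f)
  ultimately show ?thesis using that by blast
qed

context
  fixes c d i lin pr B assumes p: "patch_of c d i lin pr B"
begin

interpretation patch i lin pr d B "rep c d f" using p by (simp add: patch_of_def)

lemma patch_c: "c \<in> A" and patch_sub: "B \<subseteq> rep_dom c d f" using p by (auto simp: patch_of_def)

lemma f_patch: "q \<in> B \<Longrightarrow> f (chart_inv c q) = hopf (sgn (Z (rep c d f q)))"
proof -
  assume "q \<in> B"
  then have "f (chart_inv c q) \<in> fst d" using rep_dom_inv[OF patch_c] patch_sub by blast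
  then show ?thesis using chart_inv_map chart_inv_Z by (metis comp_apply rep_def)
qed

lemma f_patch_proj:
  "subspace W \<Longrightarrow> q \<in> B \<Longrightarrow> f (chart_inv c q) \<in> proj W \<longleftrightarrow> (\<exists>l. l \<noteq> 0 \<and> l *s Z (rep c d f q) \<in> W)"
  by (simp add: f_patch hopf_in_proj)

lemma patch_open: "openin M (chart_inv c ` B)"
proof -
  have "snd c ` chart_inv c ` B = B"
  proof -
    have "snd c (chart_inv c q) = q" if "q \<in> B" for q
      using rep_dom_inv(3)[OF patch_c subsetD[OF patch_sub that]] .
    then show ?thesis by (simp add: image_image)
  qed
  moreover have "chart_inv c ` B \<subseteq> fst c" using rep_dom_inv(1)[OF patch_c] patch_sub by blast
  ultimately show ?thesis using chart_image_open[OF patch_c, of "chart_inv c ` B"] U(1) by simp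
qed

lemma patch_preimage_open:
  assumes "openin M O'" shows "open {q \<in> B. chart_inv c q \<in> O'}"
proof -
  have "{q \<in> B. chart_inv c q \<in> O'} = B \<inter> snd c ` (fst c \<inter> O')"
  proof (intro equalityI subsetI)
    fix q assume q: "q \<in> {q \<in> B. chart_inv c q \<in> O'}"
    then have "q \<in> rep_dom c d f" using patch_sub by blast
    then have "q = snd c (chart_inv c q)" "chart_inv c q \<in> fst c"
      using rep_dom_inv(1,3)[OF patch_c, of q d] by auto
    then show "q \<in> B \<inter> snd c ` (fst c \<inter> O')" using q by blast
  next
    fix q assume q: "q \<in> B \<inter> snd c ` (fst c \<inter> O')"
    then obtain y where "y \<in> fst c" "y \<in> O'" "q = snd c y" by blast
    moreover from this have "chart_inv c q = y"
      unfolding chart_inv_def using chart(4)[OF patch_c] by (simp add: inv_into_f_f)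
    ultimately show "q \<in> {q \<in> B. chart_inv c q \<in> O'}" using q by simp
  qed
  moreover have "open (snd c ` (fst c \<inter> O'))"
    using chart_image_open[OF patch_c, of "fst c \<inter> O'"] chart(1)[OF patch_c] assms by blast
  ultimately show ?thesis using U(1) by auto
qed

lemma patch_framed_all:
  assumes W: "plane W" and O: "openin M O'" "f ` O' \<subseteq> proj W" and q: "q0 \<in> B" "chart_inv c q0 \<in> O'" "q1 \<in> B"
  shows "framed W q1"
proof -
  have sW: "subspace W" using W by (simp add: plane_def)
  have "framed W q0"
  proof (rule framed_if_local[OF sW plane_herm_closed[OF W] patch_preimage_open[OF O(1)]])
    show "q0 \<in> {q \<in> B. chart_inv c q \<in> O'}" using q by simp
    fix q assume "q \<in> {q \<in> B. chart_inv c q \<in> O'}"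
    then show "\<exists>l. l \<noteq> 0 \<and> l *s Z (rep c d f q) \<in> W"
      using f_patch_proj[OF sW, of q] O(2) by blast
  qed auto
  then show ?thesis by (rule plane_transport[OF W q(1,3)])
qed

lemma patch_framed_proj:
  assumes W: "plane W" and "\<And>q. q \<in> B \<Longrightarrow> framed W q"
  shows "f ` chart_inv c ` B \<subseteq> proj W"
  using assms f_patch_proj[of W] by (force simp: plane_def framed_def)

text \<open>The closeness condition of \<open>local_open\<close> is invariant under phases, since it
  only involves the normalised vector; so it descends to an open set of \<open>CP3\<close>.\<close>

lemma patch_local_open:
  assumes W: "plane W" and fr: "\<And>q. q \<in> B \<Longrightarrow> framed W q" and q: "q0 \<in> B"
  shows "\<exists>S. openin (subtopology CP3 (proj W)) S \<and> f (chart_inv c q0) \<in> S \<and> S \<subseteq> f ` topspace M"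
proof -
  have sW: "subspace W" using W by (simp add: plane_def)
  obtain l where l: "cmod l * norm (Z (rep c d f q0)) = 1" "l *s Z (rep c d f q0) \<in> W" "\<And>u. l *s P q0 u \<in> W"
    using framedE[OF sW fr[OF q]] by blast
  define p0 where "p0 = l *s Z (rep c d f q0)"
  have np0: "norm p0 = 1" using l(1) by (simp add: p0_def norm_smult)
  obtain \<delta> where \<delta>: "\<delta> > 0" "\<And>p. \<lbrakk>p \<in> W; herm p p0 \<noteq> 0; norm ((1 / herm p p0) *s p - p0) < \<delta>\<rbrakk>
    \<Longrightarrow> \<exists>q\<in>B. hopf (sgn p) = hopf (sgn (Z (rep c d f q)))"
    using local_open[OF W q fr l] unfolding p0_def by metis
  define Q where "Q p \<longleftrightarrow> herm p p0 \<noteq> 0 \<and> norm ((1 / herm p p0) *s p - p0) < \<delta>" for p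
  have Qc: "Q (e *s p) \<longleftrightarrow> Q p" if "cmod e = 1" for e p
  proof -
    have e: "e \<noteq> 0" using that by auto
    then show ?thesis by (simp add: Q_def herm_scale smult_assoc)
  qed
  define S where "S = hopf ` {p \<in> sphere 0 1. Q p}"
  have Sm: "hopf p \<in> S \<longleftrightarrow> Q p" if p1: "norm p = 1" for p
  proof
    assume "hopf p \<in> S"
    then obtain p' where p': "Q p'" "hopf p = hopf p'" by (auto simp: S_def)
    then obtain e where "cmod e = 1" "p = e *s p'" using hopf_eqD by blast
    then show "Q p" using Qc p' by simp
  qed (use p1 in \<open>auto simp: S_def\<close>)
  have hc: "continuous_on X (\<lambda>p. herm p p0)" for X
    by (intro bounded_bilinear.continuous_on[OF bounded_bilinear_herm] continuous_intros)
  have op1: "open {p. herm p p0 \<noteq> 0}"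
    using continuous_open_preimage[OF hc open_UNIV, of "- {0}"] by (simp add: vimage_def open_Compl)
  have "continuous_on {p. herm p p0 \<noteq> 0} (\<lambda>p. norm ((1 / herm p p0) *s p - p0))"
    by (intro continuous_intros bounded_bilinear.continuous_on[OF bounded_bilinear_smult] hc) auto
  from continuous_open_preimage[OF this op1, of "{..<\<delta>}"]
  have "open {p. Q p}" by (simp add: Q_def vimage_def Collect_conj_eq)
  then have "openin (top_of_set (sphere 0 1)) (sphere 0 1 \<inter> {p. Q p})" by (simp add: openin_open_Int)
  moreover have "{p \<in> sphere 0 1. hopf p \<in> S} = sphere 0 1 \<inter> {p. Q p}" using Sm by auto
  ultimately have "openin CP3 S" unfolding openin_CP3 by (auto simp: S_def)
  then have 1: "openin (subtopology CP3 (proj W)) (S \<inter> proj W)" by (auto simp: openin_subtopology)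
  have fq: "f (chart_inv c q0) = hopf p0"
  proof -
    have "l \<noteq> 0" using l(1) by auto
    then have "hopf (sgn p0) = f (chart_inv c q0)" unfolding f_patch[OF q] p0_def by (rule hopf_sgn_smult)
    moreover have "sgn p0 = p0" using np0 by (simp add: sgn_div_norm)
    ultimately show ?thesis by simp
  qed
  have "Q p0" using \<delta>(1) np0 by (simp add: Q_def herm_self)
  then have 2: "f (chart_inv c q0) \<in> S \<inter> proj W"
    unfolding fq using Sm[OF np0] l(2) np0 by (auto simp: proj_def p0_def)
  have "S \<inter> proj W \<subseteq> f ` topspace M"
  proof
    fix X assume X: "X \<in> S \<inter> proj W"
    then obtain p where pp: "p \<in> W" "norm p = 1" "X = hopf p" by (auto simp: proj_def)
    then have "Q p" using X Sm by simp
    then obtain q where q: "q \<in> B" "hopf (sgn p) = hopf (sgn (Z (rep c d f q)))"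
      using \<delta>(2)[OF pp(1)] unfolding Q_def by blast
    have "sgn p = p" using pp by (simp add: sgn_div_norm)
    then have "X = f (chart_inv c q)" using f_patch[OF q(1)] q(2) pp by simp
    moreover have "chart_inv c q \<in> topspace M"
      using rep_dom_inv(1)[OF patch_c] patch_sub q(1) chart(5)[OF patch_c] by blast
    ultimately show "X \<in> f ` topspace M" by blast
  qed
  then show ?thesis using 1 2 by blast
qed

end

text \<open>An open-closed argument. \<open>S\<close>, the points with a neighbourhood mapped into
  \<open>proj W\<close>, is open by construction. Transport of the frame shows that a patch meeting
  \<open>S\<close> lies in \<open>S\<close>, so the complement is open as well.\<close>

lemma surface_in_plane:
  assumes W: "plane W" and p: "patch_of c d i lin pr B" and q: "q0 \<in> B"
    and f0: "patch.framed i lin (rep c d f) W q0"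
  shows "f ` topspace M \<subseteq> proj W"
    and "\<And>c d i lin pr B q. patch_of c d i lin pr B \<Longrightarrow> q \<in> B \<Longrightarrow> patch.framed i lin (rep c d f) W q"
    and "openin (subtopology CP3 (proj W)) (f ` topspace M)"
proof -
  have sW: "subspace W" using W by (simp add: plane_def)
  define S where "S = {x. \<exists>O'. openin M O' \<and> x \<in> O' \<and> f ` O' \<subseteq> proj W}"
  have S1: "openin M S" by (subst openin_subopen) (auto simp: S_def)
  have key: "patch.framed i lin (rep c d f) W q"
    if p: "patch_of c d i lin pr B" and y: "q0 \<in> B" "chart_inv c q0 \<in> S" and q: "q \<in> B" for c d i lin pr B q0 q
    using y(2) patch_framed_all[OF p W _ _ y(1) _ q] unfolding S_def by blast
  have inS: "chart_inv c q \<in> S"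
    if p: "patch_of c d i lin pr B" and fr: "\<And>q. q \<in> B \<Longrightarrow> patch.framed i lin (rep c d f) W q" and q: "q \<in> B"
    for c d i lin pr B q
    using patch_open[OF p] patch_framed_proj[OF p W fr] q unfolding S_def by blast
  have S2: "openin M (topspace M - S)"
  proof (subst openin_subopen, intro ballI)
    fix x assume x: "x \<in> topspace M - S"
    then obtain c d i lin pr B q where p: "patch_of c d i lin pr B" and q: "q \<in> B" "x = chart_inv c q"
      using point_in_patch[of x] by blast
    have "chart_inv c ` B \<inter> S = {}"
    proof (rule ccontr)
      assume "chart_inv c ` B \<inter> S \<noteq> {}"
      then obtain q' where "q' \<in> B" "chart_inv c q' \<in> S" by blast
      then have "chart_inv c q \<in> S" using inS[OF p key[OF p, of q'] q(1)] by blast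
      then show False using x q by simp
    qed
    then show "\<exists>T. openin M T \<and> x \<in> T \<and> T \<subseteq> topspace M - S"
      using patch_open[OF p] q openin_subset[OF patch_open[OF p]] by (intro exI[of _ "chart_inv c ` B"]) auto
  qed
  have "S \<noteq> {}"
  proof -
    interpret patch i lin pr d B "rep c d f" using p by (simp add: patch_of_def)
    have "framed W q" if "q \<in> B" for q by (rule plane_transport[OF W q that f0])
    then show ?thesis using inS[OF p _ q] by blast
  qed
  moreover have "closedin M S" using S1 S2 openin_subset by (auto simp: closedin_def)
  ultimately have S: "S = topspace M" using M(2) S1 by (auto simp: connected_space_clopen_in)
  show fr: "patch.framed i lin (rep c d f) W q" if p: "patch_of c d i lin pr B" and q: "q \<in> B" for c d i lin pr B q
  proof (rule key[OF p q _ q])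
    show "chart_inv c q \<in> S" using openin_subset[OF patch_open[OF p]] q S by blast
  qed
  show "f ` topspace M \<subseteq> proj W" using S unfolding S_def by blast
  show "openin (subtopology CP3 (proj W)) (f ` topspace M)"
  proof (subst openin_subopen, intro ballI)
    fix X assume "X \<in> f ` topspace M"
    then obtain x where x: "x \<in> topspace M" "X = f x" by blast
    obtain c d i lin pr B q where p: "patch_of c d i lin pr B" and q: "q \<in> B" "x = chart_inv c q"
      using point_in_patch[OF x(1)] by blast
    show "\<exists>T. openin (subtopology CP3 (proj W)) T \<and> X \<in> T \<and> T \<subseteq> f ` topspace M"
      using patch_local_open[OF p W fr[OF p] q(1)] x q by blast
  qed
qed

end

section \<open>Normal forms of planes\<close>

lemma complex_plane_expand:
  assumes W: "subspace W" "complex_closed W" "dim W \<le> 4" and "p \<in> W" "X \<in> W"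
    and n: "norm p = 1" "norm X = 1" "herm X p = 0" and v: "v \<in> W"
  shows "v = herm v p *s p + herm v X *s X"
proof -
  define S where "S = {v \<in> W. herm v p = 0}"
  define S' where "S' = {v \<in> S. herm v X = 0}"
  have S: "subspace S" unfolding S_def by (rule complement_subspace[OF W(1)])
  have cS: "complex_closed S" using W(2) by (auto simp: S_def complex_closed_def herm_scale)
  have XS: "X \<in> S" using assms by (simp add: S_def)
  have nz: "p \<noteq> 0" "X \<noteq> 0" using n by auto
  have "dim S \<le> 2" using complex_complement_dim[OF W(1,2) assms(4) nz(1)] W(3) by (simp add: S_def)
  then have "dim S' = 0" using complex_complement_dim[OF S cS XS nz(2)] unfolding S'_def by linarith
  then have S0: "S' \<subseteq> {0}" by (simp add: dim_eq_0)
  define r where "r = v - herm v p *s p - herm v X *s X"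
  have rW: "r \<in> W" unfolding r_def
    by (intro subspace_diff W(1) v complex_closedD[OF W(1,2)] assms)
  have "herm p X = 0" using n(3) cnj_herm[of X p] by simp
  then have "herm r p = 0" "herm r X = 0"
    using n by (simp_all add: r_def herm_diff herm_scale herm_self)
  then have "r = 0" using S0 rW by (auto simp: S'_def S_def)
  then show ?thesis unfolding r_def by (simp only: diff_diff_eq right_minus_eq)
qed

lemma isotropic_smult: "isotropic W \<Longrightarrow> v \<in> W \<Longrightarrow> w \<in> W \<Longrightarrow> herm v w *s (x::complex^4) = Re (herm v w) *\<^sub>R x"
  by (subst smult_Re_Im) (simp add: isotropic_def)

lemma isotropic_plane_expand:
  assumes W: "subspace W" "isotropic W" "dim W \<le> 3" and m: "p \<in> W" "X \<in> W" "Y \<in> W"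
    and n: "norm p = 1" "norm X = 1" "norm Y = 1" "herm X p = 0" "herm Y p = 0" "herm Y X = 0"
  shows "v \<in> W \<Longrightarrow> v = herm v p *s p + herm v X *s X + herm v Y *s Y" and "dim W = 3"
proof -
  define S where "S = {v \<in> W. herm v p = 0}"
  define S' where "S' = {v \<in> S. herm v X = 0}"
  define S'' where "S'' = {v \<in> S'. herm v Y = 0}"
  have S: "subspace S" unfolding S_def by (rule complement_subspace[OF W(1)])
  have S': "subspace S'" unfolding S'_def by (rule complement_subspace[OF S])
  have iS: "isotropic S" "isotropic S'" using W(2) by (auto simp: S_def S'_def isotropic_def)
  have XS: "X \<in> S" "Y \<in> S'" using assms by (simp_all add: S_def S'_def)
  have nz: "p \<noteq> 0" "X \<noteq> 0" "Y \<noteq> 0" using n by auto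
  have d: "dim S + 1 = dim W" "dim S' + 1 = dim S" "dim S'' + 1 = dim S'"
    unfolding S_def S'_def S''_def
    using isotropic_complement_dim[OF W(1,2) m(1) nz(1)] isotropic_complement_dim[OF S iS(1) XS(1) nz(2)]
      isotropic_complement_dim[OF S' iS(2) XS(2) nz(3)] by (simp_all add: S_def S'_def)
  then show "dim W = 3" using W(3) by simp
  have "dim S'' = 0" using d W(3) by linarith
  then have S0: "S'' \<subseteq> {0}" by (simp add: dim_eq_0)
  assume v: "v \<in> W"
  define r where "r = v - herm v p *s p - herm v X *s X - herm v Y *s Y"
  have rW: "r \<in> W" unfolding r_def isotropic_smult[OF W(2) v m(1)] isotropic_smult[OF W(2) v m(2)]
      isotropic_smult[OF W(2) v m(3)]
    by (intro subspace_diff subspace_scale W(1) v m)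
  have "herm p X = 0" "herm p Y = 0" "herm X Y = 0"
    using n cnj_herm[of X p] cnj_herm[of Y p] cnj_herm[of Y X] by simp_all
  then have "herm r p = 0" "herm r X = 0" "herm r Y = 0"
    using n by (simp_all add: r_def herm_diff herm_scale herm_self)
  then have "r = 0" using S0 rW by (auto simp: S''_def S'_def S_def)
  then show "v = herm v p *s p + herm v X *s X + herm v Y *s Y" unfolding r_def by (simp only: diff_diff_eq right_minus_eq add.assoc)
qed

text \<open>The congruence is induced by the inverse of \<open>A\<close>. The phase \<open>e\<close>
  acts trivially on fibres, which is what allows normal forms up to a phase although multiplication
  by \<open>e\<close> need not commute with \<open>jmul\<close>.\<close>

lemma qunitary_congruent:
  assumes A: "qunitary A" and e: "cmod e = 1" and W: "W = (\<lambda>w. e *s A w) ` W0"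
    and S: "S \<subseteq> proj W" "openin (subtopology CP3 (proj W)) S"
  shows "congruent_to_open_part CP3 CP3_atlas g_NK S (proj W0)"
proof -
  obtain B where B: "qunitary B" and AB: "\<And>v. A (B v) = v" and BA: "\<And>v. B (A v) = v"
    using qunitary_inverse[OF A] by blast
  let ?\<phi> = "\<lambda>X. B ` X"
  have \<phi>: "?\<phi> (hopf p) = hopf (B p)" for p by (rule qunitary_isometry(2)[OF B])
  have \<psi>: "A ` hopf p = hopf (A p)" for p by (rule qunitary_isometry(2)[OF A])
  have inv: "A ` ?\<phi> X = X" "?\<phi> (A ` X) = X" for X using AB BA by (simp_all add: image_image)
  have \<phi>W: "?\<phi> X \<in> proj W0" if X: "X \<in> proj W" for X
  proof -
    obtain w where w: "w \<in> W0" "norm (e *s A w) = 1" "X = hopf (e *s A w)"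
      using X by (auto simp: proj_def W)
    then have "norm w = 1" using e by (simp add: norm_smult qunitary_norm[OF A])
    moreover have "?\<phi> X = hopf w" using w(3) e by (simp add: \<phi> qunitary_smult[OF B] BA hopf_phase)
    ultimately show ?thesis using w by (auto simp: proj_def)
  qed
  have \<psi>W: "A ` X \<in> proj W" if X: "X \<in> proj W0" for X
  proof -
    obtain w where w: "w \<in> W0" "norm w = 1" "X = hopf w" using X by (auto simp: proj_def)
    then have "A ` X = hopf (e *s A w)" using e by (simp add: \<psi> hopf_phase)
    moreover have "norm (e *s A w) = 1" using w e by (simp add: norm_smult qunitary_norm[OF A])
    ultimately show ?thesis using w by (auto simp: proj_def W)
  qed
  obtain O' where O': "openin CP3 O'" "S = O' \<inter> proj W" using S(2) by (auto simp: openin_subtopology)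
  have "continuous_map CP3 CP3 (\<lambda>X. A ` X)" by (rule qunitary_continuous_map[OF A \<psi>])
  then have "openin CP3 {X \<in> topspace CP3. A ` X \<in> O'}" using O'(1) by (simp add: continuous_map)
  moreover have "?\<phi> ` S = {X \<in> topspace CP3. A ` X \<in> O'} \<inter> proj W0"
  proof (intro equalityI subsetI)
    fix Y assume "Y \<in> ?\<phi> ` S"
    then obtain X where X: "X \<in> S" "Y = ?\<phi> X" by blast
    then have "Y \<in> proj W0" using \<phi>W S(1) by blast
    moreover from this have "Y \<in> topspace CP3" by (auto simp: proj_def topspace_CP3)
    ultimately show "Y \<in> {X \<in> topspace CP3. A ` X \<in> O'} \<inter> proj W0" using X O'(2) inv by simp
  next
    fix Y assume Y: "Y \<in> {X \<in> topspace CP3. A ` X \<in> O'} \<inter> proj W0"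
    then have "A ` Y \<in> S" using \<psi>W O'(2) by blast
    then show "Y \<in> ?\<phi> ` S" using inv(2) by (metis imageI)
  qed
  ultimately have "openin (subtopology CP3 (proj W0)) (?\<phi> ` S)" by (auto simp: openin_subtopology)
  moreover have "?\<phi> ` S \<subseteq> proj W0" using \<phi>W S(1) by blast
  ultimately show ?thesis unfolding congruent_to_open_part_def
    using qunitary_isometry(1)[OF B] by blast
qed

text \<open>The complex plane over the first model: \<open>a\<close> and \<open>b\<close> replace
  \<open>cos u\<close> and the product of \<open>sin u\<close> with the exponential of
  \<open>\<i> * v\<close>.\<close>

definition line0 :: "(complex^4) set" where
  "line0 = {vector [a, of_real (sqrt 2 / sqrt 3) * \<i> * b, 0, of_real (1 / sqrt 3) * b] | a b. True}"

definition plane0 :: "(complex^4) set" where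
  "plane0 = {vector [of_real a, of_real b, of_real c, 0] | a b c. True}"

lemma norm_vector_4: "(norm (vector [a, b, c, d] :: complex^4))\<^sup>2 = (cmod a)\<^sup>2 + (cmod b)\<^sup>2 + (cmod c)\<^sup>2 + (cmod d)\<^sup>2"
proof -
  have "of_real ((norm (vector [a, b, c, d] :: complex^4))\<^sup>2) =
      (of_real ((cmod a)\<^sup>2 + (cmod b)\<^sup>2 + (cmod c)\<^sup>2 + (cmod d)\<^sup>2) :: complex)"
    by (simp only: herm_self[symmetric] herm_def sum_4 vector_4 of_real_add complex_norm_square)
  then show ?thesis using of_real_eq_iff by blast
qed

lemma norm_line0:
  "(norm (vector [a, of_real (sqrt 2 / sqrt 3) * \<i> * b, 0, of_real (1 / sqrt 3) * b] :: complex^4))\<^sup>2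
    = (cmod a)\<^sup>2 + (cmod b)\<^sup>2"
  unfolding norm_vector_4 by (simp add: norm_mult norm_divide power_mult_distrib power_divide)

lemma model_CP1_eq: "model_CP1 = proj line0"
proof (intro equalityI subsetI)
  fix X assume "X \<in> model_CP1"
  then obtain u v where X: "X = hopf (vector [of_real (cos u),
      of_real (sqrt 2 / sqrt 3) * \<i> * exp (\<i> * of_real v) * of_real (sin u), 0,
      of_real (1 / sqrt 3) * exp (\<i> * of_real v) * of_real (sin u)])"
    by (auto simp: model_CP1_def)
  define b where "b = exp (\<i> * of_real v) * complex_of_real (sin u)"
  define w :: "complex^4" where "w = vector [of_real (cos u), of_real (sqrt 2 / sqrt 3) * \<i> * b, 0, of_real (1 / sqrt 3) * b]"
  have "(norm w)\<^sup>2 = (cos u)\<^sup>2 + (sin u)\<^sup>2"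
    unfolding w_def norm_line0 by (simp add: b_def norm_mult)
  then have "norm w = 1" using power2_eq_imp_eq[of "norm w" 1] by simp
  moreover have "w \<in> line0" unfolding line0_def w_def by blast
  moreover have "X = hopf w" unfolding X w_def b_def by (simp add: mult.assoc)
  ultimately show "X \<in> proj line0" by (auto simp: proj_def)
next
  fix X assume "X \<in> proj line0"
  then obtain a b where n: "norm (vector [a, of_real (sqrt 2 / sqrt 3) * \<i> * b, 0, of_real (1 / sqrt 3) * b] :: complex^4) = 1"
    and X: "X = hopf (vector [a, of_real (sqrt 2 / sqrt 3) * \<i> * b, 0, of_real (1 / sqrt 3) * b])"
    by (auto simp: proj_def line0_def)
  have ab: "(cmod a)\<^sup>2 + (cmod b)\<^sup>2 = 1" using norm_line0[of a b] n by simp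
  \<comment> \<open>Multiplying by this phase makes the first coordinate real and nonnegative, hence
    a cosine; the angle \<open>v\<close> is then the argument of \<open>e * b\<close>.\<close>
  define e where "e = (if a = 0 then 1 else cnj a / of_real (cmod a))"
  have e: "cmod e = 1" by (simp add: e_def norm_divide)
  have ea: "e * a = of_real (cmod a)"
    by (simp add: e_def mult.commute[of "cnj a"] complex_norm_square[symmetric] power2_eq_square)
  define u where "u = arccos (cmod a)"
  have a1: "cmod a \<le> 1" using ab by (smt (verit) norm_ge_zero one_le_power power2_le_imp_le zero_le_power2 power_one)
  have a0: "- 1 \<le> cmod a" using norm_ge_zero[of a] by linarith
  have u: "u \<in> {0..pi}" "cos u = cmod a" using arccos_bounded[OF a0 a1] cos_arccos[OF a0 a1] by (auto simp: u_def)
  have su: "sin u = cmod b"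
  proof -
    have "(sin u)\<^sup>2 = (cmod b)\<^sup>2" using ab sin_cos_squared_add[of u] u(2) by simp
    moreover have "sin u \<ge> 0" using u(1) by (simp add: sin_ge_zero)
    ultimately show ?thesis by (simp add: power2_eq_iff_nonneg)
  qed
  define v where "v = Arg2pi (e * b)"
  have v: "v \<in> {0..2 * pi}" using Arg2pi_ge_0[of "e * b"] Arg2pi_lt_2pi[of "e * b"] by (simp add: v_def)
  have eb: "e * b = exp (\<i> * of_real v) * of_real (sin u)"
  proof -
    have "e * b = of_real (cmod (e * b)) * exp (\<i> * of_real (Arg2pi (e * b)))" by (rule Arg2pi_eq)
    then show ?thesis using e by (simp add: v_def su norm_mult mult.commute)
  qed
  have "X = hopf (e *s vector [a, of_real (sqrt 2 / sqrt 3) * \<i> * b, 0, of_real (1 / sqrt 3) * b])"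
    unfolding X using hopf_phase[OF e] by simp
  also have "e *s vector [a, of_real (sqrt 2 / sqrt 3) * \<i> * b, 0, of_real (1 / sqrt 3) * b]
    = (vector [e * a, of_real (sqrt 2 / sqrt 3) * \<i> * (e * b), 0, of_real (1 / sqrt 3) * (e * b)] :: complex^4)"
    by (simp add: vec_eq_iff forall_4)
  finally have "X = hopf (vector [of_real (cos u),
      of_real (sqrt 2 / sqrt 3) * \<i> * exp (\<i> * of_real v) * of_real (sin u), 0,
      of_real (1 / sqrt 3) * exp (\<i> * of_real v) * of_real (sin u)])"
    unfolding ea eb u(2)[symmetric] mult.assoc .
  then show "X \<in> model_CP1" using u(1) v by (auto simp: model_CP1_def)
qed

lemma model_RP2_eq: "model_RP2 0 = proj plane0"
proof -
  have n: "norm (vector [of_real (y $ 1), of_real (y $ 2), of_real (y $ 3), 0] :: complex^4) = norm y" for y :: "real^3"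
  proof -
    have "(norm (vector [of_real (y $ 1), of_real (y $ 2), of_real (y $ 3), 0] :: complex^4))\<^sup>2 = (norm y)\<^sup>2"
      unfolding norm_vector_4 power2_norm_eq_inner[of y] by (simp add: inner_vec_def sum_3 power2_eq_square)
    then show ?thesis by simp
  qed
  show ?thesis
  proof (intro equalityI subsetI)
    fix X assume "X \<in> model_RP2 0"
    then obtain y :: "real^3" where "norm y = 1" "X = hopf (vector [of_real (y $ 1), of_real (y $ 2), of_real (y $ 3), 0])"
      by (auto simp: model_RP2_def)
    moreover have "vector [of_real (y $ 1), of_real (y $ 2), of_real (y $ 3), 0] \<in> plane0"
      unfolding plane0_def by blast
    ultimately show "X \<in> proj plane0" using n[of y] unfolding proj_def by auto
  next
    fix X assume "X \<in> proj plane0"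
    then obtain a b c where 1: "norm (vector [of_real a, of_real b, of_real c, 0] :: complex^4) = 1"
      "X = hopf (vector [of_real a, of_real b, of_real c, 0])"
      by (auto simp: proj_def plane0_def)
    define y :: "real^3" where "y = vector [a, b, c]"
    have "norm y = 1" using n[of y] 1 by (simp add: y_def)
    then show "X \<in> model_RP2 0" unfolding model_RP2_def using 1(2)
      by (auto intro!: exI[of _ y] simp: y_def)
  qed
qed

text \<open>Split the second unit vector into its part along \<open>jmul p\<close>, of squared
  length 2/3, and a remainder \<open>Y\<close> of squared length 1/3. The normalised remainder
  serves as the fourth vector of a quaternionic frame, which explains the coefficients in
  \<open>line0\<close>.\<close>

lemma complex_normal_form:
  assumes W: "subspace W" "complex_closed W" "dim W \<le> 4" and m: "p \<in> W" "X \<in> W"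
    and n: "norm p = 1" "norm X = 1" "herm X p = 0" and o: "(cmod (om p X))\<^sup>2 = 2 / 3"
  obtains A where "qunitary A" "W = (\<lambda>w. 1 *s A w) ` line0"
proof -
  define s :: complex where "s = of_real (sqrt 2 / sqrt 3) * \<i>"
  have s2: "s * cnj s = 2 / 3"
  proof -
    have "cmod s = sqrt 2 / sqrt 3" by (simp add: s_def norm_mult norm_divide)
    then have s: "(cmod s)\<^sup>2 = 2 / 3" by (simp add: power_divide)
    show ?thesis unfolding complex_norm_square[symmetric] s by simp
  qed
  have s0: "cmod s = cmod (om p X)"
  proof -
    have "(cmod s)\<^sup>2 = (cmod (om p X))\<^sup>2" unfolding o
      using s2 by (metis complex_norm_square of_real_divide of_real_eq_iff of_real_numeral)
    then show ?thesis by simp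
  qed
  have o0: "om p X \<noteq> 0" using o by auto
  \<comment> \<open>A phase adjusting \<open>om p X\<close> from a number of the right modulus to
    the exact coefficient \<open>s\<close> of \<open>line0\<close>.\<close>
  define e where "e = s / om p X"
  have e: "cmod e = 1" "e \<noteq> 0" using o0 s0 by (auto simp: e_def norm_divide)
  define X' where "X' = e *s X"
  have X': "norm X' = 1" "herm X' p = 0" "om p X' = s" "X' \<in> W"
    using n e o0 complex_closedD[OF W(1,2) m(2)] by (simp_all add: X'_def norm_smult herm_scale om_scale e_def)
  have pX': "herm p X' = 0" using X'(2) cnj_herm[of X' p] by simp
  define Y where "Y = X' - s *s jmul p"
  have Yj: "herm Y (jmul p) = 0"
    unfolding Y_def herm_diff herm_scale herm_jmul herm_jmul_right[of X'] om_swap[of X'] herm_self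
    using X' n by simp
  have Yp: "herm Y p = 0" using X' by (simp add: Y_def herm_diff herm_scale herm_jmul_left)
  have YY: "herm Y Y = 1 / 3"
  proof -
    have "herm Y Y = herm Y X'" using Yj by (simp add: Y_def herm_diff herm_scale)
    also have "\<dots> = 1 - s * cnj s"
      using X' by (simp add: Y_def herm_diff herm_scale herm_self herm_jmul_left om_swap[of X' p])
    finally show ?thesis using s2 by simp
  qed
  \<comment> \<open>Chosen so that \<open>jmul r\<close> is the unit vector \<open>sqrt 3\<close>
    times \<open>Y\<close>, because \<open>line0\<close> uses the fourth coordinate.\<close>
  define r where "r = - jmul (of_real (sqrt 3) *s Y)"
  have jr: "jmul r = of_real (sqrt 3) *s Y" by (simp add: r_def jmul_minus)
  have "herm r r = 1"
  proof -
    have "herm r r = of_real (sqrt 3 * sqrt 3) * herm Y Y"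
      by (simp only: r_def herm_minus herm_jmul herm_scale complex_cnj_complex_of_real of_real_mult minus_minus mult.assoc)
    then show ?thesis by (simp add: YY)
  qed
  then have "(norm r)\<^sup>2 = 1" unfolding herm_self using of_real_eq_1_iff by blast
  then have nr: "norm r = 1" using power2_eq_imp_eq[of "norm r" 1] by simp
  have pr: "herm p r = 0"
    using Yj by (simp add: r_def herm_minus jmul_smult herm_scale herm_jmul_right om_swap[of p])
  have opr: "om p r = 0"
  proof -
    have "herm p Y = 0" using Yp cnj_herm[of Y p] by simp
    then show ?thesis by (simp add: r_def om_minus om_jmul herm_scale)
  qed
  obtain A where A: "qunitary A" "\<And>v. A v = v $ 1 *s p + v $ 2 *s jmul p + v $ 3 *s r + v $ 4 *s jmul r"
    using qunitary_exists[OF n(1) nr pr opr] by blast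
  have AX: "A (vector [a, of_real (sqrt 2 / sqrt 3) * \<i> * b, 0, of_real (1 / sqrt 3) * b]) = a *s p + b *s X'" for a b
  proof -
    have "X' = s *s jmul p + Y" by (simp add: Y_def)
    moreover have "(of_real (1 / sqrt 3) * b) *s jmul r = b *s Y" unfolding jr by (simp add: smult_assoc)
    ultimately show ?thesis unfolding A(2) vector_4 by (simp add: s_def vec_eq_iff algebra_simps)
  qed
  have "W = A ` line0"
  proof (intro equalityI subsetI)
    fix v assume "v \<in> W"
    then have "v = herm v p *s p + herm v X' *s X'"
      by (rule complex_plane_expand[OF W m(1) X'(4) n(1) X'(1,2)])
    then have "v = A (vector [herm v p, of_real (sqrt 2 / sqrt 3) * \<i> * herm v X', 0, of_real (1 / sqrt 3) * herm v X'])"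
      unfolding AX .
    then show "v \<in> A ` line0" unfolding line0_def by blast
  next
    fix v assume "v \<in> A ` line0"
    then obtain a b where "v = a *s p + b *s X'" unfolding line0_def using AX by auto
    then show "v \<in> W" by (simp add: subspace_add[OF W(1)] complex_closedD[OF W(1,2)] m X')
  qed
  then show ?thesis using that[OF A(1)] by simp
qed

text \<open>The three numbers are the entries of a skew form on a real space of dimension 3. The
  hypotheses make them real after multiplication by one phase direction \<open>cnj e\<close>, and a
  real skew form in dimension 3 is a cross product with \<open>(r23, - r13, r12)\<close>, which
  therefore lies in its kernel.\<close>

lemma real_kernel:
  fixes c12 c13 c23 :: complex
  assumes "Im (c12 * cnj c13) = 0" "Im (c12 * cnj c23) = 0" "Im (c13 * cnj c23) = 0"
  obtains x y z :: real where "x \<noteq> 0 \<or> y \<noteq> 0 \<or> z \<noteq> 0"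
    "y * c12 + z * c13 = 0" "z * c23 - x * c12 = 0" "x * c13 + y * c23 = 0"
proof (cases "c12 = 0 \<and> c13 = 0 \<and> c23 = 0")
  case True
  then show ?thesis using that[of 1 0 0] by simp
next
  case False
  then obtain e where e: "e \<noteq> 0" "e = c12 \<or> e = c13 \<or> e = c23" by blast
  have sw: "Im (b * cnj a) = - Im (a * cnj b)" for a b :: complex by simp
  have self: "Im (a * cnj a) = 0" for a by simp
  have im: "Im (c12 * cnj e) = 0 \<and> Im (c13 * cnj e) = 0 \<and> Im (c23 * cnj e) = 0"
    using e(2) assms self[of c12] self[of c13] self[of c23]
      sw[of c13 c12] sw[of c23 c12] sw[of c23 c13] by (elim disjE) (simp_all only: simp_thms minus_zero)
  have real: "c * cnj e = of_real (Re (c * cnj e))" if "Im (c * cnj e) = 0" for c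
    using that by (simp only: complex_eq_iff Re_complex_of_real Im_complex_of_real simp_thms)
  define r12 r13 r23 where "r12 = Re (c12 * cnj e)" and "r13 = Re (c13 * cnj e)" and "r23 = Re (c23 * cnj e)"
  have r: "c12 * cnj e = of_real r12" "c13 * cnj e = of_real r13" "c23 * cnj e = of_real r23"
    unfolding r12_def r13_def r23_def using im by (blast intro: real)+
  have ce: "cnj e \<noteq> 0" using e by simp
  have z: "a = 0" if "a * cnj e = 0" for a using that ce by simp
  show ?thesis
  proof (rule that[of r23 "- r13" r12])
    show "r23 \<noteq> 0 \<or> - r13 \<noteq> 0 \<or> r12 \<noteq> 0"
    proof (rule ccontr)
      assume "\<not> (r23 \<noteq> 0 \<or> - r13 \<noteq> 0 \<or> r12 \<noteq> 0)"
      then have "c12 * cnj e = 0" "c13 * cnj e = 0" "c23 * cnj e = 0" unfolding r by simp_all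
      then have "c12 = 0" "c13 = 0" "c23 = 0" using z by blast+
      then show False using False by simp
    qed
    have lin: "of_real s * a + of_real t * b = 0"
      if "a * cnj e = of_real a'" "b * cnj e = of_real b'" "s * a' + t * b' = 0" for a b :: complex and a' b' s t :: real
    proof (rule z)
      have "(of_real s * a + of_real t * b) * cnj e = of_real s * (a * cnj e) + of_real t * (b * cnj e)"
        by (simp only: distrib_right mult.assoc)
      also have "\<dots> = of_real (s * a' + t * b')" unfolding that(1,2) by simp
      finally show "(of_real s * a + of_real t * b) * cnj e = 0" unfolding that(3) by simp
    qed
    show "of_real (- r13) * c12 + of_real r12 * c13 = 0" by (rule lin[OF r(1,2)]) simp
    show "of_real r12 * c23 - of_real r23 * c12 = 0" using lin[OF r(3,1), of r12 "- r23"] by simp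
    show "of_real r23 * c13 + of_real (- r13) * c23 = 0" by (rule lin[OF r(2,3)]) simp
  qed
qed

text \<open>A unit vector \<open>u3\<close> of \<open>W\<close> in the kernel of \<open>om\<close>
  and an orthonormal basis \<open>u1\<close>, \<open>u2\<close> of its complement in
  \<open>W\<close> give a quaternionic frame: the kernel condition forces \<open>jmul u1\<close> to
  be a phase times \<open>u2\<close>.\<close>

lemma real_normal_form:
  assumes W: "subspace W" "isotropic W" "dim W \<le> 3" and m: "p \<in> W" "X \<in> W" "Y \<in> W"
    and n: "norm p = 1" "norm X = 1" "norm Y = 1" "herm X p = 0" "herm Y p = 0" "herm Y X = 0"
    and o: "Im (om p X * cnj (om p Y)) = 0" "Im (om p X * cnj (om X Y)) = 0" "Im (om p Y * cnj (om X Y)) = 0"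
  obtains A e where "qunitary A" "cmod e = 1" "W = (\<lambda>w. e *s A w) ` plane0"
proof -
  obtain x y z :: real where xyz: "x \<noteq> 0 \<or> y \<noteq> 0 \<or> z \<noteq> 0"
    "y * om p X + z * om p Y = 0" "z * om X Y - x * om p X = 0" "x * om p Y + y * om X Y = 0"
    using real_kernel[OF o] by metis
  define k where "k = x *\<^sub>R p + y *\<^sub>R X + z *\<^sub>R Y"
  have hs: "herm p X = 0" "herm p Y = 0" "herm X Y = 0"
    using n cnj_herm[of X p] cnj_herm[of Y p] cnj_herm[of Y X] by simp_all
  have "herm k p = x" "herm k X = y" "herm k Y = z"
    using n hs by (simp_all add: k_def herm_add herm_scaleR herm_self)
  then have k0: "k \<noteq> 0" using xyz(1) by auto
  have kW: "k \<in> W" unfolding k_def by (intro subspace_add subspace_scale W(1) m)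
  have kp: "om p k = 0" "om X k = 0" "om Y k = 0"
  proof -
    show "om p k = 0" using xyz(2) by (simp add: k_def om_add om_scaleR)
    show "om X k = 0" using xyz(3) by (simp add: k_def om_add om_scaleR om_swap[of X p])
    have "om Y k = - (x * om p Y + y * om X Y)"
      by (simp add: k_def om_add om_scaleR om_swap[of Y p] om_swap[of Y X])
    then show "om Y k = 0" using xyz(4) by simp
  qed
  have ok: "om w k = 0" if "w \<in> W" for w
    by (subst isotropic_plane_expand(1)[OF W m n that]) (simp add: om_add om_scale kp)
  define u3 where "u3 = sgn k"
  have u3: "u3 \<in> W" "norm u3 = 1" "u3 \<noteq> 0"
    using sgn_scaleR_mem[OF W(1) kW] k0 by (auto simp: u3_def norm_sgn sgn_zero_iff)
  have o3: "om w u3 = 0" if "w \<in> W" for w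
    using ok[OF that] by (simp add: u3_def vec_sgn_smult om_scale)
  define S where "S = {v \<in> W. herm v u3 = 0}"
  have S: "subspace S" unfolding S_def by (rule complement_subspace[OF W(1)])
  have "dim S = 2" using isotropic_complement_dim[OF W(1,2) u3(1,3)] isotropic_plane_expand(2)[OF W m n]
    by (simp add: S_def)
  then obtain Bs where Bs: "Bs \<subseteq> S" "pairwise orthogonal Bs" "\<And>x. x \<in> Bs \<Longrightarrow> norm x = 1" "card Bs = 2"
    using orthonormal_basis_subspace[OF S] by metis
  then obtain u1 u2 where u12: "Bs = {u1, u2}" "u1 \<noteq> u2" by (auto simp: card_2_iff)
  have u: "u1 \<in> W" "u2 \<in> W" "herm u1 u3 = 0" "herm u2 u3 = 0" "norm u1 = 1" "norm u2 = 1"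
    using Bs u12 by (auto simp: S_def)
  have "orthogonal u2 u1" using Bs(2) u12 by (auto simp: pairwise_def)
  then have h21: "herm u2 u1 = 0" using W(2) u by (simp add: isotropic_def orthogonal_def complex_eq_iff Re_herm)
  have hs: "herm u1 u2 = 0" "herm u3 u1 = 0" "herm u3 u2 = 0"
    using h21 u cnj_herm[of u2 u1] cnj_herm[of u1 u3] cnj_herm[of u2 u3] by simp_all
  define b where "b = herm (jmul u1) u2"
  \<comment> \<open>The kernel condition says that \<open>jmul u3\<close> is orthogonal to
    \<open>W\<close>, so it completes \<open>u1\<close>, \<open>u2\<close>, \<open>u3\<close> to an
    orthonormal basis; only the \<open>u2\<close> coefficient will survive.\<close>
  have jx: "jmul u1 = herm (jmul u1) u1 *s u1 + herm (jmul u1) u2 *s u2 + herm (jmul u1) u3 *s u3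
      + herm (jmul u1) (jmul u3) *s jmul u3"
    by (rule herm_orthonormal_expansion4)
       (use u u3 hs o3 in \<open>simp_all add: herm_jmul_right\<close>)
  have ju1: "jmul u1 = b *s u2"
  proof -
    have "herm (jmul u1) u1 = 0" "herm (jmul u1) u3 = 0"
      using hs o3[OF u(1)] by (simp_all add: herm_jmul_left om_swap[of u3 u1])
    moreover have "herm (jmul u1) (jmul u3) = 0" unfolding herm_jmul by (rule hs)
    ultimately have "herm (jmul u1) u1 *s u1 + herm (jmul u1) u2 *s u2 + herm (jmul u1) u3 *s u3
      + herm (jmul u1) (jmul u3) *s jmul u3 = b *s u2" unfolding b_def by simp
    with jx show ?thesis by (rule trans)
  qed
  have nb: "cmod b = 1" using arg_cong[OF ju1, of norm] u by (simp add: norm_smult)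
  \<comment> \<open>A square root of \<open>b\<close>: as \<open>jmul\<close> conjugates scalars,
    \<open>jmul (e0 *s u1)\<close> is \<open>cnj e0 * b\<close> times \<open>u2\<close>, which
    equals \<open>e0 *s u2\<close>. All three vectors then carry the same phase, removed at the end
    by \<open>cnj e0\<close>.\<close>
  define e0 where "e0 = csqrt b"
  have ee: "e0 * e0 = b" unfolding e0_def by (metis power2_csqrt power2_eq_square)
  then have "(cmod e0)\<^sup>2 = 1" using nb by (metis norm_mult power2_eq_square)
  then have e0: "cmod e0 = 1" "e0 * e0 = b" using ee power2_eq_imp_eq[of "cmod e0" 1] by simp_all
  have ce: "cnj e0 * e0 = 1" "e0 * cnj e0 = 1"
    using e0(1) complex_norm_square[of e0] by (simp_all add: mult.commute)
  define a1 a3 where "a1 = e0 *s u1" and "a3 = e0 *s u3"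
  have ja1: "jmul a1 = e0 *s u2"
  proof -
    have "jmul a1 = (cnj e0 * e0 * e0) *s u2"
      by (simp add: a1_def jmul_smult ju1 smult_assoc e0(2)[symmetric] mult.assoc)
    then show ?thesis using ce by simp
  qed
  have a: "norm a1 = 1" "norm a3 = 1" "herm a1 a3 = 0" "om a1 a3 = 0"
    using u u3 e0 o3 by (simp_all add: a1_def a3_def norm_smult herm_scale om_scale)
  obtain A where A: "qunitary A" "\<And>v. A v = v $ 1 *s a1 + v $ 2 *s jmul a1 + v $ 3 *s a3 + v $ 4 *s jmul a3"
    using qunitary_exists[OF a] by blast
  have Av: "cnj e0 *s A (vector [of_real s, of_real t, of_real r, 0]) = s *\<^sub>R u1 + t *\<^sub>R u2 + r *\<^sub>R u3" for s t r :: real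
  proof -
    have "cnj e0 *s A (vector [of_real s, of_real t, of_real r, 0]) =
        (cnj e0 * e0) *s (of_real s *s u1 + of_real t *s u2 + of_real r *s u3)"
      unfolding A(2) ja1 by (simp add: a1_def a3_def vec_eq_iff algebra_simps)
    then show ?thesis by (simp add: ce scaleR_smult)
  qed
  have "W = (\<lambda>w. cnj e0 *s A w) ` plane0"
  proof (intro equalityI subsetI)
    fix v assume v: "v \<in> W"
    have "v = herm v u1 *s u1 + herm v u2 *s u2 + herm v u3 *s u3"
      by (rule isotropic_plane_expand(1)[OF W u(1,2) u3(1) u(5,6) u3(2) h21 hs(2,3) v])
    then have "v = Re (herm v u1) *\<^sub>R u1 + Re (herm v u2) *\<^sub>R u2 + Re (herm v u3) *\<^sub>R u3"
      unfolding isotropic_smult[OF W(2) v u(1)] isotropic_smult[OF W(2) v u(2)] isotropic_smult[OF W(2) v u3(1)] .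
    then have "v = cnj e0 *s A (vector [of_real (Re (herm v u1)), of_real (Re (herm v u2)), of_real (Re (herm v u3)), 0])"
      unfolding Av .
    then show "v \<in> (\<lambda>w. cnj e0 *s A w) ` plane0" unfolding plane0_def by blast
  next
    fix v assume "v \<in> (\<lambda>w. cnj e0 *s A w) ` plane0"
    then obtain s t r :: real where "v = s *\<^sub>R u1 + t *\<^sub>R u2 + r *\<^sub>R u3"
      unfolding plane0_def using Av by auto
    then show "v \<in> W" by (simp add: subspace_add[OF W(1)] subspace_scale[OF W(1)] u u3)
  qed
  then show ?thesis using that[OF A(1), of "cnj e0"] e0 by simp
qed

section \<open>Mean curvature for the nearly Kaehler metric\<close>

lemma orthonormal_expand:
  fixes e1 e2 :: "real^2" and I :: "real^2 \<Rightarrow> real^2 \<Rightarrow> real"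
  assumes "inner_form I" and e: "I e1 e1 = 1" "I e2 e2 = 1" "I e1 e2 = 0"
  shows "v = I v e1 *\<^sub>R e1 + I v e2 *\<^sub>R e2"
proof -
  interpret I: inner_form I by (rule assms(1))
  define L where "L c = c $ 1 *\<^sub>R e1 + c $ 2 *\<^sub>R e2" for c :: "real^2"
  have L: "linear L" by (rule linearI) (simp_all add: L_def algebra_simps)
  have IL: "I (L c) e1 = c $ 1" "I (L c) e2 = c $ 2" for c
    using e I.sym[of e2 e1] by (simp_all add: L_def I.add I.scale)
  have "inj L" unfolding linear_injective_0[OF L]
  proof (intro allI impI)
    fix c assume L0: "L c = 0"
    have "c $ 1 = 0" "c $ 2 = 0" using IL[of c] unfolding L0 by simp_all
    then show "c = 0" by (simp add: vec_eq_iff forall_2)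
  qed
  then have "surj L" using linear_injective_imp_surjective[OF L] by simp
  then obtain c where "v = L c" by (metis surjD)
  then show ?thesis using IL[of c] by (simp add: L_def)
qed

text \<open>\<open>mean_curvature\<close> demands one vector valid for all orthonormal bases, so
  invariance of the trace is what gives it a value.\<close>

lemma trace_invariant:
  fixes I b :: "real^2 \<Rightarrow> real^2 \<Rightarrow> real"
  assumes "inner_form I" and b1: "\<And>v. linear (\<lambda>u. b u v)" and b2: "\<And>u. linear (\<lambda>v. b u v)"
    and e: "I e1 e1 = 1" "I e2 e2 = 1" "I e1 e2 = 0" and f: "I f1 f1 = 1" "I f2 f2 = 1" "I f1 f2 = 0"
  shows "b e1 e1 + b e2 e2 = b f1 f1 + b f2 f2"
proof -
  interpret I: inner_form I by (rule assms(1))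
  have ex: "v = I v e1 *\<^sub>R e1 + I v e2 *\<^sub>R e2" for v by (rule orthonormal_expand[OF assms(1) e])
  have fx: "v = I v f1 *\<^sub>R f1 + I v f2 *\<^sub>R f2" for v by (rule orthonormal_expand[OF assms(1) f])
  define x y z w where "x = I f1 e1" and "y = I f1 e2" and "z = I f2 e1" and "w = I f2 e2"
  have e1: "e1 = x *\<^sub>R f1 + z *\<^sub>R f2" using fx[of e1] by (simp add: x_def z_def I.sym)
  have e2: "e2 = y *\<^sub>R f1 + w *\<^sub>R f2" using fx[of e2] by (simp add: y_def w_def I.sym)
  have f1: "f1 = x *\<^sub>R e1 + y *\<^sub>R e2" using ex[of f1] by (simp add: x_def y_def)
  have f2: "f2 = z *\<^sub>R e1 + w *\<^sub>R e2" using ex[of f2] by (simp add: z_def w_def)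
  have "I f1 f1 = I (x *\<^sub>R e1 + y *\<^sub>R e2) (x *\<^sub>R e1 + y *\<^sub>R e2)" using f1 by simp
  then have 1: "x * x + y * y = 1" using e f I.sym[of e2 e1] by (simp add: I.add I.scale)
  have "I f2 f2 = I (z *\<^sub>R e1 + w *\<^sub>R e2) (z *\<^sub>R e1 + w *\<^sub>R e2)" using f2 by simp
  then have 2: "z * z + w * w = 1" using e f I.sym[of e2 e1] by (simp add: I.add I.scale)
  have "I f1 f2 = I (x *\<^sub>R e1 + y *\<^sub>R e2) (z *\<^sub>R e1 + w *\<^sub>R e2)" using f1 f2 by simp
  then have 3: "x * z + y * w = 0" using e f I.sym[of e2 e1] by (simp add: I.add I.scale mult.commute)
  have B: "b (r *\<^sub>R u + s *\<^sub>R v) (r *\<^sub>R u + s *\<^sub>R v) = r * r * b u u + r * s * (b u v + b v u) + s * s * b v v" for r s u v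
    by (simp add: linear_add[OF b1] linear_add[OF b2] linear_scale[OF b1] linear_scale[OF b2] algebra_simps)
  have "b e1 e1 + b e2 e2 = b (x *\<^sub>R f1 + z *\<^sub>R f2) (x *\<^sub>R f1 + z *\<^sub>R f2) + b (y *\<^sub>R f1 + w *\<^sub>R f2) (y *\<^sub>R f1 + w *\<^sub>R f2)"
    using e1 e2 by simp
  also have "\<dots> = (x * x + y * y) * b f1 f1 + (x * z + y * w) * (b f1 f2 + b f2 f1) + (z * z + w * w) * b f2 f2"
    unfolding B by (simp add: algebra_simps)
  finally show ?thesis unfolding 1 2 3 by simp
qed

context patch
begin

lemma second_ff_NK:
  assumes q: "q \<in> U"
  shows "g_NK d (F q) (T q t) (second_ff (g_NK d) F q u v) = 0"
    "cov_deriv_along (g_NK d) F q u v - second_ff (g_NK d) F q u v \<in> range (T q)"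
proof -
  interpret NK: inner_form "g_NK d (F q)" by (rule inner_form_NK)
  have i: "inj (T q)" using inj[OF q] by (simp add: T_def)
  show "g_NK d (F q) (T q t) (second_ff (g_NK d) F q u v) = 0"
    using NK.normal_part(1)[OF T_linear[OF q] i] by (simp add: second_ff_def T_def[symmetric] NK.sym)
  show "cov_deriv_along (g_NK d) F q u v - second_ff (g_NK d) F q u v \<in> range (T q)"
    using NK.normal_part(2)[OF T_linear[OF q] i] by (simp add: second_ff_def T_def[symmetric])
qed

text \<open>The Fubini-Study covariant derivative is tangent by total geodesy and pairs to 0 with
  \<open>n\<close>; what remains is the difference of the two connections.\<close>

lemma second_ff_NK_pair:
  assumes q: "q \<in> U" and l: "cmod l * norm (Z (F q)) = 1"
    and n: "\<And>v. g_NK d (F q) (T q v) n = 0"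
  shows "g_NK d (F q) (second_ff (g_NK d) F q u u) n =
    - 2 * Re (cnj (om (l *s Z (F q)) (l *s P q u)) * om (l *s P q u) (l *s lift (F q) n))"
proof -
  interpret NK: inner_form "g_NK d (F q)" by (rule inner_form_NK)
  have rn: "g_NK d (F q) w n = 0" if "w \<in> range (T q)" for w using that n by auto
  let ?II = "second_ff (g_NK d) F q u u" and ?c = "cov_deriv_along (g_NK d) F q u u"
  let ?f = "cov_deriv_along (g_FS d) F q u u"
  have "g_NK d (F q) (?c - ?II) n = 0" by (rule rn[OF second_ff_NK(2)[OF q]])
  then have 1: "g_NK d (F q) ?II n = g_NK d (F q) ?c n" by (simp add: NK.diff)
  have "?f \<in> range (T q)" using geo[OF q] by (simp add: T_def)
  then have 2: "g_NK d (F q) ?f n = 0" by (rule rn)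
  have "?c = ?f + (christoffel (g_NK d) (F q) (T q u) (T q u) - christoffel (g_FS d) (F q) (T q u) (T q u))"
    by (simp add: cov_deriv_along_def T_def)
  then have "g_NK d (F q) ?c n = g_NK d (F q) (christoffel (g_NK d) (F q) (T q u) (T q u) - christoffel (g_FS d) (F q) (T q u) (T q u)) n"
    using 2 by (simp add: NK.add)
  also have "\<dots> = - 2 * Re (cnj (om (Z (F q)) (P q u)) * om (P q u) (lift (F q) n)) / (N (F q))\<^sup>2"
    unfolding christoffel_diff P_def ..
  also have "\<dots> = - 2 * Re (cnj (om (l *s Z (F q)) (l *s P q u)) * om (l *s P q u) (l *s lift (F q) n))"
  proof -
    \<comment> \<open>Passing to the unit representative brings out \<open>l * cnj l\<close> twice,
      which absorbs the division by the square of \<open>N\<close>.\<close>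
    have ll: "l * cnj l = of_real (1 / N (F q))"
    proof -
      have "(l * cnj l) * of_real (N (F q)) = of_real ((cmod l * norm (Z (F q)))\<^sup>2)"
        by (simp add: complex_norm_square[symmetric] power_mult_distrib N_def)
      then have "(l * cnj l) * of_real (N (F q)) = 1" using l by simp
      then show ?thesis by (simp add: eq_divide_eq)
    qed
    have "cnj (om (l *s Z (F q)) (l *s P q u)) * om (l *s P q u) (l *s lift (F q) n)
      = (l * cnj l) * (l * cnj l) * (cnj (om (Z (F q)) (P q u)) * om (P q u) (lift (F q) n))"
      by (simp add: om_scale mult_ac)
    also have "\<dots> = of_real (1 / (N (F q))\<^sup>2) * (cnj (om (Z (F q)) (P q u)) * om (P q u) (lift (F q) n))"
      unfolding ll by (simp add: power2_eq_square)
    finally show ?thesis by simp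
  qed
  finally show ?thesis using 1 by simp
qed

lemma induced_inner_form:
  assumes q: "q \<in> U" shows "inner_form (\<lambda>u v. g_NK d (F q) (T q u) (T q v))"
proof -
  interpret NK: inner_form "g_NK d (F q)" by (rule inner_form_NK)
  show ?thesis
  proof (rule inner_form.intro)
    show "linear (\<lambda>u. g_NK d (F q) (T q u) (T q v))" for v
      using linear_compose[OF T_linear[OF q] NK.lin1] by (simp add: o_def)
    show "g_NK d (F q) (T q u) (T q v) = g_NK d (F q) (T q v) (T q u)" for u v by (rule NK.sym)
    show "g_NK d (F q) (T q u) (T q u) > 0" if "u \<noteq> 0" for u
    proof (rule NK.pos)
      show "T q u \<noteq> 0"
        using that inj[OF q] linear_0[OF T_linear[OF q]] unfolding T_def by (metis injD)
    qed
  qed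
qed

text \<open>The trace \<open>V\<close> of the second fundamental form is itself normal, so it is
  determined by its pairings with normal vectors, and these are traces of the forms
  \<open>b n\<close>. A single orthonormal frame thus decides whether the mean curvature
  vanishes.\<close>

lemma mean_curvature_NK:
  assumes q: "q \<in> U" and l: "cmod l * norm (Z (F q)) = 1"
    and f: "g_NK d (F q) (T q f1) (T q f1) = 1" "g_NK d (F q) (T q f2) (T q f2) = 1"
      "g_NK d (F q) (T q f1) (T q f2) = 0"
  defines "b \<equiv> \<lambda>n u v. Re (cnj (om (l *s Z (F q)) (l *s P q u)) * om (l *s P q v) (l *s lift (F q) n))"
  shows "(\<And>n. (\<And>v. g_NK d (F q) (T q v) n = 0) \<Longrightarrow> b n f1 f1 + b n f2 f2 = 0) \<Longrightarrow> mean_curvature (g_NK d) F q = 0"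
    and "(\<And>v. g_NK d (F q) (T q v) n = 0) \<Longrightarrow> b n f1 f1 + b n f2 f2 \<noteq> 0 \<Longrightarrow> mean_curvature (g_NK d) F q \<noteq> 0"
proof -
  interpret NK: inner_form "g_NK d (F q)" by (rule inner_form_NK)
  define V where "V u v = second_ff (g_NK d) F q u u + second_ff (g_NK d) F q v v" for u v
  have VT: "g_NK d (F q) (T q t) (V u v) = 0" for t u v
    by (simp add: V_def NK.add second_ff_NK(1)[OF q])
  have b1: "linear (\<lambda>u. b n u v)" for n v unfolding b_def
    by (rule linearI) (simp_all add: linear_add[OF P_linear[OF q]] linear_scale[OF P_linear[OF q]]
        om_scale om_add om_scaleR vector_add_ldistrib algebra_simps)
  have b2: "linear (\<lambda>v. b n u v)" for n u unfolding b_def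
    by (rule linearI) (simp_all add: linear_add[OF P_linear[OF q]] linear_scale[OF P_linear[OF q]]
        om_scale om_add om_scaleR vector_add_ldistrib algebra_simps)
  have Vb: "g_NK d (F q) (V u v) n = - 2 * (b n u u + b n v v)" if "\<And>v. g_NK d (F q) (T q v) n = 0" for n u v
    unfolding V_def NK.add b_def second_ff_NK_pair[OF q l that] by simp
  have Veq: "V u v = V f1 f2"
    if e: "g_NK d (F q) (T q u) (T q u) = 1" "g_NK d (F q) (T q v) (T q v) = 1" "g_NK d (F q) (T q u) (T q v) = 0" for u v
  proof -
    \<comment> \<open>The difference of two traces is normal, so it may be paired with itself;
      invariance of the trace of \<open>b D\<close> then makes it 0.\<close>
    define D where "D = V u v - V f1 f2"
    have Dn: "g_NK d (F q) (T q t) D = 0" for t by (simp add: D_def NK.diff VT)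
    have "b D u u + b D v v = b D f1 f1 + b D f2 f2"
      by (rule trace_invariant[OF induced_inner_form[OF q] b1 b2 e f])
    then have "g_NK d (F q) (V u v - V f1 f2) D = 0" using Vb[OF Dn] by (simp add: NK.diff)
    then show ?thesis using NK.eq_zero[of D] by (simp add: D_def)
  qed
  have mc: "mean_curvature (g_NK d) F q = (1/2) *\<^sub>R V f1 f2"
    unfolding mean_curvature_def Let_def T_def[symmetric]
  proof (rule the_equality)
    show "\<forall>e1 e2. g_NK d (F q) (T q e1) (T q e1) = 1 \<and> g_NK d (F q) (T q e2) (T q e2) = 1 \<and>
        g_NK d (F q) (T q e1) (T q e2) = 0 \<longrightarrow>
        (1/2) *\<^sub>R V f1 f2 = (1/2) *\<^sub>R (second_ff (g_NK d) F q e1 e1 + second_ff (g_NK d) F q e2 e2)"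
    proof (intro allI impI)
      fix u v assume "g_NK d (F q) (T q u) (T q u) = 1 \<and> g_NK d (F q) (T q v) (T q v) = 1 \<and> g_NK d (F q) (T q u) (T q v) = 0"
      then have "V u v = V f1 f2" by (intro Veq) auto
      then show "(1/2) *\<^sub>R V f1 f2 = (1/2) *\<^sub>R (second_ff (g_NK d) F q u u + second_ff (g_NK d) F q v v)"
        by (simp only: V_def)
    qed
    fix H assume "\<forall>e1 e2. g_NK d (F q) (T q e1) (T q e1) = 1 \<and> g_NK d (F q) (T q e2) (T q e2) = 1 \<and>
        g_NK d (F q) (T q e1) (T q e2) = 0 \<longrightarrow>
        H = (1/2) *\<^sub>R (second_ff (g_NK d) F q e1 e1 + second_ff (g_NK d) F q e2 e2)"
    then show "H = (1/2) *\<^sub>R V f1 f2" using f unfolding V_def by blast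
  qed
  show "mean_curvature (g_NK d) F q = 0"
    if H: "\<And>n. (\<And>v. g_NK d (F q) (T q v) n = 0) \<Longrightarrow> b n f1 f1 + b n f2 f2 = 0"
  proof -
    have "b (V f1 f2) f1 f1 + b (V f1 f2) f2 f2 = 0" by (rule H) (rule VT)
    moreover have "g_NK d (F q) (V f1 f2) (V f1 f2) = - 2 * (b (V f1 f2) f1 f1 + b (V f1 f2) f2 f2)"
      by (rule Vb) (rule VT)
    ultimately have "g_NK d (F q) (V f1 f2) (V f1 f2) = 0" by simp
    then show ?thesis unfolding mc by (simp add: NK.eq_zero)
  qed
  show "mean_curvature (g_NK d) F q \<noteq> 0"
    if n: "\<And>v. g_NK d (F q) (T q v) n = 0" and "b n f1 f1 + b n f2 f2 \<noteq> 0"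
  proof
    assume "mean_curvature (g_NK d) F q = 0"
    then have "V f1 f2 = 0" unfolding mc by simp
    then show False using Vb[OF n, of f1 f2] that(2) by simp
  qed
qed

lemma g_NK_T:
  assumes "cmod l * norm (Z (F q)) = 1"
  shows "g_NK d (F q) (T q u) n = 2 * ((l *s P q u) \<bullet> (l *s lift (F q) n))
    - Re (om (l *s Z (F q)) (l *s P q u) * cnj (om (l *s Z (F q)) (l *s lift (F q) n)))"
  unfolding g_NK_unit[OF assms] P_def ..

text \<open>Being totally real fixes the modulus of \<open>om p X\<close>; after that, one explicit
  normal vector detects a nonzero mean curvature.\<close>

lemma complex_not_minimal:
  assumes q: "q \<in> U" and W: "subspace W" "complex_closed W" "dim W \<le> 4" and fr: "framed W q"
    and tr: "\<And>u v. g_NK d (F q) (J_NK d (F q) (T q u)) (T q v) = 0"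
  obtains p X where "p \<in> W" "X \<in> W" "norm p = 1" "norm X = 1" "herm X p = 0"
    "(cmod (om p X))\<^sup>2 = 2 / 3" "mean_curvature (g_NK d) F q \<noteq> 0"
proof -
  have pl: "plane W" using W by (simp add: plane_def)
  obtain l where l: "cmod l * norm (Z (F q)) = 1" "l *s Z (F q) \<in> W" "\<And>u. l *s P q u \<in> W"
    using framedE[OF W(1) fr] by blast
  have l0: "l \<noteq> 0" using l(1) by auto
  define p where "p = l *s Z (F q)"
  have np: "norm p = 1" using l(1) by (simp add: p_def norm_smult)
  have Ps: "P q (r *\<^sub>R u) = r *\<^sub>R P q u" for r u by (rule linear_scale[OF P_linear[OF q]])
  have ls: "l *s (r *\<^sub>R v) = r *\<^sub>R (l *s v)" for r and v :: "complex^4"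
    by (simp add: scaleR_smult smult_assoc mult.commute)
  define a where "a = norm (l *s P q e1)"
  have a: "a \<noteq> 0" using l0 P_inj[OF q, of e1] by (simp add: a_def norm_smult axis_eq_0_iff)
  define u1 where "u1 = (1 / a) *\<^sub>R e1"
  define X where "X = l *s P q u1"
  have nX: "norm X = 1"
    unfolding X_def u1_def Ps ls using a by (simp add: a_def[symmetric]) (simp add: a_def)
  have XW: "X \<in> W" unfolding X_def by (rule l(3))
  have hP: "herm (l *s P q u) p = 0" for u by (simp add: p_def P_def herm_scale)
  have hX: "herm X p = 0" unfolding X_def by (rule hP)
  have pX: "herm p X = 0" using hX cnj_herm[of X p] by simp
  have iX: "\<i> *s X \<in> W" using W(2) XW by (simp add: complex_closed_def)
  obtain u2 where u2: "\<i> *s X = l *s P q u2"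
    using frame_complement[OF pl q l0 l(2,3) iX] hX by (auto simp: herm_scale p_def)
  define \<eta> where "\<eta> = om p X"
  have hXX: "herm X X = 1" by (simp add: herm_self nX)
  \<comment> \<open>The totally real condition on the tangent pair \<open>X\<close>,
    \<open>\<i> *s X\<close>: the Hermitian term contributes 2, the symplectic one -3 times the
    squared modulus of \<open>\<eta>\<close>.\<close>
  have "0 = 2 * Re (\<i> * herm X (\<i> *s X)) - 3 * Re (\<i> * (om p X * cnj (om p (\<i> *s X))))"
    using tr[of u1 u2] unfolding g_NK_J[OF l(1)] P_def[symmetric] X_def[symmetric] u2[symmetric] p_def[symmetric] by simp
  then have "3 * Re (\<eta> * cnj \<eta>) = 2"
    unfolding herm_scale om_scale hXX \<eta>_def[symmetric] by (simp add: algebra_simps)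
  moreover have \<eta>c: "Re (\<eta> * cnj \<eta>) = (cmod \<eta>)\<^sup>2" by (simp only: complex_norm_square[symmetric] Re_complex_of_real)
  ultimately have \<eta>: "(cmod \<eta>)\<^sup>2 = 2 / 3" by simp
  \<comment> \<open>In the nearly Kaehler metric \<open>X\<close> and \<open>\<i> *s X\<close> have
    squared length 2 - 2/3 = 4/3, so this factor normalises them.\<close>
  define s where "s = sqrt 3 / 2"
  have s: "s * s = 3 / 4" by (simp add: s_def)
  define f1 f2 where "f1 = s *\<^sub>R u1" and "f2 = s *\<^sub>R u2"
  have Pf: "l *s P q f1 = s *\<^sub>R X" "l *s P q f2 = s *\<^sub>R (\<i> *s X)"
    by (simp_all add: f1_def f2_def Ps ls X_def[symmetric] u2[symmetric])
  have g: "g_NK d (F q) (T q u) (T q v) = 2 * Re (herm (l *s P q u) (l *s P q v)) - Re (om p (l *s P q u) * cnj (om p (l *s P q v)))" for u v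
    unfolding g_NK_T[OF l(1)] P_def p_def Re_herm ..
  have f: "g_NK d (F q) (T q f1) (T q f1) = 1" "g_NK d (F q) (T q f2) (T q f2) = 1"
      "g_NK d (F q) (T q f1) (T q f2) = 0"
  proof -
    have r: "Re (complex_of_real s * z) = s * Re z" for z by simp
    have "g_NK d (F q) (T q f1) (T q f1) = (s * s) * (2 - Re (\<eta> * cnj \<eta>))"
      unfolding g Pf herm_scaleR om_scaleR hXX \<eta>_def[symmetric] by (simp add: algebra_simps)
    then show "g_NK d (F q) (T q f1) (T q f1) = 1" unfolding s \<eta>c \<eta> by simp
    have "g_NK d (F q) (T q f2) (T q f2) = (s * s) * (2 - Re (\<eta> * cnj \<eta>))"
      unfolding g Pf herm_scaleR om_scaleR herm_scale om_scale hXX \<eta>_def[symmetric] by (simp add: algebra_simps)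
    then show "g_NK d (F q) (T q f2) (T q f2) = 1" unfolding s \<eta>c \<eta> by simp
    show "g_NK d (F q) (T q f1) (T q f2) = 0"
      unfolding g Pf herm_scaleR om_scaleR herm_scale om_scale hXX \<eta>_def[symmetric] by (simp add: algebra_simps)
  qed
  \<comment> \<open>The horizontal part of \<open>jmul X\<close>. It is orthogonal to the tangent
    plane and satisfies \<open>om p nn = 0\<close>, so it is normal for the nearly Kaehler metric;
    the factor \<open>\<eta>\<close> aligns the phases so that both terms of the trace are
    positive.\<close>
  define nn where "nn = \<eta> *s (jmul X - herm (jmul X) p *s p)"
  have hjp: "herm (jmul X) p = - cnj \<eta>" by (simp add: herm_jmul_left \<eta>_def)
  have "herm nn p = 0" by (simp add: nn_def herm_scale herm_diff herm_self np)
  then have "herm ((1 / l) *s nn) (Z (F q)) = 0" using l0 by (simp add: p_def herm_scale)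
  then obtain n where n': "(1 / l) *s nn = lift (F q) n" by (rule lift_surj)
  then have n: "l *s lift (F q) n = nn" using l0 by (simp add: n'[symmetric] smult_assoc)
  have jX: "herm X (jmul X) = 0" by (simp add: herm_jmul_right)
  have hXn: "herm X nn = 0" by (simp add: nn_def herm_scale herm_diff jX hX)
  have opn: "om p nn = 0" by (simp add: nn_def om_scale om_diff om_jmul pX)
  have oXn: "om X nn = \<eta> / 3"
  proof -
    have "om X nn = \<eta> * (1 - \<eta> * cnj \<eta>)"
      by (simp add: nn_def om_scale om_diff om_add om_jmul hXX hjp om_swap[of X p] \<eta>_def[symmetric] algebra_simps)
    also have "\<eta> * cnj \<eta> = 2 / 3" unfolding complex_norm_square[symmetric] \<eta> by simp
    finally show ?thesis by simp
  qed
  have normal: "g_NK d (F q) (T q v) n = 0" for v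
  proof -
    have "l *s P q v = herm (l *s P q v) p *s p + herm (l *s P q v) X *s X"
      by (rule complex_plane_expand[OF W _ XW np nX hX l(3)]) (use l(2) in \<open>simp add: p_def\<close>)
    then have v: "l *s P q v = herm (l *s P q v) X *s X" unfolding hP by simp
    have "herm (l *s P q v) nn = 0" by (subst v) (simp add: herm_scale hXn)
    then show ?thesis unfolding g_NK_T[OF l(1)] n p_def[symmetric] opn by (simp add: Re_herm[symmetric])
  qed
  have "mean_curvature (g_NK d) F q \<noteq> 0"
  proof (rule mean_curvature_NK(2)[OF q l(1) f normal])
    have "Re (cnj (om p (l *s P q f1)) * om (l *s P q f1) nn) + Re (cnj (om p (l *s P q f2)) * om (l *s P q f2) nn)
        = (s * s) * (2 / 3) * Re (\<eta> * cnj \<eta>)"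
      unfolding Pf om_scaleR om_scale \<eta>_def[symmetric] oXn by (simp add: algebra_simps)
    also have "\<dots> \<noteq> 0" unfolding s \<eta>c \<eta> by simp
    finally show "Re (cnj (om (l *s Z (F q)) (l *s P q f1)) * om (l *s P q f1) (l *s lift (F q) n)) +
      Re (cnj (om (l *s Z (F q)) (l *s P q f2)) * om (l *s P q f2) (l *s lift (F q) n)) \<noteq> 0"
      unfolding n p_def .
  qed
  then show ?thesis using that[of p X] l(2) XW np nX hX \<eta> by (simp add: p_def \<eta>_def)
qed

end

text \<open>At a point of the model, the tangent vectors \<open>X\<close>, \<open>Y\<close> are the directions of the circles of
  latitude and of the meridians.\<close>

lemma real_plane_frame:
  assumes A: "qunitary A" and e: "cmod e = 1" and W: "W = (\<lambda>w. e *s A w) ` plane0" and p: "p \<in> W" "norm p = 1"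
  obtains X Y where "X \<in> W" "Y \<in> W" "norm X = 1" "norm Y = 1" "herm X p = 0" "herm Y p = 0" "herm X Y = 0" "om p Y = 0"
    "\<And>n. \<lbrakk>herm n p = 0; Re (herm n Y) = 0\<rbrakk> \<Longrightarrow> Re (cnj (om p X) * om X n) = 0"
proof -
  note result = that
  have "\<exists>B. \<forall>v. A (B v) = v" using qunitary_inverse[OF A] by metis
  then obtain B where AB: "\<And>v. A (B v) = v" by blast
  let ?E = "\<lambda>w. e *s A w"
  have ce: "cnj e * e = 1" using e complex_norm_square[of e] by (simp add: mult.commute)
  have e0: "e \<noteq> 0" using e by auto
  have hE: "herm (?E v) (?E w) = herm v w" for v w
    using ce by (simp add: herm_scale qunitary_herm[OF A] mult.assoc[symmetric] mult.commute[of e])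
  have oE: "om (?E v) (?E w) = e * e * om v w" for v w by (simp add: om_scale qunitary_om[OF A])
  have nE: "norm (?E v) = norm v" for v using e by (simp add: norm_smult qunitary_norm[OF A])
  obtain a b c where p0: "p = ?E (vector [of_real a, of_real b, of_real c, 0])"
    using p(1) unfolding W plane0_def by auto
  define p' :: "complex^4" where "p' = vector [of_real a, of_real b, of_real c, 0]"
  have pE: "p = ?E p'" using p0 by (simp add: p'_def)
  have "(norm p')\<^sup>2 = 1" using p(2) nE[of p'] pE by simp
  then have abc: "a\<^sup>2 + b\<^sup>2 + c\<^sup>2 = 1" by (simp add: p'_def norm_vector_4)
  have surjE: "\<exists>n'. n = ?E n'" for n
    by (rule exI[of _ "B ((1 / e) *s n)"]) (simp add: AB smult_assoc e0)
  have main: ?thesis if X': "X' \<in> plane0" "(norm X')\<^sup>2 = 1" "herm X' p' = 0" and Y': "Y' \<in> plane0" "(norm Y')\<^sup>2 = 1" "herm Y' p' = 0"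
    and XY: "herm X' Y' = 0" "om p' Y' = 0"
    and n: "\<And>n. \<lbrakk>herm n p' = 0; Re (herm n Y') = 0\<rbrakk> \<Longrightarrow> Re (cnj (om p' X') * om X' n) = 0" for X' Y'
  proof (rule result[of "?E X'" "?E Y'"])
    show "?E X' \<in> W" "?E Y' \<in> W" using X' Y' W by auto
    show "norm (?E X') = 1" "norm (?E Y') = 1"
      unfolding nE using X'(2) Y'(2) power2_eq_imp_eq[of "norm X'" 1] power2_eq_imp_eq[of "norm Y'" 1] by simp_all
    show "herm (?E X') p = 0" "herm (?E Y') p = 0" "herm (?E X') (?E Y') = 0" "om p (?E Y') = 0"
      unfolding pE hE oE using X' Y' XY by simp_all
    fix n assume h: "herm n p = 0" "Re (herm n (?E Y')) = 0"
    obtain n' where n': "n = ?E n'" using surjE by blast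
    have "Re (cnj (om p' X') * om X' n') = 0" by (rule n) (use h in \<open>simp_all only: n' pE hE\<close>)
    moreover have "cnj (om p (?E X')) * om (?E X') n = (cnj e * e) * (cnj e * e) * (cnj (om p' X') * om X' n')"
      unfolding n' pE oE by (simp add: mult_ac)
    ultimately show "Re (cnj (om p (?E X')) * om (?E X') n) = 0" unfolding ce by simp
  qed
  show ?thesis
  \<comment> \<open>If \<open>a = b = 0\<close>, the point is the pole spanned by the kernel of
    \<open>om\<close> on the plane: \<open>om p'\<close> vanishes on \<open>plane0\<close> and the
    two coordinate directions serve as \<open>X\<close> and \<open>Y\<close>. Elsewhere the circle
    of latitude is defined.\<close>
  proof (cases "a\<^sup>2 + b\<^sup>2 = 0")
    case True
    then have ab: "a = 0" "b = 0" by (auto simp: sum_power2_eq_zero_iff)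
    show ?thesis
    proof (rule main[of "vector [of_real 1, of_real 0, of_real 0, 0]" "vector [of_real 0, of_real 1, of_real 0, 0]"])
      show "vector [of_real 1, of_real 0, of_real 0, 0] \<in> plane0" "vector [of_real 0, of_real 1, of_real 0, 0] \<in> plane0"
        unfolding plane0_def by blast+
    qed (unfold norm_vector_4, simp_all add: p'_def ab herm_def sum_4 om_def)
  next
    case False
    define r where "r = sqrt (a\<^sup>2 + b\<^sup>2)"
    have r: "r \<noteq> 0" "r * r = a * a + b * b" using False by (simp_all add: r_def power2_eq_square)
    have abc': "r * r + c * c = 1" using abc r by (simp add: power2_eq_square)
    show ?thesis
    proof (rule main[of "vector [of_real (- b / r), of_real (a / r), of_real 0, 0]"
          "vector [of_real (- a * c / r), of_real (- b * c / r), of_real r, 0]"])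
      show "vector [of_real (- b / r), of_real (a / r), of_real 0, 0] \<in> plane0"
        "vector [of_real (- a * c / r), of_real (- b * c / r), of_real r, 0] \<in> plane0"
        unfolding plane0_def by blast+
      have "(- b / r)\<^sup>2 + (a / r)\<^sup>2 = (a * a + b * b) / (r * r)"
        by (simp add: power2_eq_square add_divide_distrib)
      also have "\<dots> = 1" unfolding r(2)[symmetric] using r(1) by simp
      finally show "(norm (vector [of_real (- b / r), of_real (a / r), of_real 0, 0] :: complex^4))\<^sup>2 = 1"
        unfolding norm_vector_4 norm_of_real power2_abs by simp
      have "(- a * c / r)\<^sup>2 + (- b * c / r)\<^sup>2 + r\<^sup>2 = (a * a + b * b) * (c * c) / (r * r) + r * r"
        by (simp add: power2_eq_square add_divide_distrib algebra_simps)
      also have "\<dots> = 1" unfolding r(2)[symmetric] using r(1) abc' by simp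
      finally show "(norm (vector [of_real (- a * c / r), of_real (- b * c / r), of_real r, 0] :: complex^4))\<^sup>2 = 1"
        unfolding norm_vector_4 norm_of_real power2_abs by simp
      show "herm (vector [of_real (- b / r), of_real (a / r), of_real 0, 0]) p' = 0"
        by (simp add: p'_def herm_def sum_4 field_simps)
      have "- a * c / r * a + - b * c / r * b + r * c = (r * r - (a * a + b * b)) * c / r"
        using r(1) by (simp add: field_simps)
      then have "- a * c / r * a + - b * c / r * b + r * c = 0" using r(2) by simp
      then have "complex_of_real (- a * c / r * a + - b * c / r * b + r * c) = 0" by simp
      then show "herm (vector [of_real (- a * c / r), of_real (- b * c / r), of_real r, 0]) p' = 0"
        by (simp add: p'_def herm_def sum_4)
      show "herm (vector [of_real (- b / r), of_real (a / r), of_real 0, 0])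
         (vector [of_real (- a * c / r), of_real (- b * c / r), of_real r, 0]) = 0"
        by (simp add: herm_def sum_4)
      show "om p' (vector [of_real (- a * c / r), of_real (- b * c / r), of_real r, 0]) = 0"
        by (simp add: p'_def om_def)
      \<comment> \<open>The real parts of the two orthogonality conditions are linear equations in
        \<open>x\<close>, \<open>y\<close>, \<open>z\<close>; they force \<open>z = 0\<close> and
        \<open>x * a + y * b = 0\<close>, and the latter is, up to the factor \<open>- r\<close>,
        the real part of \<open>om X n\<close>.\<close>
      fix n assume h: "herm n p' = 0" "Re (herm n (vector [of_real (- a * c / r), of_real (- b * c / r), of_real r, 0])) = 0"
      define x y z where "x = Re (n $ 1)" and "y = Re (n $ 2)" and "z = Re (n $ 3)"
      have h1: "x * a + y * b + z * c = 0"
        using arg_cong[OF h(1), of Re] by (simp add: p'_def herm_def sum_4 x_def y_def z_def)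
      have "x * (- a * c / r) + y * (- b * c / r) + z * r = 0"
        using h(2) by (simp add: herm_def sum_4 x_def y_def z_def)
      then have h0: "(x * (- a * c / r) + y * (- b * c / r) + z * r) * r = 0" by (simp only: mult_zero_left)
      have h': "(x * (- a * c / r) + y * (- b * c / r) + z * r) * r = - c * (x * a + y * b) + z * (r * r)"
        using r(1) by (simp add: field_simps)
      have h2: "- c * (x * a + y * b) + z * (r * r) = 0" using h0 unfolding h' .
      have xy: "x * a + y * b = - (z * c)" using h1 by linarith
      have "z * (r * r + c * c) = 0" using h2 unfolding xy by (simp add: algebra_simps)
      then have "z = 0" unfolding abc' by simp
      then have xy0: "x * a + y * b = 0" using xy by simp
      have o1: "om p' (vector [of_real (- b / r), of_real (a / r), of_real 0, 0]) = of_real ((a * a + b * b) / r)"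
        by (simp add: p'_def om_def add_divide_distrib)
      have o2: "Re (om (vector [of_real (- b / r), of_real (a / r), of_real 0, 0]) n) = - (x * a + y * b) / r"
        by (simp add: om_def x_def y_def add_divide_distrib diff_divide_distrib mult.commute)
      show "Re (cnj (om p' (vector [of_real (- b / r), of_real (a / r), of_real 0, 0])) *
          om (vector [of_real (- b / r), of_real (a / r), of_real 0, 0]) n) = 0"
        unfolding o1 complex_cnj_complex_of_real using o2 xy0 by simp
    qed
  qed
qed

context patch
begin

text \<open>The trace vanishes term by term. The meridian direction contributes 0 since
  \<open>om p Y = 0\<close>; for the same reason a nearly Kaehler normal vector is
  Euclidean-orthogonal to \<open>Y\<close>, and the frame was chosen so that the latitude direction
  then contributes 0.\<close>

lemma real_minimal:
  assumes q: "q \<in> U" and W: "plane W" "isotropic W" and fr: "framed W q"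
    and A: "qunitary A" "cmod e = 1" "W = (\<lambda>w. e *s A w) ` plane0"
  shows "mean_curvature (g_NK d) F q = 0"
proof -
  have sW: "subspace W" using W by (simp add: plane_def)
  obtain l where l: "cmod l * norm (Z (F q)) = 1" "l *s Z (F q) \<in> W" "\<And>u. l *s P q u \<in> W"
    using framedE[OF sW fr] by blast
  have l0: "l \<noteq> 0" using l(1) by auto
  define p where "p = l *s Z (F q)"
  have p: "p \<in> W" "norm p = 1" using l(1,2) by (simp_all add: p_def norm_smult)
  obtain X Y where XY: "X \<in> W" "Y \<in> W" "norm X = 1" "norm Y = 1" "herm X p = 0" "herm Y p = 0" "herm X Y = 0" "om p Y = 0"
    and nn: "\<And>n. \<lbrakk>herm n p = 0; Re (herm n Y) = 0\<rbrakk> \<Longrightarrow> Re (cnj (om p X) * om X n) = 0"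
    using real_plane_frame[OF A p] by metis
  obtain u1 where u1: "X = l *s P q u1" using frame_complement[OF W(1) q l0 l(2,3) XY(1)] XY(5) by (auto simp: p_def)
  obtain u2 where u2: "Y = l *s P q u2" using frame_complement[OF W(1) q l0 l(2,3) XY(2)] XY(6) by (auto simp: p_def)
  have Ps: "l *s P q (r *\<^sub>R u) = r *\<^sub>R (l *s P q u)" for r u
    by (simp add: linear_scale[OF P_linear[OF q]] scaleR_smult smult_assoc mult.commute)
  have g: "g_NK d (F q) (T q u) (T q v) = 2 * Re (herm (l *s P q u) (l *s P q v)) - Re (om p (l *s P q u) * cnj (om p (l *s P q v)))" for u v
    unfolding g_NK_T[OF l(1)] P_def p_def Re_herm ..
  define m where "m = g_NK d (F q) (T q u1) (T q u1)"
  interpret I: inner_form "\<lambda>u v. g_NK d (F q) (T q u) (T q v)" by (rule induced_inner_form[OF q])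
  have "u1 \<noteq> 0" using XY(3) u1 linear_0[OF P_linear[OF q]] by auto
  then have m: "m > 0" unfolding m_def by (rule I.pos)
  have g22: "g_NK d (F q) (T q u2) (T q u2) = 2"
    unfolding g u2[symmetric] by (simp add: herm_self XY)
  have g12: "g_NK d (F q) (T q u1) (T q u2) = 0"
    unfolding g u1[symmetric] u2[symmetric] by (simp add: XY)
  define f1 f2 where "f1 = (1 / sqrt m) *\<^sub>R u1" and "f2 = (1 / sqrt 2) *\<^sub>R u2"
  have f: "g_NK d (F q) (T q f1) (T q f1) = 1" "g_NK d (F q) (T q f2) (T q f2) = 1"
      "g_NK d (F q) (T q f1) (T q f2) = 0"
    unfolding f1_def f2_def I.scale g22 g12 m_def[symmetric] using m by simp_all
  show ?thesis
  proof (rule mean_curvature_NK(1)[OF q l(1) f])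
    fix n assume n: "\<And>v. g_NK d (F q) (T q v) n = 0"
    define n' where "n' = l *s lift (F q) n"
    have hn: "herm n' p = 0" by (simp add: n'_def p_def herm_scale)
    have "0 = 2 * (Y \<bullet> n') - Re (om p Y * cnj (om p n'))"
      using n[of u2] unfolding g_NK_T[OF l(1)] u2[symmetric] p_def[symmetric] n'_def[symmetric] by simp
    then have "Re (herm n' Y) = 0" by (simp add: XY Re_herm inner_commute)
    then have "Re (cnj (om p X) * om X n') = 0" by (rule nn[OF hn])
    then show "Re (cnj (om (l *s Z (F q)) (l *s P q f1)) * om (l *s P q f1) (l *s lift (F q) n)) +
      Re (cnj (om (l *s Z (F q)) (l *s P q f2)) * om (l *s P q f2) (l *s lift (F q) n)) = 0"
      unfolding f1_def f2_def Ps u1[symmetric] u2[symmetric] n'_def[symmetric] p_def[symmetric] om_scaleR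
      by (simp add: XY)
  qed
qed

text \<open>\<open>herm\<close> is real on \<open>W\<close>, so only the symplectic term of
  \<open>g_NK_J\<close> remains. Components of \<open>X\<close> and \<open>Y\<close> along
  \<open>p\<close> are invisible to \<open>om p\<close>, and another representative of the point
  changes the product by a nonnegative real factor.\<close>

lemma real_totally_real:
  assumes q: "q \<in> U" and W: "plane W" "isotropic W" and fr: "framed W q"
    and tr: "\<And>u v. g_NK d (F q) (J_NK d (F q) (T q u)) (T q v) = 0"
    and p: "p \<in> W" "norm p = 1" "p = k *s Z (F q)" and XY: "X \<in> W" "Y \<in> W"
  shows "Im (om p X * cnj (om p Y)) = 0"
proof -
  have sW: "subspace W" using W by (simp add: plane_def)
  obtain l where l: "cmod l * norm (Z (F q)) = 1" "l *s Z (F q) \<in> W" "\<And>u. l *s P q u \<in> W"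
    using framedE[OF sW fr] by blast
  have l0: "l \<noteq> 0" using l(1) by auto
  define c where "c = k / l"
  have pc: "p = c *s (l *s Z (F q))" using p(3) l0 by (simp add: c_def smult_assoc)
  have dec: "\<exists>u. om p X = c * om (l *s Z (F q)) (l *s P q u)" if X: "X \<in> W" for X
  proof -
    define z where "z = l *s Z (F q)"
    have nz: "norm z = 1" using l(1) by (simp add: z_def norm_smult)
    have zW: "z \<in> W" using l(2) by (simp add: z_def)
    have "X - herm X z *s z \<in> W" unfolding isotropic_smult[OF W(2) X zW]
      by (intro subspace_diff subspace_scale sW X zW)
    moreover have "herm (X - herm X z *s z) (l *s Z (F q)) = 0"
      unfolding z_def[symmetric] by (simp add: herm_diff herm_scale herm_self nz)
    ultimately obtain u where u: "X - herm X z *s z = l *s P q u"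
      using frame_complement[OF W(1) q l0 l(2,3)] by blast
    have "om p X = c * om z (X - herm X z *s z)"
      unfolding pc z_def[symmetric] by (simp add: om_scale om_diff)
    then show ?thesis unfolding u unfolding z_def by blast
  qed
  obtain u where u: "om p X = c * om (l *s Z (F q)) (l *s P q u)" using dec[OF XY(1)] by blast
  obtain v where v: "om p Y = c * om (l *s Z (F q)) (l *s P q v)" using dec[OF XY(2)] by blast
  define w where "w = om (l *s Z (F q)) (l *s P q u) * cnj (om (l *s Z (F q)) (l *s P q v))"
  have "Im (herm (l *s P q u) (l *s P q v)) = 0" using W(2) l(3) by (simp add: isotropic_def)
  then have "Im w = 0" using tr[of u v]
    unfolding g_NK_J[OF l(1)] P_def[symmetric] w_def[symmetric] by simp
  moreover have "om p X * cnj (om p Y) = of_real ((cmod c)\<^sup>2) * w"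
    unfolding u v w_def complex_norm_square by simp
  ultimately show ?thesis by (simp del: of_real_power)
qed

lemma real_orthonormal_frame:
  assumes q: "q \<in> U" and W: "plane W" "isotropic W" and fr: "framed W q"
  obtains l X Y where "cmod l * norm (Z (F q)) = 1" "l *s Z (F q) \<in> W" "X \<in> W" "Y \<in> W"
    "norm X = 1" "norm Y = 1" "herm X (l *s Z (F q)) = 0" "herm Y (l *s Z (F q)) = 0" "herm Y X = 0"
proof -
  have sW: "subspace W" using W by (simp add: plane_def)
  obtain l where l: "cmod l * norm (Z (F q)) = 1" "l *s Z (F q) \<in> W" "\<And>u. l *s P q u \<in> W"
    using framedE[OF sW fr] by blast
  have l0: "l \<noteq> 0" using l(1) by auto
  have dimR: "dim (range (\<lambda>u. l *s P q u)) = 2" by (rule dim_smult_P[OF q l0])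
  have R: "subspace (range (\<lambda>u. l *s P q u))" by (rule linear_subspace_image[OF smult_P_linear[OF q] subspace_UNIV])
  obtain Bs where Bs: "Bs \<subseteq> range (\<lambda>u. l *s P q u)" "pairwise orthogonal Bs" "\<And>x. x \<in> Bs \<Longrightarrow> norm x = 1"
    "card Bs = dim (range (\<lambda>u. l *s P q u))"
    using orthonormal_basis_subspace[OF R] by metis
  then obtain X Y where XY: "Bs = {X, Y}" "X \<noteq> Y" unfolding dimR by (auto simp: card_2_iff)
  have "X \<in> W" "Y \<in> W" using Bs(1) XY l(3) by auto
  moreover have "orthogonal Y X" using Bs(2) XY by (auto simp: pairwise_def)
  moreover have "herm X (l *s Z (F q)) = 0" "herm Y (l *s Z (F q)) = 0"
    using Bs(1) XY by (auto simp: P_def herm_scale)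
  ultimately show ?thesis
    using that[OF l(1,2), of X Y] Bs(3) XY W(2) by (auto simp: isotropic_def orthogonal_def complex_eq_iff Re_herm)
qed

end

section \<open>The classification\<close>

locale totally_real_surface = geodesic_surface +
  assumes tot: "totally_real A CP3_atlas g_NK J_NK f"
begin

lemma patch_totally_real:
  assumes p: "patch_of c d i lin pr B" and q: "q \<in> B"
  shows "g_NK d (rep c d f q) (J_NK d (rep c d f q) (patch.T (rep c d f) q u)) (patch.T (rep c d f) q v) = 0"
proof -
  interpret patch i lin pr d B "rep c d f" using p by (simp add: patch_of_def)
  have "c \<in> A" "d \<in> CP3_atlas" "q \<in> rep_dom c d f" using p q by (auto simp: patch_of_def)
  then show ?thesis using tot unfolding totally_real_def Let_def T_def by blast
qed

definition framed_everywhere :: "(complex^4) set \<Rightarrow> bool" where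
  "framed_everywhere W \<longleftrightarrow> (\<forall>c d i lin pr B. patch_of c d i lin pr B \<longrightarrow>
     (\<forall>q\<in>B. patch.framed i lin (rep c d f) W q))"

lemma isotropic_condition:
  assumes W: "plane W" "isotropic W"
    and fr: "framed_everywhere W"
    and p: "p \<in> W" "norm p = 1" "hopf p \<in> f ` topspace M" and XY: "X \<in> W" "Y \<in> W"
  shows "Im (om p X * cnj (om p Y)) = 0"
proof -
  obtain x where x: "x \<in> topspace M" "hopf p = f x" using p(3) by blast
  obtain c d i lin pr B q where pt: "patch_of c d i lin pr B" and q: "q \<in> B" "x = chart_inv c q"
    using point_in_patch[OF x(1)] by metis
  interpret patch i lin pr d B "rep c d f" using pt by (simp add: patch_of_def)
  have "hopf p = hopf (sgn (Z (rep c d f q)))" using x(2) q(2) f_patch[OF pt q(1)] by simp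
  then obtain e where "p = e *s sgn (Z (rep c d f q))" using hopf_eqD by metis
  then have "p = (e * of_real (1 / norm (Z (rep c d f q)))) *s Z (rep c d f q)"
    by (simp add: vec_sgn_smult smult_assoc)
  moreover have fq: "framed W q" using fr pt q(1) unfolding framed_everywhere_def by blast
  ultimately show ?thesis
    using real_totally_real[OF q(1) W fq patch_totally_real[OF pt q(1)] p(1,2) _ XY] by blast
qed

text \<open>As the image is open in \<open>proj W\<close>, the direction of
  \<open>p + s *\<^sub>R v\<close> still belongs to it for small \<open>s\<close>; the normalising
  factor is real and drops out.\<close>

lemma isotropic_condition_near:
  assumes W: "plane W" "isotropic W" and S: "openin (subtopology CP3 (proj W)) (f ` topspace M)"
    and fr: "framed_everywhere W"
    and p: "p \<in> W" "norm p = 1" "hopf p \<in> f ` topspace M" and v: "v \<in> W"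
  shows "\<exists>s>0. \<forall>X\<in>W. \<forall>Y\<in>W. Im (om (p + s *\<^sub>R v) X * cnj (om (p + s *\<^sub>R v) Y)) = 0"
proof -
  have sW: "subspace W" using W by (simp add: plane_def)
  obtain O' where O': "openin CP3 O'" "f ` topspace M = O' \<inter> proj W" using S by (auto simp: openin_subtopology)
  then obtain G where G: "open G" "{p \<in> sphere 0 1. hopf p \<in> O'} = sphere 0 1 \<inter> G"
    by (auto simp: openin_CP3 openin_open)
  have "p \<in> {p \<in> sphere 0 1. hopf p \<in> O'}" using p O'(2) by auto
  then have "p \<in> G" using G(2) by blast
  then obtain \<epsilon> where \<epsilon>: "\<epsilon> > 0" "ball p \<epsilon> \<subseteq> G" using G(1) openE by blast
  define g where "g s = (1 / norm (p + s *\<^sub>R v)) *\<^sub>R (p + s *\<^sub>R v)" for s :: real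
  have g0: "g 0 = p" using p(2) by (simp add: g_def)
  have "isCont g 0" unfolding g_def using p(2) by (intro continuous_intros) auto
  then obtain \<delta> where \<delta>: "\<delta> > 0" "\<And>s. dist s 0 < \<delta> \<Longrightarrow> dist (g s) p < min \<epsilon> 1"
    unfolding continuous_at_eps_delta g0 using \<epsilon>(1) by (metis min_less_iff_conj zero_less_one)
  define s where "s = \<delta> / 2"
  have s: "s > 0" "dist (g s) p < \<epsilon>" "dist (g s) p < 1" using \<delta>(1) \<delta>(2)[of s] by (auto simp: s_def)
  define w where "w = p + s *\<^sub>R v"
  have "g s \<noteq> 0" using s(3) p(2) by auto
  then have w0: "norm w \<noteq> 0" by (auto simp: g_def w_def)
  have gw: "g s = (1 / norm w) *\<^sub>R w" by (simp add: g_def w_def)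
  have n: "norm (g s) = 1" unfolding gw using w0 by simp
  have gW: "g s \<in> W" unfolding gw w_def by (intro subspace_scale subspace_add sW p v)
  have "g s \<in> G" using s(2) \<epsilon>(2) by (auto simp: dist_commute)
  then have "g s \<in> sphere 0 1 \<inter> G" using n by simp
  then have "hopf (g s) \<in> O'" unfolding G(2)[symmetric] by simp
  moreover have "hopf (g s) \<in> proj W" using gW n by (auto simp: proj_def)
  ultimately have "hopf (g s) \<in> f ` topspace M" using O'(2) by blast
  note c = isotropic_condition[OF W fr gW n this]
  show ?thesis
  proof (intro exI[of _ s] conjI ballI s(1))
    fix X Y assume XY: "X \<in> W" "Y \<in> W"
    have "om (g s) X * cnj (om (g s) Y) = of_real (1 / norm w * (1 / norm w)) * (om w X * cnj (om w Y))"
      unfolding gw om_scaleR by simp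
    then have "1 / norm w * (1 / norm w) * Im (om w X * cnj (om w Y)) = 0" using c[OF XY] by simp
    then show "Im (om (p + s *\<^sub>R v) X * cnj (om (p + s *\<^sub>R v) Y)) = 0" using w0 unfolding w_def by simp
  qed
qed

lemma classification:
  assumes ne: "topspace M \<noteq> {}"
  shows "\<not> minimal_surface A CP3_atlas g_NK f \<and>
      congruent_to_open_part CP3 CP3_atlas g_NK (f ` topspace M) model_CP1 \<or>
    minimal_surface A CP3_atlas g_NK f \<and>
      congruent_to_open_part CP3 CP3_atlas g_NK (f ` topspace M) (model_RP2 0)"
proof -
  obtain x where x: "x \<in> topspace M" using ne by blast
  obtain c d i lin pr B q where pt: "patch_of c d i lin pr B" and q: "q \<in> B" "x = chart_inv c q"
    using point_in_patch[OF x] by metis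
  interpret patch i lin pr d B "rep c d f" using pt by (simp add: patch_of_def)
  obtain W where W: "plane W" "framed W q" using plane_exists[OF q(1)] by metis
  note S = surface_in_plane[OF W(1) pt q(1) W(2)]
  have fr: "framed_everywhere W" unfolding framed_everywhere_def using S(2) by blast
  have sW: "subspace W" using W by (simp add: plane_def)
  have cd: "c \<in> A" "d \<in> CP3_atlas" "q \<in> rep_dom c d f" using pt q by (auto simp: patch_of_def)
  consider "complex_closed W" "dim W \<le> 4" | "isotropic W" "dim W \<le> 3" using W by (auto simp: plane_def)
  then show ?thesis
  proof cases
    case 1
    obtain p X where pX: "p \<in> W" "X \<in> W" "norm p = 1" "norm X = 1" "herm X p = 0"
      "(cmod (om p X))\<^sup>2 = 2 / 3" and mc: "mean_curvature (g_NK d) (rep c d f) q \<noteq> 0"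
      using complex_not_minimal[OF q(1) sW 1 W(2) patch_totally_real[OF pt q(1)]] by metis
    have "\<not> minimal_surface A CP3_atlas g_NK f" unfolding minimal_surface_def using cd mc by blast
    moreover obtain A' where A': "qunitary A'" "W = (\<lambda>w. 1 *s A' w) ` line0"
      using complex_normal_form[OF sW 1 pX] by metis
    have "congruent_to_open_part CP3 CP3_atlas g_NK (f ` topspace M) (proj line0)"
      by (rule qunitary_congruent[OF A'(1) _ A'(2) S(1,3)]) simp
    ultimately show ?thesis unfolding model_CP1_eq by blast
  next
    case 2
    obtain l X Y where l: "cmod l * norm (Z (rep c d f q)) = 1" "l *s Z (rep c d f q) \<in> W"
      and XY: "X \<in> W" "Y \<in> W" "norm X = 1" "norm Y = 1"
      "herm X (l *s Z (rep c d f q)) = 0" "herm Y (l *s Z (rep c d f q)) = 0" "herm Y X = 0"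
      using real_orthonormal_frame[OF q(1) W(1) 2(1) W(2)] by metis
    define p where "p = l *s Z (rep c d f q)"
    have p: "p \<in> W" "norm p = 1" using l by (simp_all add: p_def norm_smult)
    have "f x = hopf (sgn p)"
      unfolding q(2) f_patch[OF pt q(1)] p_def by (rule hopf_sgn_smult[symmetric]) (use l(1) in auto)
    then have hp: "hopf p \<in> f ` topspace M" using x p(2) by (auto simp: sgn_div_norm)
    have o1: "Im (om p X * cnj (om p Y)) = 0"
      by (rule isotropic_condition[OF W(1) 2(1) fr p hp XY(1,2)])
    \<comment> \<open>The condition at \<open>p + s *\<^sub>R X\<close> on the pair
      \<open>p\<close>, \<open>Y\<close> is a polynomial in \<open>s\<close> whose linear
      coefficient vanishes by \<open>o1\<close>, so the quadratic one vanishes too.\<close>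
    have o2: "Im (om p X * cnj (om X Y)) = 0"
    proof -
      obtain s where s: "s > 0" "\<forall>V\<in>W. \<forall>V'\<in>W. Im (om (p + s *\<^sub>R X) V * cnj (om (p + s *\<^sub>R X) V')) = 0"
        using isotropic_condition_near[OF W(1) 2(1) S(3) fr p hp XY(1)] by blast
      have "om (p + s *\<^sub>R X) p * cnj (om (p + s *\<^sub>R X) Y) =
         - of_real s * (om p X * cnj (om p Y)) - of_real (s * s) * (om p X * cnj (om X Y))"
        by (simp add: om_add om_scaleR om_swap[of X p] algebra_simps)
      then have "- s * Im (om p X * cnj (om p Y)) - s * s * Im (om p X * cnj (om X Y)) = 0"
        using bspec[OF bspec[OF s(2) p(1)] XY(2)] by simp
      then show ?thesis unfolding o1 using s(1) by simp
    qed
    \<comment> \<open>The same with the displacement along \<open>Y\<close> and the pair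
      \<open>X\<close>, \<open>p\<close>.\<close>
    have o3: "Im (om p Y * cnj (om X Y)) = 0"
    proof -
      obtain s where s: "s > 0" "\<forall>V\<in>W. \<forall>V'\<in>W. Im (om (p + s *\<^sub>R Y) V * cnj (om (p + s *\<^sub>R Y) V')) = 0"
        using isotropic_condition_near[OF W(1) 2(1) S(3) fr p hp XY(2)] by blast
      have "om (p + s *\<^sub>R Y) X * cnj (om (p + s *\<^sub>R Y) p) =
         - of_real s * (om p X * cnj (om p Y)) + of_real (s * s) * cnj (om p Y * cnj (om X Y))"
        by (simp add: om_add om_scaleR om_swap[of Y p] om_swap[of Y X] algebra_simps)
      then have "- s * Im (om p X * cnj (om p Y)) + s * s * Im (cnj (om p Y * cnj (om X Y))) = 0"
        using bspec[OF bspec[OF s(2) XY(1)] p(1)] by simp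
      then have "Im (cnj (om p Y * cnj (om X Y))) = 0" unfolding o1 using s(1) by simp
      then show ?thesis by simp
    qed
    obtain A' e where A': "qunitary A'" "cmod e = 1" "W = (\<lambda>w. e *s A' w) ` plane0"
      using real_normal_form[OF sW 2 p(1) XY(1,2) p(2) XY(3,4) XY(5,6)[folded p_def] XY(7) o1 o2 o3] by metis
    have "minimal_surface A CP3_atlas g_NK f" unfolding minimal_surface_def
    proof (intro ballI)
      fix c' d' q' assume "c' \<in> A" "d' \<in> CP3_atlas" "q' \<in> rep_dom c' d' f"
      then obtain B' i' lin' pr' where q': "q' \<in> B'" and pt': "patch_of c' d' i' lin' pr' B'"
        using patch_exists by metis
      interpret p': patch i' lin' pr' d' B' "rep c' d' f" using pt' by (simp add: patch_of_def)
      show "mean_curvature (g_NK d') (rep c' d' f) q' = 0"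
        by (rule p'.real_minimal[OF q' W(1) 2(1) S(2)[OF pt' q'] A'])
    qed
    moreover have "congruent_to_open_part CP3 CP3_atlas g_NK (f ` topspace M) (proj plane0)"
      by (rule qunitary_congruent[OF A' S(1,3)])
    ultimately show ?thesis unfolding model_RP2_eq by blast
  qed
qed

end

lemma qunitary_id: "qunitary (\<lambda>v. v)"
  by (simp add: qunitary_def)

theorem theorem7p1:
  fixes M :: "'m topology" and A :: "('m, real^2) chart set" and f :: "'m \<Rightarrow> (complex^4) set"
  assumes "smooth_manifold M A" and "connected_space M"
    and "immersion M A CP3 CP3_atlas f"
    and "totally_real A CP3_atlas g_NK J_NK f"
    and "totally_geodesic A CP3_atlas g_FS f"
  shows "(\<not> minimal_surface A CP3_atlas g_NK f \<longrightarrow>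
            congruent_to_open_part CP3 CP3_atlas g_NK (f ` topspace M) model_CP1) \<and>
         (minimal_surface A CP3_atlas g_NK f \<longrightarrow>
            (\<exists>c. congruent_to_open_part CP3 CP3_atlas g_NK (f ` topspace M) (model_RP2 c)))"
proof -
  interpret totally_real_surface M A f
    by (intro totally_real_surface.intro geodesic_surface.intro totally_real_surface_axioms.intro assms)
  show ?thesis
  proof (cases "topspace M = {}")
    \<comment> \<open>An empty space counts as connected. The surface is then vacuously minimal, and
      the identity isometry exhibits the empty set as an open part of the model.\<close>
    case True
    have "rep_dom c d f = {}" if "c \<in> A" for c and d :: CP3_chart
      using chart(5)[OF that] True by (auto simp: rep_dom_def)
    then have "minimal_surface A CP3_atlas g_NK f" by (simp add: minimal_surface_def)
    moreover have "congruent_to_open_part CP3 CP3_atlas g_NK (f ` topspace M) (model_RP2 0)"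
      unfolding congruent_to_open_part_def True using qunitary_isometry(1)[OF qunitary_id]
      by (intro exI conjI) auto
    ultimately show ?thesis by blast
  next
    case False
    then show ?thesis using classification by blast
  qed
qed

end
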